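(* Let $m,n$ be integers with $0\le m<n$ and let $q=2^e\ge 2$ with $e$ an integer, and suppose that the $e$th binary digits of both $m$ and $n$ are $1$. Then \[ L_{I_{m,n}}(1/q)<3q . \]
   Context: $P_j(x)=\frac{1}{2^j j!}\frac{d^j}{dx^j}(x^2-1)^j$ is the $j$th Legendre polynomial, $Q_j(X)=P_j(2X+1)$, and $I_{m,n}(X)=\frac1X\int_0^X Q_m(t)Q_n(t)\,dt$ (integrated term by term), which is a polynomial in $\mathbb{Q}[X]$ with $I_{m,n}(0)=1$. Binary digits are indexed starting with the units digit as digit $0$, so the $e$th digit is the coefficient of $2^e$. $\nu=\nu_2$ is the $2$-adic valuation, with $\nu(2)=1$ and $\nu(0)=+\infty$. For $F(X)=\sum_{k=0}^d c_kX^k\in\mathbb{Q}_2[X]$ with $c_0c_d\ne 0$, the $2$-adic Newton polygon $\operatorname{NP}_2(F)$ is the lower boundary of the convex hull of the points $(k,\nu(c_k))$ with $c_k\ne 0$; adjacent collinear segments are regarded as a single edge, and the length of an edge means its horizontal length. $L_F(\lambda)$ denotes the (horizontal) length of the edge of $\operatorname{NP}_2(F)$ of slope $\lambda$, with $L_F(\lambda)=0$ if there is no such edge. *)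

theory Defs
  imports "HOL-Analysis.Analysis" "HOL-Computational_Algebra.Computational_Algebra"
begin

definition legendre_poly :: "nat \<Rightarrow> rat poly" where
  "legendre_poly j = smult (1 / (2 ^ j * fact j)) ((pderiv ^^ j) ([:-1, 0, 1:] ^ j))"

definition Qpoly :: "nat \<Rightarrow> rat poly" where
  "Qpoly j = pcompose (legendre_poly j) [:1, 2:]"

definition poly_antideriv :: "rat poly \<Rightarrow> rat poly" where
  "poly_antideriv F = (\<Sum>k\<le>degree F. monom (coeff F k / of_nat (Suc k)) (Suc k))"

text \<open>The division by \<open>X\<close> is exact, since the antiderivative has no constant term.\<close>

definition Ipoly :: "nat \<Rightarrow> nat \<Rightarrow> rat poly" where
  "Ipoly m n = poly_antideriv (Qpoly m * Qpoly n) div [:0, 1:]"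

text \<open>The polynomials considered have rational coefficients, so the valuation and the Newton
  polygon are only defined over \<open>\<rat>\<close> rather than over \<open>\<rat>\<^sub>2\<close>.\<close>

definition nu2 :: "rat \<Rightarrow> ereal" where
  "nu2 x = (if x = 0 then \<infinity>
     else ereal (real (multiplicity 2 (fst (quotient_of x)))
               - real (multiplicity 2 (snd (quotient_of x)))))"

definition newton_points :: "rat poly \<Rightarrow> (real \<times> real) set" where
  "newton_points F = {(real k, y) | k y. coeff F k \<noteq> 0 \<and> nu2 (coeff F k) = ereal y}"

definition newton_polygon :: "rat poly \<Rightarrow> (real \<times> real) set" where
  "newton_polygon F =
     {(x, y). (x, y) \<in> convex hull newton_points F \<and>
              (\<forall>z. (x, z) \<in> convex hull newton_points F \<longrightarrow> y \<le> z)}"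

definition segment_of_slope :: "(real \<times> real) set \<Rightarrow> real \<Rightarrow> real \<times> real \<Rightarrow> real \<times> real \<Rightarrow> bool" where
  "segment_of_slope S s u v \<longleftrightarrow>
     fst u < fst v \<and> (snd v - snd u) / (fst v - fst u) = s \<and> closed_segment u v \<subseteq> S"

text \<open>Maximality of an edge encodes that adjacent collinear segments are merged.\<close>

definition newton_edge :: "rat poly \<Rightarrow> real \<Rightarrow> real \<times> real \<Rightarrow> real \<times> real \<Rightarrow> bool" where
  "newton_edge F s u v \<longleftrightarrow> segment_of_slope (newton_polygon F) s u v \<and>
     (\<forall>u' v'. segment_of_slope (newton_polygon F) s u' v' \<longrightarrow>
        closed_segment u v \<subseteq> closed_segment u' v' \<longrightarrow> u' = u \<and> v' = v)"

text \<open>By convexity there is at most one edge of a given slope, so \<open>THE\<close> below is well defined.\<close>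

definition edge_length :: "rat poly \<Rightarrow> real \<Rightarrow> real" where
  "edge_length F s =
     (if \<exists>u v. newton_edge F s u v
      then THE l. \<exists>u v. newton_edge F s u v \<and> l = fst v - fst u
      else 0)"

end

theory Submission
  imports Defs
begin

text \<open>
  Let \<open>w\<close> be the Gauss valuation on \<open>\<rat>(X)\<close> with \<open>w X = -1/q\<close>, \<open>q = 2^e\<close>; an edge of slope \<open>1/q\<close>
  is spanned by the monomials of minimal \<open>w\<close>. If digit \<open>e\<close> of \<open>n\<close> is \<open>1\<close>, then up to terms of larger
  \<open>w\<close> the polynomial \<open>Q\<^sub>n\<close> is a monomial times \<open>1 + 2 X^q\<close>, so \<open>G = Q\<^sub>m Q\<^sub>n\<close> is a monomial times
  \<open>1 + 4 X^(2q)\<close>. The point is that \<open>F = X I\<^sub>m\<^sub>,\<^sub>n\<close> is, again up to larger \<open>w\<close>, a monomial times \<open>G\<close>;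
  the edge then has length exactly \<open>2q\<close>.

  With \<open>z\<^sub>n = X (1 + X) Q\<^sub>n' / Q\<^sub>n\<close>, Legendre's equation gives \<open>F = G (z\<^sub>n - z\<^sub>m) / \<Delta>\<close> where
  \<open>\<Delta> = (n - m) (n + m + 1)\<close>, so everything reduces to the leading term of \<open>z\<^sub>n - z\<^sub>m\<close>. The contiguous
  relations turn one step \<open>n - 1 \<mapsto> n\<close> into an explicit Moebius map relating \<open>z\<^sub>n\<^sub>-\<^sub>1\<close> and \<open>z\<^sub>n\<close>, and
  induction along these steps gives \<open>z\<^sub>n - z\<^sub>m \<sim> (n - m) / 2\<close> if \<open>2q\<close> divides \<open>n - m\<close>, and otherwise
  \<open>z\<^sub>n - z\<^sub>m \<sim> 2^f X^(2^f)\<close> where \<open>2^f\<close> exactly divides \<open>\<Delta>\<close>.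
\<close>

section \<open>The 2-adic valuation and binary digit sums\<close>

text \<open>The coefficients of \<open>I_(m,n)\<close> are cancelling convolutions divided by
  indices, so their valuations cannot be read off termwise. The Wronskian identity removes the
  convolution, but \<open>z_n\<close> and \<open>z_m\<close> cancel as well; hence their difference,
  not each of them, is carried through a recursion. Two facts make this work. The residue field of 2
  has two elements, so a nonzero rational is known up to larger valuation once its valuation is
  known: signs and odd factors never matter, and leading terms are read off from digit sums by
  Kummer's theorem. Moreover \<open>Q_j - Q_(j-1)\<close> is \<open>2 X^(2^t) Q_(j-1)\<close> to
  leading order, where \<open>2^t\<close> exactly divides \<open>j\<close>; this is the origin of
  the exponents \<open>2^f\<close>. It is available when \<open>j mod 2q\<close> exceeds
  \<open>q\<close>, so the recursion runs in the upper half of one block of \<open>2q\<close>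
  indices, and indices of other blocks are first moved there by a multiple of \<open>2q\<close>. The
  parity of \<open>n - m\<close> decides where the recursion starts: at the left end of the
  half-block, or at a centre of symmetry \<open>c\<close>, where the pair is \<open>c\<close> and
  \<open>-c\<close>.\<close>

text \<open>Integer-valued variant of \<open>nu2\<close>; at \<open>0\<close> it takes the junk value \<open>0\<close>.\<close>

definition v2 :: "rat \<Rightarrow> int" where
  "v2 x = int (multiplicity 2 (fst (quotient_of x))) - int (multiplicity 2 (snd (quotient_of x)))"

lemma v2_divide_of_int:
  assumes "a \<noteq> 0" "b \<noteq> 0"
  shows "v2 (of_int a / of_int b) = int (multiplicity 2 a) - int (multiplicity 2 b)"
proof -
  obtain p r where pr: "quotient_of (of_int a / of_int b) = (p, r)"
    by (cases "quotient_of (of_int a / of_int b)") auto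
  then have r: "r > 0" and eq: "of_int a / of_int b = (of_int p / of_int r :: rat)"
    using quotient_of_denom_pos quotient_of_div by blast+
  have "of_int (a * r) = (of_int (p * b) :: rat)"
    using eq assms r by (simp add: field_simps)
  then have ar: "a * r = p * b"
    by (simp only: of_int_eq_iff)
  then have "p \<noteq> 0"
    using assms r by auto
  then have "multiplicity 2 a + multiplicity 2 r = multiplicity 2 p + multiplicity 2 b"
    using arg_cong[OF ar, of "multiplicity 2"] assms r
    by (simp add: prime_elem_multiplicity_mult_distrib)
  then show ?thesis
    by (simp add: v2_def pr)
qed

lemma v2_of_int: "v2 (of_int a) = int (multiplicity 2 a)"
  by (simp add: v2_def)

lemma v2_mult:
  assumes "x \<noteq> 0" "y \<noteq> 0"
  shows "v2 (x * y) = v2 x + v2 y"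
proof -
  obtain a b where x: "x = of_int a / of_int b" "b > 0"
    using quotient_of_div quotient_of_denom_pos by (metis surj_pair)
  obtain c d where y: "y = of_int c / of_int d" "d > 0"
    using quotient_of_div quotient_of_denom_pos by (metis surj_pair)
  have nz: "a \<noteq> 0" "c \<noteq> 0"
    using assms x y by auto
  have "x * y = of_int (a * c) / of_int (b * d)"
    by (simp add: x y)
  then show ?thesis
    using nz x(2) y(2)
    by (simp add: v2_divide_of_int x(1) y(1) prime_elem_multiplicity_mult_distrib del: of_int_mult)
qed

lemma v2_1 [simp]: "v2 1 = 0"
  by (simp add: v2_def)

lemma v2_2 [simp]: "v2 2 = 1"
  using v2_of_int[of 2] by simp

lemma v2_power: "x \<noteq> 0 \<Longrightarrow> v2 (x ^ n) = int n * v2 x"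
  by (induction n) (simp_all add: v2_mult algebra_simps)

lemma v2_minus [simp]: "v2 (- x) = v2 x"
proof (cases "x = 0")
  case False
  then have "v2 (- x) = v2 (-1) + v2 x"
    using v2_mult[of "-1" x] by simp
  moreover have "v2 (-1) = 0"
    using v2_of_int[of "-1"] by simp
  ultimately show ?thesis by simp
qed simp

lemma v2_divide:
  assumes "x \<noteq> 0" "y \<noteq> 0"
  shows "v2 (x / y) = v2 x - v2 y"
  using v2_mult[of "x / y" y] assms by simp

lemma v2_of_int_nonneg: "0 \<le> v2 (of_int a)"
  by (simp add: v2_of_int)

lemma v2_of_nat_nonneg: "0 \<le> v2 (of_nat a)"
  using v2_of_int_nonneg[of "int a"] by simp

lemma power2_dvd_iff_v2:
  assumes "a \<noteq> 0"
  shows "2 ^ t dvd a \<longleftrightarrow> int t \<le> v2 (of_int a)"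
  using assms by (simp add: v2_of_int power_dvd_iff_le_multiplicity)

lemma v2_odd: "odd a \<Longrightarrow> v2 (of_int a) = 0"
  by (simp add: v2_of_int not_dvd_imp_multiplicity_0)

lemma v2_add_ge:
  assumes "x \<noteq> 0" "y \<noteq> 0" "x + y \<noteq> 0"
  shows "min (v2 x) (v2 y) \<le> v2 (x + y)"
proof -
  obtain a b where x: "x = of_int a / of_int b" "b > 0"
    using quotient_of_div quotient_of_denom_pos by (metis surj_pair)
  obtain c d where y: "y = of_int c / of_int d" "d > 0"
    using quotient_of_div quotient_of_denom_pos by (metis surj_pair)
  define u v where "u = a * d" and "v = c * b"
  have x': "x = of_int u / of_int (b * d)" and y': "y = of_int v / of_int (b * d)"
    and xy: "x + y = of_int (u + v) / of_int (b * d)"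
    using x y by (simp_all add: u_def v_def field_simps)
  have nz: "u \<noteq> 0" "v \<noteq> 0" "u + v \<noteq> 0" "b * d \<noteq> 0"
    using assms x(2) y(2) x' y' xy by (auto simp del: of_int_add of_int_mult)
  let ?k = "min (multiplicity 2 u) (multiplicity 2 v)"
  have "2 ^ ?k dvd u" "2 ^ ?k dvd v"
    by (auto intro: multiplicity_dvd')
  then have "?k \<le> multiplicity 2 (u + v)"
    using nz by (intro multiplicity_geI) auto
  moreover have "v2 (x + y) = int (multiplicity 2 (u + v)) - int (multiplicity 2 (b * d))"
    unfolding xy by (rule v2_divide_of_int) (fact nz)+
  moreover have "v2 x = int (multiplicity 2 u) - int (multiplicity 2 (b * d))"
    "v2 y = int (multiplicity 2 v) - int (multiplicity 2 (b * d))"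
    by (subst x' y', rule v2_divide_of_int, (fact nz)+)+
  ultimately show ?thesis by linarith
qed

text \<open>The residue field at 2 has two elements: the quotient of two rationals of equal
  valuation is a ratio of odd integers. Later this allows a coefficient to be replaced by the power
  of 2 of the same valuation.\<close>

lemma v2_sub_ge:
  assumes "x \<noteq> 0" "y \<noteq> 0" "v2 x = c" "v2 y = c" "x - y \<noteq> 0"
  shows "c + 1 \<le> v2 (x - y)"
proof -
  define u where "u = x / y"
  have u: "u \<noteq> 0" "v2 u = 0"
    using assms by (simp_all add: u_def v2_divide)
  obtain p r where pr: "quotient_of u = (p, r)"
    by (cases "quotient_of u") auto
  then have r: "r > 0" and ueq: "u = of_int p / of_int r" and cop: "coprime p r"
    using quotient_of_denom_pos quotient_of_div quotient_of_coprime by blast+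
  have p0: "p \<noteq> 0"
    using u ueq by auto
  have meq: "multiplicity 2 p = multiplicity 2 r"
    using u(2) by (simp add: v2_def pr)
  have "\<not> (2 dvd p \<and> 2 dvd r)"
    using cop by (meson coprime_common_divisor odd_one)
  moreover have "even p \<longleftrightarrow> even r"
    using meq p0 r power_dvd_iff_le_multiplicity[of p 2 1] power_dvd_iff_le_multiplicity[of r 2 1]
    by simp
  ultimately have odd: "odd p" "odd r"
    by auto
  have "x - y = y * (of_int (p - r) / of_int r)"
    using assms(2) r ueq unfolding u_def by (simp add: field_simps)
  moreover have pr0: "p - r \<noteq> 0"
    using calculation assms(5) by auto
  ultimately have "v2 (x - y) = c + v2 (of_int (p - r) / of_int r)"
    using assms r v2_mult[of y "of_int (p - r) / of_int r"] by (simp del: of_int_diff)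
  also have "v2 (of_int (p - r) / of_int r) = int (multiplicity 2 (p - r))"
    using pr0 r odd by (simp add: v2_divide_of_int not_dvd_imp_multiplicity_0 del: of_int_diff)
  also have "multiplicity 2 (p - r) \<ge> 1"
    using odd pr0 by (intro multiplicity_geI) auto
  then have "c + int (multiplicity 2 (p - r)) \<ge> c + 1" by simp
  finally show ?thesis .
qed

section \<open>Binary digit sums and the formulas of Legendre and Kummer\<close>

fun digit_sum :: "nat \<Rightarrow> nat" where
  "digit_sum n = (if n = 0 then 0 else n mod 2 + digit_sum (n div 2))"

declare digit_sum.simps [simp del]

lemma digit_sum_0 [simp]: "digit_sum 0 = 0"
  by (simp add: digit_sum.simps)

lemma digit_sum_double [simp]: "digit_sum (2 * n) = digit_sum n"
  by (cases "n = 0") (simp_all add: digit_sum.simps[of "2 * n"])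

lemma digit_sum_Suc_double [simp]: "digit_sum (Suc (2 * n)) = Suc (digit_sum n)"
  by (simp add: digit_sum.simps[of "Suc (2 * n)"])

lemma digit_sum_1 [simp]: "digit_sum (Suc 0) = 1"
  using digit_sum_Suc_double[of 0] by simp

text \<open>Incrementing turns the trailing ones of \<open>n\<close>, of which there are
  \<open>v2 (Suc n)\<close>, into zeros and the next digit into a one. The induction strips the last
  digit.\<close>

lemma digit_sum_Suc: "int (digit_sum (Suc n)) + v2 (of_nat (Suc n)) = int (digit_sum n) + 1"
proof (induction n rule: less_induct)
  case (less n)
  show ?case
  proof (cases "even n")
    case True
    then obtain k where "n = 2 * k" by auto
    moreover have "v2 (of_nat (Suc n)) = 0"
      using v2_odd[of "int (Suc n)"] True by simp
    ultimately show ?thesis by simp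
  next
    case False
    then obtain k where k: "n = Suc (2 * k)" by (auto elim: oddE)
    have "Suc n = 2 * Suc k" using k by simp
    then have "v2 (of_nat (Suc n)) = 1 + v2 (of_nat (Suc k))" "digit_sum (Suc n) = digit_sum (Suc k)"
      using v2_mult[of 2 "of_nat (Suc k)"] by (simp_all only: of_nat_mult digit_sum_double, simp_all)
    then show ?thesis
      using less[of k] k by simp
  qed
qed

lemma v2_fact: "v2 (fact n) = int n - int (digit_sum n)"
proof (induction n)
  case (Suc n)
  have "v2 (fact (Suc n)) = v2 (of_nat (Suc n)) + v2 (fact n)"
    by (subst fact_Suc, subst v2_mult) (simp_all del: of_nat_Suc)
  then show ?case
    using Suc digit_sum_Suc[of n] by simp
qed simp

text \<open>Kummer's theorem, with the number of carries in \<open>a + b\<close> written as a defect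
  of digit sums.\<close>

lemma v2_binomial:
  "v2 (of_nat ((a + b) choose a)) = int (digit_sum a) + int (digit_sum b) - int (digit_sum (a + b))"
proof -
  have "of_nat ((a + b) choose a) = (fact (a + b) / (fact a * fact b) :: rat)"
    by (simp add: binomial_fact)
  then show ?thesis
    by (simp add: v2_divide v2_mult v2_fact)
qed

lemma digit_sum_add_le: "digit_sum (a + b) \<le> digit_sum a + digit_sum b"
  using v2_binomial[of a b] v2_of_nat_nonneg[of "(a + b) choose a"] by linarith

lemma digit_sum_pos: "n > 0 \<Longrightarrow> digit_sum n \<ge> 1"
proof (induction n rule: less_induct)
  case (less n)
  then show ?case
    by (cases "even n") (auto elim!: evenE oddE)
qed

lemma digit_sum_le: "digit_sum n \<le> n"
proof (induction n rule: less_induct)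
  case (less n)
  have "n div 2 < n" if "n \<noteq> 0" using that by simp
  then have "n \<noteq> 0 \<Longrightarrow> digit_sum (n div 2) \<le> n div 2" using less by blast
  then show ?case
    by (subst digit_sum.simps) (cases "even n"; auto elim!: evenE oddE)
qed

lemma digit_sum_pow2_mult_add: "b < 2 ^ j \<Longrightarrow> digit_sum (2 ^ j * a + b) = digit_sum a + digit_sum b"
proof (induction j arbitrary: b)
  case (Suc j)
  define c d where "c = b div 2" and "d = b mod 2"
  have b: "b = 2 * c + d" "d < 2" by (simp_all add: c_def d_def)
  have c: "c < 2 ^ j" using Suc.prems b by simp
  have eq: "2 ^ Suc j * a + b = 2 * (2 ^ j * a + c) + d"
    using b by (simp add: algebra_simps)
  have "d = 0 \<or> d = 1" using b by auto
  then show ?case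
    unfolding eq using Suc.IH[OF c] b(1) digit_sum_double[of "2 ^ j * a + c"]
      digit_sum_Suc_double[of "2 ^ j * a + c"]
    by (auto simp del: digit_sum_double digit_sum_Suc_double simp: digit_sum_double[of c] digit_sum_Suc_double[of c])
qed simp

lemma digit_sum_power2: "digit_sum (2 ^ j) = 1"
  using digit_sum_pow2_mult_add[of 0 j 1] by simp

lemma digit_sum_eq_1:
  assumes "digit_sum n = 1"
  shows "\<exists>j. n = 2 ^ j"
  using assms
proof (induction n rule: less_induct)
  case (less n)
  show ?case
  proof (cases "even n")
    case True
    then obtain k where k: "n = 2 * k" by auto
    with less.prems have "k < n" "digit_sum k = 1" by (auto intro: Nat.gr0I)
    with less.IH obtain j where "k = 2 ^ j" by blast
    then show ?thesis using k by (intro exI[of _ "Suc j"]) simp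
  next
    case False
    then obtain k where k: "n = Suc (2 * k)" by (auto elim: oddE)
    with less.prems have "digit_sum k = 0" by simp
    with digit_sum_pos[of k] have "k = 0" by (cases "k = 0") auto
    then show ?thesis using k by (intro exI[of _ 0]) simp
  qed
qed

section \<open>The Gauss valuation on rational functions\<close>

text \<open>Zero counts as having infinite valuation here, in contrast to the value
  \<open>v2 0 = 0\<close>.\<close>

definition kge :: "nat \<Rightarrow> rat \<Rightarrow> int \<Rightarrow> bool" where
  "kge q x c \<longleftrightarrow> (x \<noteq> 0 \<longrightarrow> c \<le> int q * v2 x)"

lemma kge_0 [simp]: "kge q 0 c"
  by (simp add: kge_def)

lemma kge_mono: "kge q x c \<Longrightarrow> d \<le> c \<Longrightarrow> kge q x d"
  by (auto simp: kge_def)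

lemma kge_add: "kge q x c \<Longrightarrow> kge q y c \<Longrightarrow> kge q (x + y) c"
proof (cases "x = 0 \<or> y = 0 \<or> x + y = 0")
  case False
  assume a: "kge q x c" "kge q y c"
  have "int q * min (v2 x) (v2 y) \<le> int q * v2 (x + y)"
    using v2_add_ge False by (intro mult_left_mono) auto
  moreover have "c \<le> int q * min (v2 x) (v2 y)"
    using a False by (simp add: kge_def min_def)
  ultimately show ?thesis by (simp add: kge_def)
qed auto

lemma kge_mult: "kge q x c \<Longrightarrow> kge q y d \<Longrightarrow> kge q (x * y) (c + d)"
  by (auto simp: kge_def v2_mult algebra_simps)

lemma kge_minus [simp]: "kge q (- x) c \<longleftrightarrow> kge q x c"
  by (simp add: kge_def)

lemma kge_sum: "(\<And>i. i \<in> A \<Longrightarrow> kge q (f i) c) \<Longrightarrow> kge q (sum f A) c"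
  by (induction A rule: infinite_finite_induct) (auto intro: kge_add)

text \<open>The monomial \<open>a X^k\<close> has scaled weight \<open>q * v2 a - k\<close>; with
  \<open>k\<close> moved to the other side, vanishing coefficients are covered too.\<close>

definition poly_ge :: "nat \<Rightarrow> rat poly \<Rightarrow> int \<Rightarrow> bool" where
  "poly_ge q P c \<longleftrightarrow> (\<forall>k. kge q (coeff P k) (c + int k))"

text \<open>The Gauss valuation at radius \<open>|X| = 2 ^ (1/q)\<close>, scaled by \<open>q\<close> so that it is
  integer-valued and strict inequalities become shifts by one.\<close>

definition gauss :: "nat \<Rightarrow> rat poly \<Rightarrow> int" where
  "gauss q P = Min ((\<lambda>k. int q * v2 (coeff P k) - int k) ` {k. coeff P k \<noteq> 0})"

lemma finite_support: "finite {k. coeff P k \<noteq> 0}"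
  by (rule finite_subset[of _ "{..degree P}"]) (auto intro: le_degree)

lemma support_nonempty: "P \<noteq> 0 \<Longrightarrow> {k. coeff P k \<noteq> 0} \<noteq> {}"
  using leading_coeff_neq_0 by blast

lemma poly_ge_iff: "P \<noteq> 0 \<Longrightarrow> poly_ge q P c \<longleftrightarrow> c \<le> gauss q P"
  unfolding gauss_def using finite_support support_nonempty
  by (subst Min_ge_iff) (auto simp: poly_ge_def kge_def algebra_simps)

lemma gauss_attained:
  assumes "P \<noteq> 0"
  shows "\<exists>k. coeff P k \<noteq> 0 \<and> int q * v2 (coeff P k) - int k = gauss q P"
proof -
  have "gauss q P \<in> (\<lambda>k. int q * v2 (coeff P k) - int k) ` {k. coeff P k \<noteq> 0}"
    unfolding gauss_def using finite_support support_nonempty assms by (intro Min_in) auto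
  then show ?thesis by auto
qed

lemma poly_ge_0 [simp]: "poly_ge q 0 c"
  by (simp add: poly_ge_def)

lemma poly_ge_add: "poly_ge q P c \<Longrightarrow> poly_ge q R c \<Longrightarrow> poly_ge q (P + R) c"
  by (auto simp: poly_ge_def intro: kge_add)

lemma poly_ge_mult:
  assumes "poly_ge q P c" "poly_ge q R d"
  shows "poly_ge q (P * R) (c + d)"
  unfolding poly_ge_def
proof
  fix k
  show "kge q (coeff (P * R) k) (c + d + int k)"
    unfolding coeff_mult
  proof (rule kge_sum)
    fix i assume "i \<in> {..k}"
    then have "(c + int i) + (d + int (k - i)) = c + d + int k" by auto
    moreover have "kge q (coeff P i * coeff R (k - i)) ((c + int i) + (d + int (k - i)))"
      using assms by (intro kge_mult) (auto simp: poly_ge_def)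
    ultimately show "kge q (coeff P i * coeff R (k - i)) (c + d + int k)" by (simp only:)
  qed
qed

text \<open>Gauss's lemma: the product of the first coefficients attaining the two minima cannot be
  cancelled.\<close>

lemma gauss_mult:
  assumes "P \<noteq> 0" "R \<noteq> 0"
  shows "gauss q (P * R) = gauss q P + gauss q R"
proof (rule antisym)
  have nz: "P * R \<noteq> 0" using assms by simp
  show "gauss q P + gauss q R \<le> gauss q (P * R)"
    using poly_ge_mult[of q P "gauss q P" R "gauss q R"] poly_ge_iff nz assms by blast
  let ?att = "\<lambda>P k. coeff P k \<noteq> 0 \<and> int q * v2 (coeff P k) - int k = gauss q P"
  define i0 where "i0 = (LEAST k. ?att P k)"
  define j0 where "j0 = (LEAST k. ?att R k)"
  have i0: "?att P i0" unfolding i0_def by (rule LeastI_ex) (rule gauss_attained[OF assms(1)])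
  have j0: "?att R j0" unfolding j0_def by (rule LeastI_ex) (rule gauss_attained[OF assms(2)])
  have P_ge: "kge q (coeff P k) (gauss q P + int k)" for k
    using poly_ge_iff[OF assms(1), of q "gauss q P"] by (simp add: poly_ge_def)
  have R_ge: "kge q (coeff R k) (gauss q R + int k)" for k
    using poly_ge_iff[OF assms(2), of q "gauss q R"] by (simp add: poly_ge_def)
  have P_gt: "kge q (coeff P k) (gauss q P + int k + 1)" if "k < i0" for k
    using not_less_Least[OF that[unfolded i0_def]] P_ge[of k] by (auto simp: kge_def)
  have R_gt: "kge q (coeff R k) (gauss q R + int k + 1)" if "k < j0" for k
    using not_less_Least[OF that[unfolded j0_def]] R_ge[of k] by (auto simp: kge_def)
  define M where "M = gauss q P + gauss q R + int (i0 + j0)"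
  define main where "main = coeff P i0 * coeff R j0"
  define rest where "rest = (\<Sum>i\<in>{..i0 + j0} - {i0}. coeff P i * coeff R (i0 + j0 - i))"
  have split: "coeff (P * R) (i0 + j0) = main + rest"
    unfolding coeff_mult main_def rest_def by (subst sum.remove[of _ i0]) auto
  have "kge q rest (M + 1)"
    unfolding rest_def
  proof (rule kge_sum)
    fix i assume i: "i \<in> {..i0 + j0} - {i0}"
    show "kge q (coeff P i * coeff R (i0 + j0 - i)) (M + 1)"
    proof (cases "i < i0")
      case True
      have "kge q (coeff P i * coeff R (i0 + j0 - i))
          ((gauss q P + int i + 1) + (gauss q R + int (i0 + j0 - i)))"
        by (rule kge_mult[OF P_gt[OF True] R_ge])
      then show ?thesis using i by (auto simp: M_def of_nat_diff elim!: kge_mono)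
    next
      case False
      then have j: "i0 + j0 - i < j0" using i by auto
      have "kge q (coeff P i * coeff R (i0 + j0 - i))
          ((gauss q P + int i) + (gauss q R + int (i0 + j0 - i) + 1))"
        by (rule kge_mult[OF P_ge R_gt[OF j]])
      then show ?thesis using i by (auto simp: M_def of_nat_diff elim!: kge_mono)
    qed
  qed
  moreover have "main \<noteq> 0" "int q * v2 main = M"
    using i0 j0 by (auto simp: main_def M_def v2_mult algebra_simps)
  ultimately have *: "\<not> kge q (main + rest) (M + 1)"
    using kge_add[of q "main + rest" "M + 1" "- rest"] by (auto simp: kge_def)
  show "gauss q (P * R) \<le> gauss q P + gauss q R"
  proof (rule ccontr)
    assume "\<not> ?thesis"
    then have "gauss q P + gauss q R + 1 \<le> gauss q (P * R)" by simp
    then have "poly_ge q (P * R) (gauss q P + gauss q R + 1)"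
      using poly_ge_iff[OF nz] by blast
    then have "kge q (coeff (P * R) (i0 + j0)) (gauss q P + gauss q R + 1 + int (i0 + j0))"
      by (simp only: poly_ge_def)
    with * show False by (simp add: split M_def algebra_simps)
  qed
qed

section \<open>The Gauss valuation on the fraction field\<close>

definition wval :: "nat \<Rightarrow> rat poly fract \<Rightarrow> int" where
  "wval q x = (SOME c. \<exists>a b. a \<noteq> 0 \<and> b \<noteq> 0 \<and> x = Fraction_Field.Fract a b \<and> c = gauss q a - gauss q b)"

text \<open>Independence of the representation is multiplicativity of \<open>gauss\<close>, applied
  to \<open>a * b' = a' * b\<close>. Zero has no admissible representation, so bounds are stated
  through \<open>wge\<close> below.\<close>

lemma wval_Fract:
  assumes "a \<noteq> 0" "b \<noteq> 0"
  shows "wval q (Fraction_Field.Fract a b) = gauss q a - gauss q b"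
  unfolding wval_def
proof (rule some_equality)
  fix c assume "\<exists>a' b'. a' \<noteq> 0 \<and> b' \<noteq> 0 \<and> Fraction_Field.Fract a b = Fraction_Field.Fract a' b' \<and> c = gauss q a' - gauss q b'"
  then obtain a' b' where h: "a' \<noteq> 0" "b' \<noteq> 0" "a * b' = a' * b" "c = gauss q a' - gauss q b'"
    using assms by (auto simp: eq_fract)
  then have "gauss q a + gauss q b' = gauss q a' + gauss q b"
    using gauss_mult assms by metis
  then show "c = gauss q a - gauss q b" using h by simp
qed (use assms in blast)

lemma fract_nz_cases:
  assumes "x \<noteq> 0"
  obtains a b where "x = Fraction_Field.Fract a b" "a \<noteq> 0" "b \<noteq> 0"
  using assms by (cases x rule: Fract_cases_nonzero) auto

lemma wval_mult:
  assumes "x \<noteq> 0" "y \<noteq> 0"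
  shows "wval q (x * y) = wval q x + wval q y"
proof -
  obtain a b c d where "x = Fraction_Field.Fract a b" "a \<noteq> 0" "b \<noteq> 0"
    "y = Fraction_Field.Fract c d" "c \<noteq> 0" "d \<noteq> 0"
    using assms by (metis fract_nz_cases)
  then show ?thesis
    by (simp add: wval_Fract gauss_mult)
qed

lemma wval_1 [simp]: "wval q 1 = 0"
  using wval_mult[of 1 1 q] by simp

lemma wval_inverse: "x \<noteq> 0 \<Longrightarrow> wval q (inverse x) = - wval q x"
  using wval_mult[of x "inverse x" q] by simp

lemma wval_divide: "x \<noteq> 0 \<Longrightarrow> y \<noteq> 0 \<Longrightarrow> wval q (x / y) = wval q x - wval q y"
  by (simp add: divide_inverse wval_mult wval_inverse)

lemma wval_power: "x \<noteq> 0 \<Longrightarrow> wval q (x ^ n) = int n * wval q x"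
  by (induction n) (simp_all add: wval_mult algebra_simps)

lemma wval_to_fract: "P \<noteq> 0 \<Longrightarrow> wval q (to_fract P) = gauss q P"
proof -
  assume "P \<noteq> 0"
  moreover have "gauss q 1 = 0"
    using gauss_mult[of 1 1 q] by simp
  ultimately show ?thesis by (simp add: to_fract_def wval_Fract)
qed

definition wge :: "nat \<Rightarrow> rat poly fract \<Rightarrow> int \<Rightarrow> bool" where
  "wge q x c \<longleftrightarrow> (x \<noteq> 0 \<longrightarrow> c \<le> wval q x)"

lemma wge_0 [simp]: "wge q 0 c"
  by (simp add: wge_def)

lemma wge_mono: "wge q x c \<Longrightarrow> d \<le> c \<Longrightarrow> wge q x d"
  by (auto simp: wge_def)

lemma wge_to_fract: "wge q (to_fract P) c \<longleftrightarrow> poly_ge q P c"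
  by (cases "P = 0") (simp_all add: wge_def wval_to_fract poly_ge_iff)

lemma wge_mult: "wge q x c \<Longrightarrow> wge q y d \<Longrightarrow> wge q (x * y) (c + d)"
  by (auto simp: wge_def wval_mult)

lemma wge_mult_le: "wge q x c \<Longrightarrow> wge q y d \<Longrightarrow> b \<le> c + d \<Longrightarrow> wge q (x * y) b"
  using wge_mult wge_mono by blast

lemma wge_add:
  assumes "wge q x c" "wge q y c"
  shows "wge q (x + y) c"
proof (cases "x = 0 \<or> y = 0")
  case False
  obtain a b where x: "x = Fraction_Field.Fract a b" "a \<noteq> 0" "b \<noteq> 0"
    using False by (metis fract_nz_cases)
  obtain d e where y: "y = Fraction_Field.Fract d e" "d \<noteq> 0" "e \<noteq> 0"
    using False by (metis fract_nz_cases)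
  have "poly_ge q (a * e) (c + (gauss q b + gauss q e))" "poly_ge q (d * b) (c + (gauss q b + gauss q e))"
    using assms x y by (auto simp: wge_def wval_Fract poly_ge_iff gauss_mult eq_fract Zero_fract_def)
  then have "poly_ge q (a * e + d * b) (c + (gauss q b + gauss q e))"
    by (rule poly_ge_add)
  moreover have "x + y = Fraction_Field.Fract (a * e + d * b) (b * e)"
    using x y by simp
  ultimately show ?thesis
    using x y by (cases "a * e + d * b = 0")
      (auto simp: wge_def wval_Fract poly_ge_iff gauss_mult fract_collapse)
qed (use assms in auto)

lemma wval_minus_1 [simp]: "wval q (- 1) = 0"
  using wval_mult[of "-1" "-1" q] by simp

lemma wge_minus [simp]: "wge q (- x) c \<longleftrightarrow> wge q x c"
  using wval_mult[of "-1" x q] by (auto simp: wge_def)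

lemma wge_diff: "wge q x c \<Longrightarrow> wge q y c \<Longrightarrow> wge q (x - y) c"
  using wge_add[of q x c "- y"] by simp

lemma wge_power: "wge q x c \<Longrightarrow> wge q (x ^ n) (int n * c)"
  by (cases "x = 0")
    (auto simp: wge_def wval_power zero_power intro!: mult_left_mono split: if_splits)

lemma wge_divide: "wge q x c \<Longrightarrow> y \<noteq> 0 \<Longrightarrow> wge q (x / y) (c - wval q y)"
  by (cases "x = 0") (auto simp: wge_def wval_divide)

text \<open>The strict ultrametric inequality; as scaled valuations are integers, strictness is a
  shift by one.\<close>

lemma wval_add_eq:
  assumes "x \<noteq> 0" "wge q y (wval q x + 1)"
  shows "x + y \<noteq> 0" "wval q (x + y) = wval q x"
proof -
  have "\<not> wge q (x + y) (wval q x + 1)"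
    using wge_diff[of q "x + y" "wval q x + 1" y] assms by (auto simp: wge_def)
  moreover have "wge q (x + y) (wval q x)"
    using assms by (intro wge_add) (auto simp: wge_def)
  ultimately show "x + y \<noteq> 0" "wval q (x + y) = wval q x"
    by (auto simp: wge_def)
qed

lemma gauss_monom:
  assumes "c \<noteq> 0"
  shows "gauss q (monom c k) = int q * v2 c - int k"
  using gauss_attained[of "monom c k" q] assms by (auto split: if_splits)

lemma of_int_fract: "(of_int n :: rat poly fract) = to_fract (monom (of_int n) 0)"
proof -
  have nat: "(of_nat n :: rat poly fract) = to_fract (monom (of_nat n) 0)" for n
    by (simp add: to_fract_def of_nat_fract of_nat_poly monom_0)
  show ?thesis
  proof (cases "n \<ge> 0")
    case True
    then obtain k where "n = int k" by (metis nonneg_int_cases)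
    then show ?thesis by (simp add: nat)
  next
    case False
    then obtain k where n: "n = - int k" by (metis nle_le neg_le_0_iff_le nonneg_int_cases minus_equation_iff)
    show ?thesis
      by (simp only: n of_int_minus of_int_of_nat_eq nat minus_monom[symmetric] to_fract_uminus)
  qed
qed

lemma wval_of_int: "n \<noteq> 0 \<Longrightarrow> wval q (of_int n) = int q * v2 (of_int n)"
  by (simp add: of_int_fract wval_to_fract gauss_monom)

lemma wval_of_nat: "n > 0 \<Longrightarrow> wval q (of_nat n) = int q * v2 (of_nat n)"
  using wval_of_int[of "int n"] by simp

lemma wval_2 [simp]: "wval q 2 = int q"
  using wval_of_int[of 2] by simp

definition Xf :: "rat poly fract" where
  "Xf = to_fract [:0, 1:]"

lemma Xf_nz [simp]: "Xf \<noteq> 0"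
  by (simp add: Xf_def)

lemma wval_Xf [simp]: "wval q Xf = -1"
  using gauss_monom[of 1 q 1] by (simp add: Xf_def wval_to_fract monom_altdef)

lemma to_fract_monom_1: "to_fract (monom 1 k) = Xf ^ k"
proof (induction k)
  case (Suc k)
  have "monom 1 (Suc k) = [:0, 1 :: rat:] * monom 1 k" by (simp add: monom_Suc)
  then show ?case by (simp only: to_fract_mult Suc Xf_def power_Suc)
qed (simp add: one_pCons[symmetric])

lemma two_nz: "(2 :: rat poly fract) \<noteq> 0"
  using of_int_fract[of 2] by simp

section \<open>Shifted Legendre polynomials\<close>

definition lcoef :: "nat \<Rightarrow> nat \<Rightarrow> nat" where
  "lcoef n k = (n choose k) * ((n + k) choose k)"

lemma higher_pderiv_pcompose_linear:
  "(pderiv ^^ j) (pcompose P [:1, 2:]) = smult (2 ^ j) (pcompose ((pderiv ^^ j) P) [:1, 2 :: rat:])"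
proof (induction j)
  case (Suc j)
  have "pderiv [:1, 2 :: rat:] = [:2:]"
    by (simp add: pderiv_pCons)
  then show ?case
    using Suc by (simp add: pderiv_smult pderiv_pcompose mult.commute)
qed simp

text \<open>Under \<open>x = 2X + 1\<close> the base \<open>x^2 - 1\<close> of Rodrigues' formula
  becomes \<open>4 X (X + 1)\<close>. The factor \<open>4^n\<close> cancels against the
  \<open>2^n\<close> of the formula and the \<open>2^n\<close> of the chain rule, leaving the
  \<open>n\<close>th derivative of \<open>X^n (1 + X)^n\<close> over \<open>n!\<close>.\<close>

lemma coeff_Qpoly: "coeff (Qpoly n) k = of_nat (lcoef n k)"
proof -
  let ?x = "[:1, 2 :: rat:]"
  have "pcompose ([:-1, 0, 1:] ^ n) ?x = (pcompose [:-1, 0, 1:] ?x) ^ n"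
    by (induction n) (simp_all add: pcompose_mult pcompose_1 del: mult_pCons_left)
  also have "pcompose [:-1, 0, 1:] ?x = smult 4 ([:0, 1:] * [:1, 1:])"
    by (simp add: pcompose_pCons)
  finally have base: "pcompose ([:-1, 0, 1:] ^ n) ?x = smult (4 ^ n) (monom 1 n * [:1, 1:] ^ n)"
    by (simp add: smult_power power_mult_distrib monom_altdef del: mult_pCons_left mult_pCons_right)
  let ?B = "monom 1 n * [:1, 1 :: rat:] ^ n"
  have "smult (2 ^ n) (pcompose ((pderiv ^^ n) ([:-1, 0, 1:] ^ n)) ?x) = smult (4 ^ n) ((pderiv ^^ n) ?B)"
    by (simp only: higher_pderiv_pcompose_linear[symmetric] base higher_pderiv_smult)
  then have "2 ^ n * coeff (pcompose ((pderiv ^^ n) ([:-1, 0, 1:] ^ n)) ?x) k = 4 ^ n * coeff ((pderiv ^^ n) ?B) k"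
    by (metis coeff_smult)
  moreover have "coeff (Qpoly n) k = 1 / (2 ^ n * fact n) * coeff (pcompose ((pderiv ^^ n) ([:-1, 0, 1:] ^ n)) ?x) k"
    by (simp add: Qpoly_def legendre_poly_def pcompose_smult)
  moreover have "coeff ((pderiv ^^ n) ?B) k = pochhammer (of_nat (Suc k)) n * of_nat (n choose k)"
    by (cases "k \<le> n")
      (simp_all add: coeff_higher_pderiv coeff_monom_mult coeff_linear_poly_power
        coeff_eq_0 degree_linear_power binomial_eq_0)
  moreover have "(4 :: rat) ^ n = 2 ^ n * 2 ^ n"
    by (simp flip: power_mult_distrib)
  moreover have "pochhammer (of_nat (Suc k)) n = (fact (n + k) / fact k :: rat)"
  proof -
    have "fact (k + n) = fact k * pochhammer (1 + of_nat k) (n :: nat) * (1 :: rat)"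
      using pochhammer_product'[of "1 :: rat" k n] by (simp add: pochhammer_fact)
    then show ?thesis by (simp add: add.commute[of n k])
  qed
  moreover have "of_nat ((n + k) choose k) = (fact (n + k) / (fact k * fact n) :: rat)"
    by (simp add: binomial_fact)
  ultimately have "coeff (Qpoly n) k * (fact n * fact k) = of_nat (lcoef n k) * (fact n * fact k)"
    by (simp add: lcoef_def)
  then show ?thesis by simp
qed

lemma lcoef_0 [simp]: "lcoef n 0 = 1"
  by (simp add: lcoef_def)

lemma lcoef_eq_0_iff: "lcoef n k = 0 \<longleftrightarrow> n < k"
  by (simp add: lcoef_def)

text \<open>This form isolates a central binomial coefficient, whose valuation is the digit sum of
  \<open>k\<close>; it yields a lower bound uniform in \<open>n\<close>.\<close>

lemma lcoef_altdef: "lcoef n k = ((n + k) choose (2 * k)) * ((2 * k) choose k)"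
proof (cases "k \<le> n")
  case True
  have "((n + k) choose k) * (n choose k) = ((n + k) choose (2 * k)) * ((2 * k) choose k)"
    using choose_mult[of k "2 * k" "n + k"] True by simp
  then show ?thesis by (simp add: lcoef_def mult.commute)
next
  case False
  then have "n + k < 2 * k" by simp
  with False show ?thesis by (simp add: lcoef_def binomial_eq_0)
qed

text \<open>Kept free of division, the recursion also holds for \<open>k \<ge> n\<close>, where both
  sides vanish.\<close>

lemma lcoef_Suc:
  "(of_nat (Suc k))\<^sup>2 * of_nat (lcoef n (Suc k)) = (of_nat n + of_nat k + 1) * (of_nat n - of_nat k) * (of_nat (lcoef n k) :: rat)"
proof (cases "k < n")
  case True
  have "Suc k * (n choose Suc k) = (n - k) * (n choose k)"
    using binomial_absorb_comp[of n k] binomial_absorption[of k n] True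
    by (simp add: binomial_absorption binomial_absorb_comp)
  moreover have "Suc k * ((n + Suc k) choose Suc k) = (n + Suc k) * ((n + k) choose k)"
    using binomial_absorption[of k "n + Suc k"] by simp
  ultimately have "(Suc k)\<^sup>2 * lcoef n (Suc k) = (n + Suc k) * (n - k) * lcoef n k"
    unfolding lcoef_def power2_eq_square by (metis (no_types, lifting) mult.assoc mult.left_commute)
  then have "(of_nat ((Suc k)\<^sup>2 * lcoef n (Suc k)) :: rat) = of_nat ((n + Suc k) * (n - k) * lcoef n k)"
    by (simp only:)
  moreover have "(of_nat (n - k) :: rat) = of_nat n - of_nat k"
    using True by (simp add: of_nat_diff)
  ultimately show ?thesis
    by (simp only: of_nat_mult of_nat_power of_nat_add of_nat_Suc add.assoc[symmetric] add.commute[of 1])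
next
  case False
  then have "lcoef n (Suc k) = 0" "k = n \<or> lcoef n k = 0"
    by (auto simp: lcoef_eq_0_iff)
  then show ?thesis by auto
qed

lemma lcoef_pred:
  assumes "n \<ge> 1"
  shows "(of_nat n + of_nat k) * of_nat (lcoef (n - 1) k) = (of_nat n - of_nat k) * (of_nat (lcoef n k) :: rat)"
proof (cases "k \<le> n")
  case True
  obtain n' where n: "n = Suc n'" using assms by (cases n) auto
  have "n * ((n - 1) choose k) = (n - k) * (n choose k)"
    using binomial_absorb_comp[of n k] by simp
  moreover have "(n + k) * ((n - 1 + k) choose k) = n * ((n + k) choose k)"
    using binomial_absorb_comp[of "n + k" k] n by simp
  ultimately have "n * ((n + k) * lcoef (n - 1) k) = n * ((n - k) * lcoef n k)"
    unfolding lcoef_def by (metis (no_types, lifting) mult.assoc mult.left_commute)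
  then have "(n + k) * lcoef (n - 1) k = (n - k) * lcoef n k"
    using assms by simp
  then have "(of_nat ((n + k) * lcoef (n - 1) k) :: rat) = of_nat ((n - k) * lcoef n k)"
    by (simp only:)
  then show ?thesis
    using True by (simp add: of_nat_diff)
next
  case False
  then have "lcoef n k = 0" "lcoef (n - 1) k = 0"
    by (simp_all add: lcoef_eq_0_iff)
  then show ?thesis by simp
qed

section \<open>Contiguous relations and Legendre's equation\<close>

abbreviation pq :: "rat poly" where "pq \<equiv> [:0, 1, 1:]"

lemma coeff_linear_mult: "coeff ([:a, b:] * P) k = a * coeff P k + (if k = 0 then 0 else b * coeff P (k - 1))"
  for P :: "rat poly"
  by (cases k) simp_all

lemma coeff_pq_pderiv:
  "coeff (pq * pderiv P) k = of_nat k * coeff P k + (if k = 0 then 0 else of_nat (k - 1) * coeff P (k - 1))"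
  by (cases k; cases "k - 1") (simp_all add: coeff_pderiv)

text \<open>The classical \<open>(x^2 - 1) P_n' = n (x P_n - P_(n-1))\<close> and its companion at
  \<open>x = 2X + 1\<close>, where \<open>x^2 - 1 = 4 X (X + 1)\<close>.\<close>

lemma Qpoly_contiguous:
  assumes "n \<ge> 1"
  shows "2 * pq * pderiv (Qpoly n) = of_nat n * ([:1, 2:] * Qpoly n - Qpoly (n - 1))"
    and "2 * pq * pderiv (Qpoly (n - 1)) = of_nat n * (Qpoly n - [:1, 2:] * Qpoly (n - 1))"
proof -
  have num: "2 * pq * P = smult 2 (pq * P)" "of_nat n * P = smult (of_nat n) P" for P :: "rat poly"
    by (simp_all add: of_nat_poly numeral_poly smult_add_right)
  let ?a = "\<lambda>k. of_nat (lcoef n k) :: rat" and ?b = "\<lambda>k. of_nat (lcoef (n - 1) k) :: rat"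
  have rel: "2 * (of_nat k * ?a k + (if k = 0 then 0 else of_nat (k - 1) * ?a (k - 1))) =
        of_nat n * (?a k + (if k = 0 then 0 else 2 * ?a (k - 1)) - ?b k)"
    "2 * (of_nat k * ?b k + (if k = 0 then 0 else of_nat (k - 1) * ?b (k - 1))) =
        of_nat n * (?a k - (?b k + (if k = 0 then 0 else 2 * ?b (k - 1))))" for k
  proof -
    show "2 * (of_nat k * ?a k + (if k = 0 then 0 else of_nat (k - 1) * ?a (k - 1))) =
        of_nat n * (?a k + (if k = 0 then 0 else 2 * ?a (k - 1)) - ?b k)"
    proof (cases k)
      case (Suc j)
      define N J A B C :: rat where "N = of_nat n" and "J = of_nat j" and "A = ?a k"
        and "B = ?a j" and "C = ?b k"
      have "(J + 1)\<^sup>2 * A = (N + J + 1) * (N - J) * B"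
        using lcoef_Suc[of j n] by (simp add: N_def J_def A_def B_def Suc add.commute)
      moreover have "(N + J + 1) * C = (N - J - 1) * A"
        using lcoef_pred[OF assms, of k] by (simp add: N_def J_def A_def C_def Suc algebra_simps)
      \<comment> \<open>Multiplied by the nonzero \<open>N + J + 1\<close>, the identity lies in the
        ideal generated by the two recursions; the factor is then cancelled.\<close>
      ultimately have "(N + J + 1) * (2 * ((J + 1) * A + J * B) - N * (A + 2 * B - C)) = 0"
        by algebra
      moreover have "N + J + 1 \<noteq> 0"
        unfolding N_def J_def by (metis of_nat_add of_nat_Suc of_nat_neq_0 add.commute add_Suc_right plus_1_eq_Suc)
      ultimately show ?thesis
        by (simp add: N_def J_def A_def B_def C_def Suc add.commute)
    qed simp
    show "2 * (of_nat k * ?b k + (if k = 0 then 0 else of_nat (k - 1) * ?b (k - 1))) =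
        of_nat n * (?a k - (?b k + (if k = 0 then 0 else 2 * ?b (k - 1))))"
    proof (cases k)
      case (Suc j)
      define N J A B C D :: rat where "N = of_nat n" and "J = of_nat j" and "A = ?a k"
        and "B = ?a j" and "C = ?b k" and "D = ?b j"
      have "(J + 1)\<^sup>2 * A = (N + J + 1) * (N - J) * B"
        using lcoef_Suc[of j n] by (simp add: N_def J_def A_def B_def Suc add.commute)
      moreover have "(N + J + 1) * C = (N - J - 1) * A"
        using lcoef_pred[OF assms, of k] by (simp add: N_def J_def A_def C_def Suc algebra_simps)
      moreover have "(N + J) * D = (N - J) * B"
        using lcoef_pred[OF assms, of j] by (simp add: N_def J_def B_def D_def)
      ultimately have "(N + J + 1) * (2 * ((J + 1) * C + J * D) - N * (A - (C + 2 * D))) = 0"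
        by algebra
      moreover have "N + J + 1 \<noteq> 0"
        unfolding N_def J_def by (metis of_nat_add of_nat_Suc of_nat_neq_0 add.commute add_Suc_right plus_1_eq_Suc)
      ultimately show ?thesis
        by (simp add: N_def J_def A_def B_def C_def D_def Suc add.commute)
    qed simp
  qed
  show "2 * pq * pderiv (Qpoly n) = of_nat n * ([:1, 2:] * Qpoly n - Qpoly (n - 1))"
    unfolding num by (rule poly_eqI)
      (simp only: coeff_smult coeff_pq_pderiv coeff_diff coeff_linear_mult coeff_Qpoly mult_1 rel)
  show "2 * pq * pderiv (Qpoly (n - 1)) = of_nat n * (Qpoly n - [:1, 2:] * Qpoly (n - 1))"
    unfolding num by (rule poly_eqI)
      (simp only: coeff_smult coeff_pq_pderiv coeff_diff coeff_linear_mult coeff_Qpoly mult_1 rel)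
qed

lemma Qpoly_ode: "pderiv (pq * pderiv (Qpoly n)) = smult (of_nat (n * (n + 1))) (Qpoly n)"
proof (rule poly_eqI)
  fix k
  define N J A B :: rat where "N = of_nat n" and "J = of_nat k" and "A = of_nat (lcoef n k)"
    and "B = of_nat (lcoef n (Suc k))"
  have "(J + 1)\<^sup>2 * B = (N + J + 1) * (N - J) * A"
    using lcoef_Suc[of k n] by (simp add: N_def J_def A_def B_def add.commute)
  then have "(J + 1) * ((J + 1) * B + J * A) = N * (N + 1) * A"
    by algebra
  then show "coeff (pderiv (pq * pderiv (Qpoly n))) k = coeff (smult (of_nat (n * (n + 1))) (Qpoly n)) k"
    by (simp only: coeff_pderiv coeff_pq_pderiv coeff_Qpoly coeff_smult)
      (simp add: N_def J_def A_def B_def algebra_simps)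
qed

section \<open>The antiderivative as a Wronskian\<close>

definition Fpoly :: "nat \<Rightarrow> nat \<Rightarrow> rat poly" where
  "Fpoly m n = poly_antideriv (Qpoly m * Qpoly n)"

lemma coeff_antideriv:
  "coeff (poly_antideriv P) k = (if k = 0 then 0 else coeff P (k - 1) / of_nat k)"
proof (cases k)
  case 0
  then show ?thesis
    by (simp add: poly_antideriv_def coeff_sum)
next
  case (Suc j)
  have "coeff (poly_antideriv P) k = (\<Sum>i\<le>degree P. if i = j then coeff P i / of_nat (Suc i) else 0)"
    unfolding poly_antideriv_def coeff_sum by (rule sum.cong) (auto simp: Suc)
  also have "\<dots> = coeff P j / of_nat (Suc j)"
    by (auto simp: coeff_eq_0)
  finally show ?thesis using Suc by simp
qed

lemma pderiv_antideriv: "pderiv (poly_antideriv P) = P"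
  by (rule poly_eqI) (simp add: coeff_pderiv coeff_antideriv del: of_nat_Suc)

lemma coeff_Ipoly: "coeff (Ipoly m n) k = coeff (Fpoly m n) (Suc k)"
proof -
  have "poly (Fpoly m n) 0 = 0"
    by (simp add: poly_0_coeff_0 Fpoly_def coeff_antideriv)
  then have "[:0, 1:] dvd Fpoly m n"
    by (metis poly_eq_0_iff_dvd minus_zero)
  then have "Fpoly m n = [:0, 1:] * Ipoly m n"
    unfolding Ipoly_def Fpoly_def by (metis dvd_mult_div_cancel)
  then show ?thesis by (simp add: coeff_linear_mult)
qed

text \<open>Lagrange's identity for the self-adjoint form of Legendre's equation: on
  differentiating, the products of first derivatives cancel and \<open>Qpoly_ode\<close> leaves a
  multiple of \<open>Qpoly m * Qpoly n\<close>. There is no constant of integration, since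
  \<open>pq\<close> and the antiderivative both vanish at 0.\<close>

lemma Fpoly_wronskian:
  "pq * (Qpoly m * pderiv (Qpoly n) - pderiv (Qpoly m) * Qpoly n) =
   smult (of_nat (n * (n + 1)) - of_nat (m * (m + 1))) (Fpoly m n)"
    (is "?W = smult ?D _")
proof -
  let ?U = "pq * pderiv (Qpoly m)" and ?V = "pq * pderiv (Qpoly n)"
  have W: "?W = Qpoly m * ?V - Qpoly n * ?U"
    by (simp only: right_diff_distrib mult.assoc mult.left_commute mult.commute)
  have "pderiv ?W = Qpoly m * pderiv ?V - Qpoly n * pderiv ?U
      + (pderiv (Qpoly m) * ?V - pderiv (Qpoly n) * ?U)"
    unfolding W pderiv_diff pderiv_mult[of "Qpoly m" ?V] pderiv_mult[of "Qpoly n" ?U]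
    by (simp only: algebra_simps)
  also have "pderiv (Qpoly m) * ?V - pderiv (Qpoly n) * ?U = 0"
    by (simp only: mult.left_commute mult.commute diff_self)
  finally have "pderiv ?W = Qpoly m * pderiv ?V - Qpoly n * pderiv ?U"
    by (simp only: add_0_right)
  then have "pderiv ?W = smult ?D (Qpoly m * Qpoly n)"
    unfolding Qpoly_ode by (simp only: mult_smult_right smult_diff_left mult.commute)
  then have "pderiv (?W - smult ?D (Fpoly m n)) = 0"
    by (simp add: pderiv_diff pderiv_smult Fpoly_def pderiv_antideriv del: mult_pCons_left mult_pCons_right)
  then obtain c where c: "?W - smult ?D (Fpoly m n) = [:c:]"
    using pderiv_iszero by blast
  have "coeff (?W - smult ?D (Fpoly m n)) 0 = 0"
    by (simp add: Fpoly_def coeff_antideriv)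
  with c show ?thesis by simp
qed

definition Qf :: "nat \<Rightarrow> rat poly fract" where
  "Qf n = to_fract (Qpoly n)"

definition pf :: "rat poly fract" where
  "pf = to_fract pq"

definition zf :: "nat \<Rightarrow> rat poly fract" where
  "zf n = pf * to_fract (pderiv (Qpoly n)) / Qf n"

lemma Qpoly_nz [simp]: "Qpoly n \<noteq> 0"
  using coeff_Qpoly[of n 0] by auto

lemma Qf_nz [simp]: "Qf n \<noteq> 0"
  by (simp add: Qf_def)

lemma Fpoly_eq_zf:
  "(of_int (int n * (int n + 1) - int m * (int m + 1))) * to_fract (Fpoly m n) = (zf n - zf m) * (Qf m * Qf n)"
proof -
  have "to_fract (pq * (Qpoly m * pderiv (Qpoly n) - pderiv (Qpoly m) * Qpoly n)) = (zf n - zf m) * (Qf m * Qf n)"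
    by (simp add: zf_def pf_def[symmetric] Qf_def field_simps del: mult_pCons_left mult_pCons_right)
  moreover have "of_int (int n * (int n + 1) - int m * (int m + 1)) =
      to_fract [:of_nat (n * (n + 1)) - of_nat (m * (m + 1)) :: rat:]"
    unfolding of_int_fract by (simp add: monom_0 algebra_simps)
  ultimately show ?thesis
    by (simp only: Fpoly_wronskian to_fract_mult[symmetric]) simp
qed

text \<open>Both values are expressed by the single ratio \<open>Qf n / Qf (n - 1)\<close>;
  eliminating it gives the Moebius step.\<close>

lemma zf_contiguous:
  assumes "n \<ge> 1"
  shows "2 * zf n = of_nat n * (1 + 2 * Xf - Qf (n - 1) / Qf n)"
    and "2 * zf (n - 1) = of_nat n * (Qf n / Qf (n - 1) - (1 + 2 * Xf))"
proof -
  have n: "(of_nat n :: rat poly fract) = to_fract (of_nat n)"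
    by (simp add: to_fract_def of_nat_fract)
  have x: "to_fract [:1, 2:] = 1 + 2 * Xf"
  proof -
    have "[:1, 2 :: rat:] = 1 + ([:0, 1:] + [:0, 1:])"
      by (simp add: one_pCons)
    then show ?thesis
      by (simp only: to_fract_add to_fract_1 Xf_def mult_2)
  qed
  have two: "to_fract 2 = 2"
    by (metis of_nat_fract of_nat_numeral to_fract_def)
  have "to_fract (2 * pq * pderiv (Qpoly n)) = to_fract (of_nat n * ([:1, 2:] * Qpoly n - Qpoly (n - 1)))"
    using Qpoly_contiguous(1)[OF assms] by (simp only:)
  then have "2 * pf * to_fract (pderiv (Qpoly n)) = of_nat n * ((1 + 2 * Xf) * Qf n - Qf (n - 1))"
    by (simp only: to_fract_mult to_fract_diff two pf_def Qf_def n x)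
  then show "2 * zf n = of_nat n * (1 + 2 * Xf - Qf (n - 1) / Qf n)"
    by (simp add: zf_def field_simps)
  have "to_fract (2 * pq * pderiv (Qpoly (n - 1))) = to_fract (of_nat n * (Qpoly n - [:1, 2:] * Qpoly (n - 1)))"
    using Qpoly_contiguous(2)[OF assms] by (simp only:)
  then have "2 * pf * to_fract (pderiv (Qpoly (n - 1))) = of_nat n * (Qf n - (1 + 2 * Xf) * Qf (n - 1))"
    by (simp only: to_fract_mult to_fract_diff two pf_def Qf_def n x)
  then show "2 * zf (n - 1) = of_nat n * (Qf n / Qf (n - 1) - (1 + 2 * Xf))"
    by (simp add: zf_def field_simps)
qed

lemma zf_0 [simp]: "zf 0 = 0"
proof -
  have "pderiv (Qpoly 0) = 0"
    by (rule poly_eqI) (simp add: coeff_pderiv coeff_Qpoly lcoef_def)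
  then show ?thesis by (simp add: zf_def)
qed

section \<open>Leading terms of shifted Legendre polynomials\<close>

lemma v2_add_eq:
  assumes "x \<noteq> 0" "y = 0 \<or> v2 x < v2 y"
  shows "x + y \<noteq> 0" "v2 (x + y) = v2 x"
proof -
  have "x + y \<noteq> 0 \<and> v2 (x + y) = v2 x"
  proof (cases "y = 0")
    case False
    then have lt: "v2 x < v2 y" using assms by simp
    have nz: "x + y \<noteq> 0"
    proof
      assume "x + y = 0"
      then have "y = - x" by (simp add: eq_neg_iff_add_eq_0 add.commute)
      with lt show False by simp
    qed
    moreover have "v2 x \<le> v2 (x + y)"
      using v2_add_ge[OF assms(1) False nz] lt by simp
    moreover have "v2 (x + y) \<le> v2 x"
      using v2_add_ge[OF nz, of "- y"] False assms(1) lt by simp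
    ultimately show ?thesis by simp
  qed (use assms in simp)
  then show "x + y \<noteq> 0" "v2 (x + y) = v2 x" by auto
qed

lemma v2_of_nat_eq_iff:
  assumes "n > 0"
  shows "v2 (of_nat n) = int t \<longleftrightarrow> (\<exists>d. n = 2 ^ t * (2 * d + 1))"
proof
  assume a: "v2 (of_nat n) = int t"
  then have "2 ^ t dvd int n" "\<not> 2 ^ Suc t dvd int n"
    using power2_dvd_iff_v2[of "int n" t] power2_dvd_iff_v2[of "int n" "Suc t"] assms by auto
  then have dv: "2 ^ t dvd n" "\<not> 2 ^ Suc t dvd n"
    using of_nat_dvd_iff[of "2 ^ t" n, where 'a = int] of_nat_dvd_iff[of "2 ^ Suc t" n, where 'a = int]
    by auto
  then obtain m where m: "n = 2 ^ t * m" by (auto elim: dvdE)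
  have "odd m"
  proof
    assume "even m"
    then have "2 ^ Suc t dvd n" using m by (auto elim!: evenE)
    with dv show False by simp
  qed
  with m show "\<exists>d. n = 2 ^ t * (2 * d + 1)" by (auto elim!: oddE)
next
  assume "\<exists>d. n = 2 ^ t * (2 * d + 1)"
  then obtain d where d: "n = 2 ^ t * (2 * d + 1)" by auto
  have "v2 (of_nat n) = v2 (2 ^ t) + v2 (of_nat (2 * d + 1))"
    unfolding d of_nat_mult by (subst v2_mult) (simp_all add: add_eq_0_iff flip: of_nat_Suc del: of_nat_Suc)
  moreover have "v2 (of_nat (2 * d + 1)) = 0"
    using v2_odd[of "int (2 * d + 1)"] by simp
  ultimately show "v2 (of_nat n) = int t"
    by (simp add: v2_power)
qed

lemma digit_sum_mersenne: "digit_sum (2 ^ t - 1) = t"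
proof -
  have "int (digit_sum (Suc (2 ^ t - 1))) + v2 (of_nat (Suc (2 ^ t - 1))) = int (digit_sum (2 ^ t - 1)) + 1"
    by (rule digit_sum_Suc)
  then show ?thesis
    by (simp add: digit_sum_power2 v2_power del: of_nat_Suc)
qed

lemma v2_central_binomial: "v2 (of_nat ((2 * k) choose k)) = int (digit_sum k)"
  using v2_binomial[of k k] by (simp add: mult_2[symmetric])

lemma v2_lcoef:
  assumes "k \<le> n"
  shows "v2 (of_nat (lcoef n k)) = 2 * int (digit_sum k) + int (digit_sum (n - k)) - int (digit_sum (n + k))"
proof -
  have "v2 (of_nat (lcoef n k)) = v2 (of_nat (n choose k)) + v2 (of_nat ((n + k) choose k))"
    using assms by (simp add: lcoef_def v2_mult)
  then show ?thesis
    using v2_binomial[of k "n - k"] v2_binomial[of k n] assms by (simp add: add.commute)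
qed

lemma v2_lcoef_ge:
  assumes "k \<le> n"
  shows "int (digit_sum k) \<le> v2 (of_nat (lcoef n k))"
  using assms v2_of_nat_nonneg[of "(n + k) choose (2 * k)"]
  by (simp add: lcoef_altdef v2_mult v2_central_binomial)

section \<open>Half-differences of consecutive shifted Legendre polynomials\<close>

definition Tpoly :: "nat \<Rightarrow> rat poly" where
  "Tpoly n = smult (1/2) (Qpoly n - Qpoly (n - 1))"

text \<open>By \<open>lcoef_pred\<close> the coefficient is \<open>k / (n + k)\<close> times
  \<open>lcoef n k\<close>, so the following bounds all turn on the denominator
  \<open>n + k\<close>.\<close>

lemma coeff_Tpoly:
  assumes "n \<ge> 1"
  shows "(of_nat n + of_nat k) * coeff (Tpoly n) k = of_nat k * of_nat (lcoef n k)"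
proof -
  have "(of_nat n + of_nat k) * (A - of_nat (lcoef (n - 1) k)) = 2 * of_nat k * A"
    if "A = of_nat (lcoef n k)" for A :: rat
    using lcoef_pred[OF assms, of k] that by (simp add: algebra_simps)
  then show ?thesis
    by (simp add: Tpoly_def coeff_Qpoly)
qed

lemma coeff_Tpoly_nz_iff:
  assumes "n \<ge> 1"
  shows "coeff (Tpoly n) k = 0 \<longleftrightarrow> k = 0 \<or> n < k"
proof -
  have "(of_nat n + of_nat k :: rat) \<noteq> 0"
    using assms by (simp add: add_eq_0_iff flip: of_nat_add)
  then have "coeff (Tpoly n) k = 0 \<longleftrightarrow> (of_nat n + of_nat k) * coeff (Tpoly n) k = 0"
    by (metis mult_eq_0_iff)
  then show ?thesis
    unfolding coeff_Tpoly[OF assms, of k] by (simp add: lcoef_eq_0_iff)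
qed

lemma v2_Tpoly:
  assumes "n \<ge> 1" "1 \<le> k" "k \<le> n"
  shows "v2 (coeff (Tpoly n) k) = v2 (of_nat k) + v2 (of_nat (lcoef n k)) - v2 (of_nat (n + k))"
proof -
  have "v2 (of_nat (n + k) * coeff (Tpoly n) k) = v2 (of_nat k * of_nat (lcoef n k))"
    using coeff_Tpoly[OF assms(1), of k] by simp
  moreover have "coeff (Tpoly n) k \<noteq> 0" "lcoef n k \<noteq> 0" "n + k \<noteq> 0"
    using assms coeff_Tpoly_nz_iff[of n k] by (auto simp: lcoef_eq_0_iff)
  ultimately show ?thesis
    using assms by (simp add: v2_mult del: of_nat_add)
qed

text \<open>Absorption, \<open>2 k C(n+k, 2k) = (n+k) C(n+k-1, 2k-1)\<close>, moves the denominator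
  \<open>n + k\<close> into a binomial coefficient at the cost of a single factor 2.\<close>

lemma v2_Tpoly_ge:
  assumes "n \<ge> 1" "1 \<le> k" "k \<le> n"
  shows "int (digit_sum k) - 1 \<le> v2 (coeff (Tpoly n) k)"
proof -
  have "2 * k * ((n + k) choose (2 * k)) = (n + k) * ((n + k - 1) choose (2 * k - 1))"
    using times_binomial_minus1_eq[of "2 * k" "n + k"] assms by simp
  then have "v2 (of_nat (2 * k * ((n + k) choose (2 * k)))) = v2 (of_nat ((n + k) * ((n + k - 1) choose (2 * k - 1))))"
    by simp
  moreover have "v2 (of_nat (2 * k * ((n + k) choose (2 * k)))) = 1 + v2 (of_nat k) + v2 (of_nat ((n + k) choose (2 * k)))"
    using assms by (simp add: v2_mult)
  moreover have "v2 (of_nat ((n + k) * ((n + k - 1) choose (2 * k - 1)))) =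
      v2 (of_nat (n + k)) + v2 (of_nat ((n + k - 1) choose (2 * k - 1)))"
    unfolding of_nat_mult using assms by (subst v2_mult) (auto simp del: of_nat_add)
  moreover have "v2 (of_nat (lcoef n k)) = v2 (of_nat ((n + k) choose (2 * k))) + int (digit_sum k)"
    using assms by (simp add: lcoef_altdef v2_mult v2_central_binomial)
  ultimately show ?thesis
    using v2_Tpoly[OF assms] v2_of_nat_nonneg[of "(n + k - 1) choose (2 * k - 1)"] by linarith
qed

text \<open>If \<open>k\<close> and \<open>n\<close> have different valuations, \<open>n + k\<close>
  has the smaller one, so \<open>k / (n + k)\<close> loses nothing.\<close>

lemma v2_Tpoly_ge_strong:
  assumes "n \<ge> 1" "1 \<le> k" "k \<le> n" "v2 (of_nat k) \<noteq> v2 (of_nat n)"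
  shows "int (digit_sum k) \<le> v2 (coeff (Tpoly n) k)"
proof -
  have "v2 (of_nat n + of_nat k) \<le> v2 (of_nat k)"
  proof (cases "v2 (of_nat n) < v2 (of_nat k)")
    case True
    then show ?thesis
      using v2_add_eq(2)[of "of_nat n" "of_nat k"] assms by simp
  next
    case False
    then show ?thesis
      using v2_add_eq(2)[of "of_nat k" "of_nat n"] assms by (simp add: add.commute)
  qed
  then show ?thesis
    using v2_Tpoly[OF assms(1-3)] v2_lcoef_ge[OF assms(3)] by simp
qed

lemma v2_Tpoly_altdef:
  assumes "n \<ge> 1" "1 \<le> k" "k \<le> n"
  shows "v2 (coeff (Tpoly n) k) =
    v2 (of_nat k) + 2 * int (digit_sum k) + int (digit_sum (n - k)) - int (digit_sum (n + k - 1)) - 1"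
  using v2_Tpoly[OF assms] v2_lcoef[OF assms(3)] digit_sum_Suc[of "n + k - 1"] assms by simp

section \<open>Minimal digit weights and leading parts at a fixed radius\<close>

locale dyadic_radius =
  fixes e q :: nat
  assumes q_def: "q = 2 ^ e" and e_pos: "e \<ge> 1"
begin

lemma q_ge_2: "q \<ge> 2"
  using e_pos power_increasing[of 1 e "2 :: nat"] by (simp add: q_def)

text \<open>The weight \<open>q * digit_sum k - k\<close> at the start \<open>k\<close> of the block
  of \<open>2 q\<close> indices containing \<open>n\<close>. It turns out to be the Gauss valuation
  of \<open>Qpoly n\<close>.\<close>

definition om :: "nat \<Rightarrow> int" where
  "om n = int q * (int (digit_sum (n div (2 * q))) - 2 * int (n div (2 * q)))"

lemma digit_sum_split: "b < 2 * q \<Longrightarrow> digit_sum (2 * q * a + b) = digit_sum a + digit_sum b"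
  using digit_sum_pow2_mult_add[of b "Suc e" a] by (simp add: q_def)

lemma digit_sum_split4: "b < 4 * q \<Longrightarrow> digit_sum (4 * q * a + b) = digit_sum a + digit_sum b"
  using digit_sum_pow2_mult_add[of b "Suc (Suc e)" a] by (simp add: q_def)

lemma digit_sum_split1: "b < q \<Longrightarrow> digit_sum (q + b) = 1 + digit_sum b"
  using digit_sum_pow2_mult_add[of b e 1] by (simp add: q_def)

lemma digit_sum_q [simp]: "digit_sum q = 1"
  by (simp add: q_def digit_sum_power2)

lemma weight_mod:
  "int q * int (digit_sum k) - int k = om k + (int q * int (digit_sum (k mod (2 * q))) - int (k mod (2 * q)))"
proof -
  have k: "k = 2 * q * (k div (2 * q)) + k mod (2 * q)" by simp
  have "digit_sum k = digit_sum (k div (2 * q)) + digit_sum (k mod (2 * q))"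
    using digit_sum_split[of "k mod (2 * q)" "k div (2 * q)"] q_ge_2 k by simp
  moreover have "int k = 2 * int q * int (k div (2 * q)) + int (k mod (2 * q))"
    using arg_cong[OF k, of int] by (simp only: of_nat_add of_nat_mult of_nat_numeral)
  ultimately show ?thesis by (simp add: om_def algebra_simps)
qed

text \<open>A nonzero \<open>i < q\<close> already pays \<open>q\<close> for one digit, and beyond
  \<open>q\<close> a second digit makes it \<open>2 q\<close>. The only ties, \<open>0\<close> and
  \<open>q\<close>, become the two monomials of \<open>lead\<close>.\<close>

lemma digit_weight: "i < 2 * q \<Longrightarrow> i \<le> q * digit_sum i"
  and digit_weight_strict: "i < 2 * q \<Longrightarrow> i \<noteq> 0 \<Longrightarrow> i \<noteq> q \<Longrightarrow> i + 1 \<le> q * digit_sum i"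
proof -
  assume i: "i < 2 * q"
  have *: "i + 1 \<le> q * digit_sum i" if nz: "i \<noteq> 0" "i \<noteq> q"
  proof (cases "i < q")
    case True
    have "q * 1 \<le> q * digit_sum i" using digit_sum_pos[of i] nz by (intro mult_left_mono) auto
    with True show ?thesis by linarith
  next
    case False
    then have "digit_sum i = 1 + digit_sum (i - q)"
      using digit_sum_split1[of "i - q"] i by simp
    moreover have "digit_sum (i - q) \<ge> 1"
      using digit_sum_pos[of "i - q"] False nz by simp
    ultimately have "q * 2 \<le> q * digit_sum i" by (intro mult_left_mono) auto
    with i False show ?thesis by linarith
  qed
  then show "i \<noteq> 0 \<Longrightarrow> i \<noteq> q \<Longrightarrow> i + 1 \<le> q * digit_sum i" by blast
  show "i \<le> q * digit_sum i"
    using * by (cases "i = 0 \<or> i = q") auto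
qed

text \<open>Going from block \<open>a\<close> to a later block \<open>b\<close> raises the digit sum
  by at most \<open>b - a\<close> while \<open>2 (b - a)\<close> is subtracted, so only the last
  block competes for the minimal weight.\<close>

lemma om_block_less:
  assumes "k div (2 * q) < n div (2 * q)"
  shows "om n + int q \<le> om k"
proof -
  let ?a = "k div (2 * q)" and ?b = "n div (2 * q)"
  have "digit_sum ?b \<le> digit_sum ?a + digit_sum (?b - ?a)"
    using digit_sum_add_le[of ?a "?b - ?a"] assms by simp
  moreover have "digit_sum (?b - ?a) \<le> ?b - ?a" by (rule digit_sum_le)
  ultimately have "int (digit_sum ?b) - 2 * int ?b + 1 \<le> int (digit_sum ?a) - 2 * int ?a"
    using assms by linarith
  from mult_left_mono[OF this, of "int q"] show ?thesis
    by (simp add: om_def algebra_simps)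
qed

lemma weight_ge:
  assumes "k \<le> n"
  shows "om n + int k \<le> int q * int (digit_sum k)"
proof -
  have "k div (2 * q) \<le> n div (2 * q)"
    using assms by (rule div_le_mono)
  then have "om n \<le> om k"
    using om_block_less[of k n] by (cases "k div (2 * q) = n div (2 * q)") (auto simp: om_def)
  moreover have "int (k mod (2 * q)) \<le> int q * int (digit_sum (k mod (2 * q)))"
    using digit_weight[of "k mod (2 * q)"] q_ge_2 by (metis mod_less_divisor mult_is_0 nat_0_less_mult_iff of_nat_le_iff of_nat_mult pos2 zero_less_numeral not_numeral_le_zero neq0_conv)
  ultimately show ?thesis
    using weight_mod[of k] by simp
qed

definition blk :: "nat \<Rightarrow> nat" where
  "blk n = 2 * q * (n div (2 * q))"

lemma blk_mod: "blk n + n mod (2 * q) = n"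
  by (simp add: blk_def)

lemma int_blk: "om n + int (blk n) = int q * int (digit_sum (n div (2 * q)))"
  by (simp add: om_def blk_def algebra_simps)

lemma weight_gt:
  assumes "k \<le> n" "k \<noteq> blk n" "k \<noteq> blk n + q"
  shows "om n + 1 + int k \<le> int q * int (digit_sum k)"
proof (cases "k div (2 * q) = n div (2 * q)")
  case True
  let ?i = "k mod (2 * q)"
  have i: "?i < 2 * q" using q_ge_2 by simp
  have "k = blk n + ?i"
    using blk_mod[of k] True by (simp add: blk_def)
  then have "?i \<noteq> 0" "?i \<noteq> q" using assms by auto
  from digit_weight_strict[OF i this] have "int ?i + 1 \<le> int q * int (digit_sum ?i)"
    by (metis of_nat_1 of_nat_add of_nat_le_iff of_nat_mult)
  moreover have "om k = om n" using True by (simp add: om_def)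
  ultimately show ?thesis using weight_mod[of k] by simp
next
  case False
  then have "k div (2 * q) < n div (2 * q)"
    using div_le_mono[OF assms(1), of "2 * q"] by simp
  from om_block_less[OF this] show ?thesis
    using weight_ge[of k k] q_ge_2 by simp
qed

lemma v2_lcoef_blk: "v2 (of_nat (lcoef n (blk n))) = int (digit_sum (n div (2 * q)))"
proof -
  let ?h = "n div (2 * q)" and ?c = "n mod (2 * q)"
  have c: "?c < 2 * q" using q_ge_2 by simp
  have "digit_sum (blk n) = digit_sum ?h"
    using digit_sum_split[of 0 ?h] q_ge_2 by (simp add: blk_def)
  moreover have "n - blk n = ?c" using blk_mod[of n] by simp
  moreover have "4 * q * ?h = 2 * blk n"
    by (simp add: blk_def)
  then have "n + blk n = 4 * q * ?h + ?c"
    using blk_mod[of n] by linarith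
  then have "digit_sum (n + blk n) = digit_sum ?h + digit_sum ?c"
    using digit_sum_split4[of ?c ?h] c by simp
  ultimately show ?thesis
    using v2_lcoef[of "blk n" n] blk_mod[of n] by simp
qed

text \<open>Digit \<open>e\<close> of \<open>n\<close> enters here: with
  \<open>c = n mod (2 * q) \<ge> q\<close>, the sum \<open>c + q = 2 q + (c - q)\<close> carries
  into digit \<open>e + 1\<close>, which is free because \<open>2 * blk n\<close> is a multiple of
  \<open>4 q\<close>. The bound \<open>v2_lcoef_ge\<close> is therefore attained.\<close>

lemma v2_lcoef_blk_q:
  assumes "q \<le> n mod (2 * q)"
  shows "v2 (of_nat (lcoef n (blk n + q))) = int (digit_sum (n div (2 * q))) + 1"
proof -
  let ?h = "n div (2 * q)" and ?c = "n mod (2 * q)"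
  have c: "?c < 2 * q" using q_ge_2 by simp
  have "digit_sum (blk n + q) = digit_sum ?h + 1"
    using digit_sum_split[of q ?h] q_ge_2 by (simp add: blk_def)
  moreover have "n - (blk n + q) = ?c - q" using blk_mod[of n] by simp
  moreover have "4 * q * ?h = 2 * blk n"
    by (simp add: blk_def)
  then have eq: "n + (blk n + q) = 4 * q * ?h + (2 * q * 1 + (?c - q))"
    using blk_mod[of n] assms by linarith
  moreover have "digit_sum (4 * q * ?h + (2 * q * 1 + (?c - q))) = digit_sum ?h + digit_sum (2 * q * 1 + (?c - q))"
    by (rule digit_sum_split4) (use c in simp)
  moreover have "digit_sum (2 * q * 1 + (?c - q)) = digit_sum 1 + digit_sum (?c - q)"
    by (rule digit_sum_split) (use c in simp)
  ultimately have "digit_sum (n + (blk n + q)) = digit_sum ?h + (1 + digit_sum (?c - q))"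
    by (simp only: eq digit_sum_1 One_nat_def)
  with \<open>digit_sum (blk n + q) = digit_sum ?h + 1\<close> \<open>n - (blk n + q) = ?c - q\<close> show ?thesis
    using v2_lcoef[of "blk n + q" n] blk_mod[of n] assms by simp
qed

lemma kge_lcoef:
  assumes "om n + c + int k \<le> int q * int (digit_sum k) \<or> n < k"
  shows "kge q (of_nat (lcoef n k)) (om n + c + int k)"
proof (cases "n < k")
  case True
  then have "lcoef n k = 0" by (simp add: lcoef_eq_0_iff)
  then show ?thesis by simp
next
  case False
  then have "int q * int (digit_sum k) \<le> int q * v2 (of_nat (lcoef n k))"
    by (intro mult_left_mono v2_lcoef_ge) auto
  then show ?thesis using assms False by (auto simp: kge_def)
qed

lemma poly_ge_Qpoly: "poly_ge q (Qpoly n) (om n)"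
  unfolding poly_ge_def coeff_Qpoly using kge_lcoef[of n 0] weight_ge
  by (metis add_0_right not_le)

lemma gauss_Qpoly: "gauss q (Qpoly n) = om n"
proof (rule antisym)
  show "om n \<le> gauss q (Qpoly n)"
    using poly_ge_Qpoly poly_ge_iff by simp
  have "blk n \<le> n" using blk_mod[of n] by linarith
  moreover have "poly_ge q (Qpoly n) (gauss q (Qpoly n))"
    by (simp add: poly_ge_iff)
  ultimately have "gauss q (Qpoly n) + int (blk n) \<le> int q * v2 (of_nat (lcoef n (blk n)))"
    by (auto simp: poly_ge_def kge_def coeff_Qpoly lcoef_eq_0_iff)
  then show "gauss q (Qpoly n) \<le> om n"
    using int_blk[of n] by (simp add: v2_lcoef_blk)
qed

lemma wval_Qf: "wval q (Qf n) = om n"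
  by (simp add: Qf_def wval_to_fract gauss_Qpoly)

text \<open>This is \<open>2^s X^b (1 + 2 X^q)\<close>: the terms of minimal weight, with each
  coefficient replaced by the power of 2 of its valuation.\<close>

definition lead :: "nat \<Rightarrow> rat poly" where
  "lead n = monom (2 ^ digit_sum (n div (2 * q))) (blk n) + monom (2 ^ (digit_sum (n div (2 * q)) + 1)) (blk n + q)"

lemma coeff_lead:
  "coeff (lead n) k = (if k = blk n then 2 ^ digit_sum (n div (2 * q))
     else if k = blk n + q then 2 ^ (digit_sum (n div (2 * q)) + 1) else 0)"
  using q_ge_2 by (auto simp: lead_def)

lemma kge_sub:
  assumes "x \<noteq> 0" "y \<noteq> 0" "v2 x = c" "v2 y = c" "d \<le> int q * (c + 1)"
  shows "kge q (x - y) d"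
  unfolding kge_def
proof
  assume "x - y \<noteq> 0"
  from v2_sub_ge[OF assms(1-4) this] have "int q * (c + 1) \<le> int q * v2 (x - y)"
    by (intro mult_left_mono) auto
  with assms show "d \<le> int q * v2 (x - y)" by simp
qed

lemma Qpoly_lead:
  assumes "q \<le> n mod (2 * q)"
  shows "poly_ge q (Qpoly n - lead n) (om n + 1)"
  unfolding poly_ge_def
proof
  fix k
  let ?s = "digit_sum (n div (2 * q))"
  have blk: "blk n + q \<le> n" using blk_mod[of n] assms by linarith
  consider "k = blk n" | "k = blk n + q" | "k \<noteq> blk n" "k \<noteq> blk n + q" by blast
  then show "kge q (coeff (Qpoly n - lead n) k) (om n + 1 + int k)"
  proof cases
    case 1
    have "kge q (of_nat (lcoef n k) - 2 ^ ?s) (om n + 1 + int k)"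
    proof (rule kge_sub)
      show "v2 (of_nat (lcoef n k)) = int ?s" using v2_lcoef_blk 1 by simp
      show "om n + 1 + int k \<le> int q * (int ?s + 1)"
        using int_blk[of n] 1 q_ge_2 by (simp add: algebra_simps)
    qed (use blk 1 in \<open>auto simp: lcoef_eq_0_iff v2_power\<close>)
    then show ?thesis by (simp add: coeff_Qpoly coeff_lead 1)
  next
    case 2
    have "kge q (of_nat (lcoef n k) - 2 ^ (?s + 1)) (om n + 1 + int k)"
    proof (rule kge_sub)
      show "v2 (of_nat (lcoef n k)) = int ?s + 1" using v2_lcoef_blk_q[OF assms] 2 by simp
      show "om n + 1 + int k \<le> int q * (int ?s + 1 + 1)"
        using int_blk[of n] 2 q_ge_2 by (simp add: algebra_simps)
    next
      show "v2 (2 ^ (?s + 1)) = int ?s + 1" using v2_power[of 2 "?s + 1"] by simp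
    qed (use blk 2 in \<open>auto simp: lcoef_eq_0_iff\<close>)
    then show ?thesis using q_ge_2 by (simp add: coeff_Qpoly coeff_lead 2)
  next
    case 3
    then show ?thesis
      using kge_lcoef[of n 1 k] weight_gt[of k n]
      by (cases "k \<le> n") (auto simp: coeff_Qpoly coeff_lead)
  qed
qed

lemma poly_ge_Tpoly:
  assumes "n \<ge> 1"
  shows "poly_ge q (Tpoly n) (om n - int q)"
  unfolding poly_ge_def
proof
  fix k
  show "kge q (coeff (Tpoly n) k) (om n - int q + int k)"
  proof (cases "k = 0 \<or> n < k")
    case False
    then have "int q * (int (digit_sum k) - 1) \<le> int q * v2 (coeff (Tpoly n) k)"
      using assms by (intro mult_left_mono v2_Tpoly_ge) auto
    then show ?thesis
      using weight_ge[of k n] False by (simp add: kge_def algebra_simps)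
  qed (use coeff_Tpoly_nz_iff[OF assms, of k] in simp)
qed

lemma v2_less_e:
  assumes "0 < i" "i < q" "v2 (of_nat i) = int t"
  shows "t < e"
proof (rule ccontr)
  assume "\<not> t < e"
  then have "2 ^ e dvd int i"
    using power2_dvd_iff_v2[of "int i" e] assms by simp
  then have "q dvd i"
    using of_nat_dvd_iff[of q i, where 'a = int] by (simp add: q_def)
  with assms show False by (simp add: nat_dvd_not_less)
qed

lemma v2_exists: "0 < i \<Longrightarrow> \<exists>t. v2 (of_nat i) = int t"
  using v2_of_nat_nonneg[of i] nonneg_int_cases by metis

lemma v2_add_q:
  assumes "0 < i" "i < q"
  shows "v2 (of_nat (q * a + i)) = v2 (of_nat i)"
proof -
  obtain t where t: "v2 (of_nat i) = int t" using v2_exists assms by blast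
  then have "t < e" using v2_less_e assms by blast
  have "v2 (of_nat (q * a)) = int e + v2 (of_nat a)" if "a \<noteq> 0"
    using that by (simp add: v2_mult q_def v2_power)
  then have "of_nat (q * a) = (0 :: rat) \<or> v2 (of_nat i) < v2 (of_nat (q * a))"
    using t \<open>t < e\<close> v2_of_nat_nonneg[of a] by (cases "a = 0") auto
  then show ?thesis
    using v2_add_eq(2)[of "of_nat i" "of_nat (q * a)"] assms by (simp add: add.commute)
qed

definition leadT :: "nat \<Rightarrow> nat \<Rightarrow> rat poly" where
  "leadT n t = monom 1 (2 ^ t) * lead n"

lemma coeff_leadT:
  "coeff (leadT n t) k = (if k = blk n + 2 ^ t then 2 ^ digit_sum (n div (2 * q))
     else if k = blk n + q + 2 ^ t then 2 ^ (digit_sum (n div (2 * q)) + 1) else 0)"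
  using q_ge_2 by (auto simp: leadT_def coeff_monom_mult coeff_lead)

text \<open>Separates the digits of \<open>n\<close> below \<open>q\<close> into the lowest one,
  \<open>2^t\<close>, and a multiple of \<open>2^(t+1)\<close>, with enough room below
  \<open>q\<close> that digit sums can be computed range by range.\<close>

lemma interior_decomp:
  assumes "q < n mod (2 * q)" "v2 (of_nat n) = int t"
  obtains d g where "n = blk n + q + 2 ^ t * (2 * d + 1)" "q = 2 ^ Suc t * g" "d < g" "t < e"
proof -
  define i where "i = n mod (2 * q) - q"
  have lt: "n mod (2 * q) < 2 * q" using q_ge_2 by simp
  have i: "0 < i" "i < q" using assms(1) lt unfolding i_def by linarith+
  have n: "n = blk n + q + i"
    using blk_mod[of n] assms(1) unfolding i_def by linarith
  also have "\<dots> = q * (2 * (n div (2 * q)) + 1) + i"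
    by (simp add: blk_def)
  finally have "v2 (of_nat i) = int t"
    using v2_add_q[OF i] assms(2) by metis
  then have t: "t < e" and "\<exists>d. i = 2 ^ t * (2 * d + 1)"
    using v2_less_e[OF i] v2_of_nat_eq_iff[OF i(1)] by auto
  then obtain d where d: "i = 2 ^ t * (2 * d + 1)" by blast
  define g :: nat where "g = 2 ^ (e - Suc t)"
  have qg: "q = 2 ^ Suc t * g"
    using t by (simp add: g_def q_def flip: power_add power_Suc)
  have "2 ^ t * (2 * d + 1) < 2 ^ t * (2 * g)"
    using i(2) d qg by simp
  then have "2 * d + 1 < 2 * g" by (simp only: mult_less_cancel1)
  then have "d < g" by simp
  with that n d qg t show ?thesis by blast
qed

text \<open>Shifting the two exponents of \<open>lead n\<close> by \<open>2^t\<close> gives them the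
  valuation \<open>t\<close> of \<open>n\<close>; there the factor \<open>k / (n + k)\<close>
  compensates the extra digit of \<open>k\<close>, and \<open>v2_Tpoly_ge\<close> is
  attained.\<close>

lemma v2_Tpoly_lead:
  assumes "q < n mod (2 * q)" "v2 (of_nat n) = int t"
  shows "v2 (coeff (Tpoly n) (blk n + 2 ^ t)) = int (digit_sum (n div (2 * q)))"
    and "v2 (coeff (Tpoly n) (blk n + q + 2 ^ t)) = int (digit_sum (n div (2 * q))) + 1"
    and "blk n + q + 2 ^ t \<le> n" and "2 ^ t < q"
proof -
  obtain d g where n: "n = blk n + q + 2 ^ t * (2 * d + 1)" and qg: "q = 2 ^ Suc t * g"
    and dg: "d < g" and t: "t < e"
    using interior_decomp[OF assms] by blast
  let ?h = "n div (2 * q)"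
  \<comment> \<open>The low part of \<open>n + k - 1\<close> is
    \<open>2^t + ?u + 2^t - 1 = ?u + ?m\<close>. The Mersenne number \<open>?m\<close> has digit sum
    \<open>Suc t\<close>, which offsets the summand \<open>v2 k = t\<close> of
    \<open>v2_Tpoly_altdef\<close>.\<close>
  let ?u = "2 ^ Suc t * d" and ?m = "2 ^ Suc t - 1 :: nat"
  have n': "n = blk n + q + (2 ^ t + ?u)" using n by simp
  have u: "2 ^ t + ?u + 2 ^ t \<le> q"
  proof -
    have "2 ^ Suc t * (d + 1) \<le> 2 ^ Suc t * g"
      using dg by (intro mult_left_mono) auto
    then show ?thesis by (simp add: qg)
  qed
  have pos: "(1 :: nat) \<le> 2 ^ t" by simp
  have du: "digit_sum ?u = digit_sum d"
    using digit_sum_pow2_mult_add[of 0 "Suc t" d] by simp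
  have dum: "digit_sum (?u + ?m) = digit_sum d + Suc t"
    using digit_sum_pow2_mult_add[of ?m "Suc t" d] digit_sum_mersenne[of "Suc t"] by simp
  have blk4: "2 * blk n = 4 * q * ?h" by (simp add: blk_def)
  have tq: "2 ^ t < q" using u pos by linarith
  then show "2 ^ t < q" .
  have n1: "n \<ge> 1" using n' pos by linarith
  let ?k1 = "blk n + 2 ^ t" and ?k2 = "blk n + q + 2 ^ t"
  have le: "?k1 \<le> n" "?k2 \<le> n" using n' by linarith+
  then show "?k2 \<le> n" by simp
  have ge: "1 \<le> ?k1" "1 \<le> ?k2" using pos by linarith+
  have bk: "blk n = q * (2 * ?h)" by (simp add: blk_def)
  have v2t: "v2 (of_nat (2 ^ t)) = int t" by (simp add: v2_power)
  have v2k: "v2 (of_nat ?k1) = int t" "v2 (of_nat ?k2) = int t"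
  proof -
    have "?k1 = q * (2 * ?h) + 2 ^ t" "?k2 = q * (2 * ?h + 1) + 2 ^ t"
      by (simp_all add: blk_def)
    then show "v2 (of_nat ?k1) = int t" "v2 (of_nat ?k2) = int t"
      using v2_add_q[of "2 ^ t"] tq v2t by (metis zero_less_numeral zero_less_power)+
  qed
  have "digit_sum ?k1 = digit_sum ?h + digit_sum (2 ^ t)"
    unfolding blk_def by (rule digit_sum_split) (use tq in linarith)
  then have d1: "digit_sum ?k1 = digit_sum ?h + 1" by (simp add: digit_sum_power2)
  have "?k2 = 2 * q * ?h + (q + 2 ^ t)" by (simp only: blk_def add.assoc)
  moreover have "digit_sum (2 * q * ?h + (q + 2 ^ t)) = digit_sum ?h + digit_sum (q + 2 ^ t)"
    by (rule digit_sum_split) (use tq in linarith)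
  moreover have "digit_sum (q + 2 ^ t) = 1 + digit_sum (2 ^ t)"
    by (rule digit_sum_split1) (rule tq)
  ultimately have "digit_sum ?k2 = digit_sum ?h + (1 + 1)" by (simp only: digit_sum_power2)
  then have d2: "digit_sum ?k2 = digit_sum ?h + 2" by simp
  have "n - ?k1 = q + ?u" using n' by linarith
  moreover have "digit_sum (q + ?u) = 1 + digit_sum ?u"
    by (rule digit_sum_split1) (use u pos in linarith)
  ultimately have d3: "digit_sum (n - ?k1) = 1 + digit_sum d" using du by simp
  have "n - ?k2 = ?u" using n' by linarith
  then have d4: "digit_sum (n - ?k2) = digit_sum d" using du by simp
  have m: "?m + 1 = 2 ^ t + 2 ^ t" by simp
  have um: "?u + ?m < q" using u m by linarith
  have "n + ?k1 - 1 = 4 * q * ?h + (q + (?u + ?m))"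
    using n' blk4 m by linarith
  moreover have "digit_sum (4 * q * ?h + (q + (?u + ?m))) = digit_sum ?h + digit_sum (q + (?u + ?m))"
    by (rule digit_sum_split4) (use um in linarith)
  moreover have "digit_sum (q + (?u + ?m)) = 1 + digit_sum (?u + ?m)"
    by (rule digit_sum_split1) (rule um)
  ultimately have d5: "digit_sum (n + ?k1 - 1) = digit_sum ?h + 1 + digit_sum d + Suc t"
    using dum by (simp only:)
  have "n + ?k2 - 1 = 4 * q * ?h + (2 * q * 1 + (?u + ?m))"
    using n' blk4 m by linarith
  moreover have "digit_sum (4 * q * ?h + (2 * q * 1 + (?u + ?m))) = digit_sum ?h + digit_sum (2 * q * 1 + (?u + ?m))"
    by (rule digit_sum_split4) (use um in linarith)
  moreover have "digit_sum (2 * q * 1 + (?u + ?m)) = digit_sum 1 + digit_sum (?u + ?m)"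
    by (rule digit_sum_split) (use um in linarith)
  ultimately have d6: "digit_sum (n + ?k2 - 1) = digit_sum ?h + (1 + (digit_sum d + Suc t))"
    using dum by (simp only: digit_sum_1 One_nat_def)
  show "v2 (coeff (Tpoly n) ?k1) = int (digit_sum ?h)"
    using v2_Tpoly_altdef[OF n1 ge(1) le(1)] by (simp only: v2k d1 d3 d5) simp
  show "v2 (coeff (Tpoly n) ?k2) = int (digit_sum ?h) + 1"
    using v2_Tpoly_altdef[OF n1 ge(2) le(2)] by (simp only: v2k d2 d4 d6) simp
qed

lemma digit_sum_weight_odd:
  assumes "0 < i" "i < q" "v2 (of_nat i) = int t" "i \<noteq> 2 ^ t"
  shows "int i + int q + 1 \<le> int q * int (digit_sum i)"
proof -
  have "digit_sum i \<noteq> 1"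
  proof
    assume "digit_sum i = 1"
    then obtain j where "i = 2 ^ j" using digit_sum_eq_1 by blast
    then show False using assms by (simp add: v2_power)
  qed
  then have "digit_sum i \<ge> 2" using digit_sum_pos[of i] assms(1) by linarith
  then have "int q * 2 \<le> int q * int (digit_sum i)" by (intro mult_left_mono) auto
  then show ?thesis using assms(2) by linarith
qed

text \<open>For \<open>v2 k \<noteq> t\<close> the strong bound suffices. For
  \<open>v2 k = t\<close> the weak bound loses a whole \<open>q\<close>, which is regained either
  from lying in an earlier block or from a second digit: apart from the two exponents of
  \<open>leadT\<close>, the part of \<open>k\<close> below \<open>q\<close> is then no power of
  2.\<close>

lemma Tpoly_lead:
  assumes "q < n mod (2 * q)" "v2 (of_nat n) = int t"
  shows "poly_ge q (Tpoly n - leadT n t) (om n + 1 - 2 ^ t)"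
  unfolding poly_ge_def
proof
  fix k
  let ?s = "digit_sum (n div (2 * q))"
  note T = v2_Tpoly_lead[OF assms]
  have n1: "n \<ge> 1" using T(3) by (metis add_leE one_le_numeral one_le_power order_trans)
  consider "k = blk n + 2 ^ t" | "k = blk n + q + 2 ^ t"
    | "k = 0 \<or> n < k" "k \<noteq> blk n + 2 ^ t" "k \<noteq> blk n + q + 2 ^ t"
    | "1 \<le> k" "k \<le> n" "k \<noteq> blk n + 2 ^ t" "k \<noteq> blk n + q + 2 ^ t" by linarith
  then show "kge q (coeff (Tpoly n - leadT n t) k) (om n + 1 - 2 ^ t + int k)"
  proof cases
    case 1
    have "kge q (coeff (Tpoly n) k - 2 ^ ?s) (om n + 1 - 2 ^ t + int k)"
    proof (rule kge_sub)
      show "v2 (coeff (Tpoly n) k) = int ?s" using T(1) 1 by simp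
      show "om n + 1 - 2 ^ t + int k \<le> int q * (int ?s + 1)"
        using int_blk[of n] 1 q_ge_2 by (simp add: algebra_simps)
    qed (use T(3) 1 n1 in \<open>auto simp: coeff_Tpoly_nz_iff v2_power\<close>)
    then show ?thesis by (simp add: coeff_leadT 1)
  next
    case 2
    have "kge q (coeff (Tpoly n) k - 2 ^ (?s + 1)) (om n + 1 - 2 ^ t + int k)"
    proof (rule kge_sub)
      show "v2 (coeff (Tpoly n) k) = int ?s + 1" using T(2) 2 by simp
      show "om n + 1 - 2 ^ t + int k \<le> int q * (int ?s + 1 + 1)"
        using int_blk[of n] 2 q_ge_2 by (simp add: algebra_simps)
    next
      show "v2 (2 ^ (?s + 1)) = int ?s + 1" using v2_power[of 2 "?s + 1"] by simp
    qed (use T(3) 2 n1 in \<open>auto simp: coeff_Tpoly_nz_iff\<close>)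
    then show ?thesis using q_ge_2 by (simp add: coeff_leadT 2)
  next
    case 3
    then have "coeff (Tpoly n) k = 0" using coeff_Tpoly_nz_iff[OF n1] by blast
    then show ?thesis using 3 by (simp add: coeff_leadT)
  next
    case 4
    have nz: "coeff (Tpoly n) k \<noteq> 0" using coeff_Tpoly_nz_iff[OF n1] 4 by auto
    have pos: "(1 :: int) \<le> 2 ^ t" by simp
    have "om n + 1 - 2 ^ t + int k \<le> int q * v2 (coeff (Tpoly n) k)"
    proof (cases "v2 (of_nat k) = int t")
      case False
      then have "int q * int (digit_sum k) \<le> int q * v2 (coeff (Tpoly n) k)"
        using v2_Tpoly_ge_strong[OF n1 4(1,2)] assms(2) by (intro mult_left_mono) auto
      then show ?thesis using weight_ge[OF 4(2)] pos by linarith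
    next
      case v2k: True
      have "int q * (int (digit_sum k) - 1) \<le> int q * v2 (coeff (Tpoly n) k)"
        using v2_Tpoly_ge[OF n1 4(1,2)] by (intro mult_left_mono) auto
      moreover have "om n + 1 - 2 ^ t + int k + int q \<le> int q * int (digit_sum k)"
      proof (cases "k div (2 * q) = n div (2 * q)")
        case False
        then have "k div (2 * q) < n div (2 * q)"
          using div_le_mono[OF 4(2), of "2 * q"] by simp
        from om_block_less[OF this] show ?thesis
          using weight_ge[of k k] pos by linarith
      next
        case True
        let ?i = "k mod (2 * q)"
        have i2: "?i < 2 * q" using q_ge_2 by simp
        have k: "k = blk n + ?i" using blk_mod[of k] True by (simp add: blk_def)
        have te: "t < e" using interior_decomp[OF assms] by blast
        \<comment> \<open>Since \<open>v2 k = t < e\<close>, the tied remainders \<open>0\<close>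
          and \<open>q\<close> do not occur.\<close>
        have nq: "\<not> q dvd k"
        proof
          assume "q dvd k"
          then have "2 ^ e dvd int k" by (auto simp: q_def elim!: dvdE)
          then show False using power2_dvd_iff_v2[of "int k" e] 4(1) v2k te by simp
        qed
        have "q dvd blk n" by (simp add: blk_def)
        then have i0: "?i \<noteq> 0" "?i \<noteq> q"
          using nq k by (metis dvd_add dvd_0_right dvd_refl)+
        have "int ?i + 1 - 2 ^ t + int q \<le> int q * int (digit_sum ?i)"
        proof (cases "?i < q")
          case True
          have i1: "0 < ?i" using i0 by simp
          have keq: "k = q * (2 * (n div (2 * q))) + ?i"
            using k unfolding blk_def by linarith
          have v2i: "v2 (of_nat ?i) = int t"
            by (subst v2k[symmetric], subst (2) keq) (rule v2_add_q[OF i1 True, symmetric])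
          have "?i \<noteq> 2 ^ t" using 4(3) k by linarith
          then have "int ?i + int q + 1 \<le> int q * int (digit_sum ?i)"
            by (rule digit_sum_weight_odd[OF i1 True v2i])
          then show ?thesis using pos by linarith
        next
          case False
          let ?j = "?i - q"
          have j: "0 < ?j" "?j < q" using False i0 i2 by linarith+
          have "k = blk n + q + ?j" using False k by linarith
          also have "\<dots> = q * (2 * (n div (2 * q)) + 1) + ?j" by (simp add: blk_def)
          finally have keq: "k = q * (2 * (n div (2 * q)) + 1) + ?j" .
          have "v2 (of_nat ?j) = int t"
            by (subst v2k[symmetric], subst (2) keq) (rule v2_add_q[OF j, symmetric])
          moreover have "?j \<noteq> 2 ^ t"
            using 4(4) False k by linarith
          ultimately have jw: "int ?j + int q + 1 \<le> int q * int (digit_sum ?j)"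
            by (intro digit_sum_weight_odd[OF j])
          have iq: "?i = q + ?j" using False by linarith
          have dj: "digit_sum (q + ?j) = 1 + digit_sum ?j" by (rule digit_sum_split1) (rule j)
          have "int q * int (digit_sum ?i) = int q * (1 + int (digit_sum ?j))"
            by (subst iq) (simp only: dj of_nat_add of_nat_1)
          then have "int q * int (digit_sum ?i) = int q + int q * int (digit_sum ?j)"
            by (simp only: distrib_left mult_1_right)
          moreover have "int ?i = int q + int ?j"
            by (subst iq) (simp only: of_nat_add)
          ultimately show ?thesis using pos jw by linarith
        qed
        moreover have "om k = om n" using True by (simp add: om_def)
        ultimately show ?thesis using weight_mod[of k] by linarith
      qed
      ultimately show ?thesis by (simp add: algebra_simps)
    qed
    then show ?thesis using 4 nz by (simp add: coeff_leadT kge_def)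
  qed
qed

lemma interior_pred:
  assumes "q < n mod (2 * q)"
  shows "(n - 1) div (2 * q) = n div (2 * q)" "(n - 1) mod (2 * q) = n mod (2 * q) - 1"
proof -
  have "n - 1 = 2 * q * (n div (2 * q)) + (n mod (2 * q) - 1)"
    using blk_mod[of n] assms q_ge_2 unfolding blk_def by linarith
  moreover have "n mod (2 * q) - 1 < 2 * q"
    using q_ge_2 by (meson less_imp_diff_less mod_less_divisor mult_pos_pos zero_less_numeral less_le_trans)
  ultimately show "(n - 1) div (2 * q) = n div (2 * q)" "(n - 1) mod (2 * q) = n mod (2 * q) - 1"
    by (metis div_mult_self4 div_less add_0_right mod_mult_self4 mod_less div_mult_self2 mult_is_0 not_less_zero add.commute)+
qed

text \<open>As \<open>q < n mod (2 * q)\<close>, the index \<open>n - 1\<close> stays in the upper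
  half of the same block, so \<open>Qpoly (n - 1)\<close> has the leading part of
  \<open>Qpoly n\<close>.\<close>

lemma Tpoly_approx:
  assumes "q < n mod (2 * q)" "v2 (of_nat n) = int t"
  shows "poly_ge q (Tpoly n - monom 1 (2 ^ t) * Qpoly (n - 1)) (om n + 1 - 2 ^ t)"
proof -
  note pr = interior_pred[OF assms(1)]
  have "om (n - 1) = om n" "lead (n - 1) = lead n"
    by (simp_all only: om_def lead_def blk_def pr)
  moreover have "poly_ge q (Qpoly (n - 1) - lead (n - 1)) (om (n - 1) + 1)"
    by (rule Qpoly_lead) (use pr(2) assms(1) in linarith)
  ultimately have "poly_ge q (Qpoly (n - 1) - lead n) (om n + 1)" by simp
  moreover have "poly_ge q (monom 1 (2 ^ t)) (- (2 ^ t))"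
    by (simp add: poly_ge_def kge_def)
  ultimately have "poly_ge q (monom 1 (2 ^ t) * (Qpoly (n - 1) - lead n)) (- (2 ^ t) + (om n + 1))"
    using poly_ge_mult by blast
  moreover have "- (2 ^ t) + (om n + 1) = om n + 1 - 2 ^ t" by simp
  ultimately have *: "poly_ge q (monom 1 (2 ^ t) * (Qpoly (n - 1) - lead n)) (om n + 1 - 2 ^ t)"
    by metis
  have "poly_ge q (monom (- 1) 0) 0"
    using v2_minus[of 1] by (simp add: poly_ge_def kge_def)
  from poly_ge_mult[OF this *] have "poly_ge q (- (monom 1 (2 ^ t) * (Qpoly (n - 1) - lead n))) (om n + 1 - 2 ^ t)"
    by (simp add: monom_0)
  with Tpoly_lead[OF assms] have "poly_ge q ((Tpoly n - leadT n t) + - (monom 1 (2 ^ t) * (Qpoly (n - 1) - lead n))) (om n + 1 - 2 ^ t)"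
    by (rule poly_ge_add)
  moreover have "(Tpoly n - leadT n t) + - (monom 1 (2 ^ t) * (Qpoly (n - 1) - lead n)) =
      Tpoly n - monom 1 (2 ^ t) * Qpoly (n - 1)"
    by (simp add: leadT_def algebra_simps)
  ultimately show ?thesis by metis
qed

end

section \<open>Logarithmic derivatives of shifted Legendre polynomials\<close>

text \<open>Indices are extended to all integers by the symmetry \<open>P\<^bsub>-1-j\<^esub> = P\<^sub>j\<close> of Legendre's
  equation; this treats congruences for \<open>n - m\<close> and for \<open>n + m + 1\<close> alike.\<close>

definition refl_index :: "int \<Rightarrow> nat" where
  "refl_index j = nat (if 0 \<le> j then j else - 1 - j)"

definition Qi :: "int \<Rightarrow> rat poly fract" where
  "Qi j = Qf (refl_index j)"

definition zi :: "int \<Rightarrow> rat poly fract" where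
  "zi j = zf (refl_index j)"

text \<open>Normalised so that \<open>Qi j / Qi (j - 1) = 1 + 2 * rho j\<close>, while for
  \<open>sig\<close> below \<open>Qi (j - 1) / Qi j = 1 - 2 * sig j\<close>.\<close>

definition rho :: "int \<Rightarrow> rat poly fract" where
  "rho j = (Qi j - Qi (j - 1)) / (2 * Qi (j - 1))"

definition sig :: "int \<Rightarrow> rat poly fract" where
  "sig j = (Qi j - Qi (j - 1)) / (2 * Qi j)"

lemma refl_index_of_nat [simp]: "refl_index (int n) = n"
  by (simp add: refl_index_def)

lemma refl_index_reflect: "refl_index (- 1 - j) = refl_index j"
  by (simp add: refl_index_def)

lemma Qi_nz [simp]: "Qi j \<noteq> 0"
  by (simp add: Qi_def)

lemma Qi_reflect: "Qi (- 1 - j) = Qi j" and zi_reflect: "zi (- 1 - j) = zi j"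
  by (simp_all add: Qi_def zi_def refl_index_reflect)

lemma Qi_reflect': "Qi (- j - 1) = Qi j" and zi_reflect': "zi (- j - 1) = zi j"
  using Qi_reflect[of j] zi_reflect[of j] by (simp_all only: minus_diff_commute)

lemma rho_minus: "rho (- j) = - sig j" and sig_minus: "sig (- j) = - rho j"
proof -
  have "Qi (- j) = Qi (j - 1)" "Qi (- j - 1) = Qi j"
    using Qi_reflect[of "j - 1"] Qi_reflect'[of j] by simp_all
  then show "rho (- j) = - sig j" "sig (- j) = - rho j"
    by (simp_all add: rho_def sig_def minus_divide_left)
qed

lemma zi_eq_sig_nat:
  assumes "n \<ge> 1"
  shows "zi (int n) = of_int (int n) * (Xf + sig (int n))"
    and "zi (int n - 1) = of_int (int n) * (rho (int n) - Xf)"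
proof -
  have n1: "refl_index (int n - 1) = n - 1"
    using assms by (simp add: refl_index_def of_nat_diff nat_diff_distrib)
  have "2 * zi (int n) = 2 * (of_int (int n) * (Xf + sig (int n)))"
    using zf_contiguous(1)[OF assms] two_nz
    by (simp add: zi_def sig_def Qi_def n1 field_simps)
  then show "zi (int n) = of_int (int n) * (Xf + sig (int n))"
    using two_nz mult_cancel_left by blast
  have "2 * zi (int n - 1) = 2 * (of_int (int n) * (rho (int n) - Xf))"
    using zf_contiguous(2)[OF assms] two_nz
    by (simp add: zi_def rho_def Qi_def n1 field_simps)
  then show "zi (int n - 1) = of_int (int n) * (rho (int n) - Xf)"
    using two_nz mult_cancel_left by blast
qed

text \<open>The constant 1 of the ratio cancels in the contiguous relations and the factor 2 divides
  out. Negative \<open>j\<close> follow by reflection; for \<open>j = 0\<close> the indices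
  \<open>0\<close> and \<open>-1\<close> both stand for \<open>zf 0 = 0\<close>.\<close>

lemma zi_eq_sig: "zi j = of_int j * (Xf + sig j)"
  and zi_pred_eq_rho: "zi (j - 1) = of_int j * (rho j - Xf)"
proof -
  consider n where "n \<ge> 1" "j = int n" | "j = 0" | n where "n \<ge> 1" "j = - int n"
  proof (cases "0 \<le> j")
    case True
    then obtain n where n: "j = int n" using nonneg_int_cases by blast
    show ?thesis by (cases "n = 0") (use n that in auto)
  next
    case False
    then have "- j \<ge> 0" by simp
    then obtain n where n: "- j = int n" using nonneg_int_cases by blast
    with False have "n \<ge> 1" "j = - int n" by auto
    then show ?thesis by (rule that(3))
  qed
  then have "zi j = of_int j * (Xf + sig j) \<and> zi (j - 1) = of_int j * (rho j - Xf)"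
  proof cases
    case 1
    then show ?thesis using zi_eq_sig_nat by simp
  next
    case 2
    then show ?thesis by (simp add: zi_def refl_index_def)
  next
    case (3 n)
    have "zi j = zi (int n - 1)" "zi (j - 1) = zi (int n)"
      using zi_reflect[of "int n - 1"] zi_reflect'[of "int n"] 3 by simp_all
    then show ?thesis
      using zi_eq_sig_nat[OF 3(1)] rho_minus[of "int n"] sig_minus[of "int n"] 3(2)
      by (simp add: algebra_simps)
  qed
  then show "zi j = of_int j * (Xf + sig j)" "zi (j - 1) = of_int j * (rho j - Xf)" by auto
qed

lemma ratio_eq: "1 + 2 * rho j = Qi j / Qi (j - 1)"
  using two_nz by (simp add: rho_def field_simps)

lemma sig_eq: "sig j = rho j / (1 + 2 * rho j)"
  unfolding ratio_eq using two_nz by (simp add: rho_def sig_def field_simps)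

lemma ratio_nz: "1 + 2 * rho j \<noteq> 0"
  by (simp add: ratio_eq)

text \<open>The Moebius map \<open>rho \<mapsto> rho / (1 + 2 rho)\<close> differs from the identity
  by a quadratic term with a factor 2, and that factor is worth \<open>q\<close>.\<close>

lemma sig_rho: "sig j = rho j - 2 * (rho j)\<^sup>2 / (1 + 2 * rho j)"
  using ratio_nz[of j] by (simp add: sig_eq field_simps power2_eq_square)

lemma wge_of_int:
  assumes "d \<le> int q * v2 (of_int n) \<or> n = 0"
  shows "wge q (of_int n) d"
  using assms by (cases "n = 0") (auto simp: wge_def wval_of_int)

lemma wge_Xf_power: "wge q (Xf ^ n) (- int n)"
  by (simp add: wge_def wval_power)

lemma wge_2: "wge q 2 (int q)"
  by (simp add: wge_def)

lemma v2_of_int_add_eq: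
  assumes "a \<noteq> 0" "b = 0 \<or> v2 (of_int a) < v2 (of_int b)"
  shows "v2 (of_int (a + b)) = v2 (of_int a)"
  using v2_add_eq(2)[of "of_int a" "of_int b"] assms by simp

lemma v2_of_int_add_gt:
  assumes "a \<noteq> 0" "b \<noteq> 0" "v2 (of_int a) = v2 (of_int b)" "a + b \<noteq> 0"
  shows "v2 (of_int a) < v2 (of_int (a + b))"
  using v2_sub_ge[of "of_int a" "- of_int b"] assms
  by (simp add: add_eq_0_iff2 flip: of_int_add)

section \<open>Leading terms of ratios of consecutive polynomials\<close>

context dyadic_radius
begin

definition good :: "int \<Rightarrow> nat \<Rightarrow> bool" where
  "good j t \<longleftrightarrow> t < e \<and> j \<noteq> 0 \<and> v2 (of_int j) = int t \<and> wge q (rho j - Xf ^ (2 ^ t)) (1 - 2 ^ t)"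

lemma two_power_le:
  assumes "t < e"
  shows "2 * 2 ^ t \<le> int q"
proof -
  have "(2 :: int) ^ Suc t \<le> 2 ^ e" using assms by (intro power_increasing) auto
  then show ?thesis by (simp add: q_def)
qed

lemma good_rho:
  assumes "good j t"
  shows "wge q (rho j) (- (2 ^ t))"
proof -
  have "wge q (rho j - Xf ^ (2 ^ t)) (- (2 ^ t))"
    using assms by (auto simp: good_def elim: wge_mono)
  from wge_add[OF this, of "Xf ^ (2 ^ t)"] show ?thesis
    using wge_Xf_power[of q "2 ^ t"] by simp
qed

lemma good_ratio:
  assumes "good j t"
  shows "wval q (1 + 2 * rho j) = 0"
proof -
  have t: "t < e" using assms by (simp add: good_def)
  have "wge q (2 * rho j) 1"
    using two_power_le[OF t] by (intro wge_mult_le[OF wge_2 good_rho[OF assms]]) (smt (verit) zero_less_power)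
  then show ?thesis using wval_add_eq(2)[of 1 q "2 * rho j"] by simp
qed

lemma good_tau:
  assumes "good j t"
  shows "wge q ((rho j)\<^sup>2 / (1 + 2 * rho j)) (- (2 * 2 ^ t))"
proof -
  have "wge q ((rho j)\<^sup>2) (- (2 * 2 ^ t))"
    using wge_power[OF good_rho[OF assms], of 2] by simp
  from wge_divide[OF this ratio_nz[of j]] show ?thesis
    by (simp add: good_ratio[OF assms])
qed

lemma good_sig:
  assumes "good j t"
  shows "wge q (sig j - Xf ^ (2 ^ t)) (1 - 2 ^ t)"
proof -
  have t: "t < e" using assms by (simp add: good_def)
  have "wge q (2 * ((rho j)\<^sup>2 / (1 + 2 * rho j))) (1 - 2 ^ t)"
    using two_power_le[OF t] by (intro wge_mult_le[OF wge_2 good_tau[OF assms]]) (smt (verit) zero_less_power)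
  moreover have "wge q (rho j - Xf ^ (2 ^ t)) (1 - 2 ^ t)"
    using assms by (simp add: good_def)
  ultimately have "wge q ((rho j - Xf ^ (2 ^ t)) - 2 * ((rho j)\<^sup>2 / (1 + 2 * rho j))) (1 - 2 ^ t)"
    by (rule wge_diff[rotated])
  then show ?thesis by (simp add: sig_rho algebra_simps)
qed

text \<open>Reflection turns \<open>rho\<close> into \<open>- sig\<close>, whose leading term has
  the wrong sign; the discrepancy \<open>2 * Xf ^ (2 ^ t)\<close> is absorbed by the error.\<close>

lemma good_minus:
  assumes "good j t"
  shows "good (- j) t"
proof -
  have t: "t < e" using assms by (simp add: good_def)
  have "wge q (2 * Xf ^ (2 ^ t)) (1 - 2 ^ t)"
    using q_ge_2 by (intro wge_mult_le[OF wge_2 wge_Xf_power]) simp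
  with good_sig[OF assms] have "wge q (- (sig j - Xf ^ (2 ^ t)) - 2 * Xf ^ (2 ^ t)) (1 - 2 ^ t)"
    by (intro wge_diff) (simp_all only: wge_minus)
  moreover have "- (sig j - Xf ^ (2 ^ t)) - 2 * Xf ^ (2 ^ t) = rho (- j) - Xf ^ (2 ^ t)"
    by (simp add: rho_minus)
  ultimately have "wge q (rho (- j) - Xf ^ (2 ^ t)) (1 - 2 ^ t)"
    by (simp only:)
  then show ?thesis using assms by (simp add: good_def)
qed

lemma Tpoly_Qi:
  assumes "n \<ge> 1"
  shows "2 * to_fract (Tpoly n) = Qi (int n) - Qi (int n - 1)"
proof -
  have idx: "refl_index (int n - 1) = n - 1"
    using assms by (simp add: refl_index_def of_nat_diff nat_diff_distrib)
  have "Tpoly n + Tpoly n = Qpoly n - Qpoly (n - 1)"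
    by (simp add: Tpoly_def flip: smult_add_left)
  then have "to_fract (Tpoly n) + to_fract (Tpoly n) = to_fract (Qpoly n) - to_fract (Qpoly (n - 1))"
    by (simp only: to_fract_add[symmetric] to_fract_diff[symmetric])
  then show ?thesis
    by (simp only: Qi_def Qf_def idx refl_index_of_nat mult_2)
qed

lemma good_interior:
  assumes "q < n mod (2 * q)" "v2 (of_nat n) = int t"
  shows "good (int n) t"
proof -
  note pr = interior_pred[OF assms(1)]
  have n1: "n \<ge> 1" using assms(1) by (metis One_nat_def Suc_leI mod_0 neq0_conv not_less_zero)
  have idx: "refl_index (int n - 1) = n - 1"
    using n1 by (simp add: refl_index_def of_nat_diff nat_diff_distrib)
  have om: "om (n - 1) = om n" by (simp only: om_def pr)
  let ?P = "Tpoly n - monom 1 (2 ^ t) * Qpoly (n - 1)"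
  have Qn1: "Qi (int n - 1) = Qf (n - 1)" by (simp add: Qi_def idx)
  have "rho (int n) = to_fract (Tpoly n) / Qf (n - 1)"
    unfolding rho_def Tpoly_Qi[OF n1, symmetric] using two_nz by (simp add: Qn1)
  then have "rho (int n) - Xf ^ (2 ^ t) = to_fract ?P / Qf (n - 1)"
    by (simp add: to_fract_monom_1 diff_divide_distrib Qf_def[symmetric])
  moreover have "wge q (to_fract ?P) (om n + 1 - 2 ^ t)"
    using Tpoly_approx[OF assms] by (simp only: wge_to_fract)
  from wge_divide[OF this Qf_nz, of "n - 1"]
  have "wge q (to_fract ?P / Qf (n - 1)) (1 - 2 ^ t)"
    by (simp add: wval_Qf om[unfolded One_nat_def])
  ultimately have "wge q (rho (int n) - Xf ^ (2 ^ t)) (1 - 2 ^ t)"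
    by (simp only:)
  moreover have "t < e" using interior_decomp[OF assms] by blast
  ultimately show ?thesis using assms n1 by (simp add: good_def)
qed

text \<open>A crude bound valid for every positive index; it serves the left end of the upper
  half-block, which \<open>good_interior\<close> does not reach.\<close>

lemma sig_ge:
  assumes "n \<ge> 1"
  shows "wge q (sig (int n)) (- int q)"
proof -
  have "sig (int n) = to_fract (Tpoly n) / Qf n"
    unfolding sig_def Tpoly_Qi[OF assms, symmetric] using two_nz by (simp add: Qi_def)
  moreover have "wge q (to_fract (Tpoly n) / Qf n) (om n - int q - om n)"
    using wge_divide[OF _ Qf_nz, of q "to_fract (Tpoly n)" "om n - int q" n] poly_ge_Tpoly[OF assms]
    by (simp add: wval_Qf wge_to_fract)
  ultimately show ?thesis by simp
qed

text \<open>Computes the valuation of \<open>n Q_n / Q_(n-1)\<close>. When \<open>2 q\<close>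
  divides \<open>n\<close>, crossing a block boundary lowers \<open>om\<close> by exactly what
  \<open>v2 n\<close> has in excess of \<open>e\<close>.\<close>

lemma om_step:
  assumes "n \<ge> 1"
  shows "int q * v2 (of_nat n) + om n - om (n - 1) = int q * min (v2 (of_nat n)) (int e)"
proof (cases "2 * q dvd n")
  case True
  then obtain h where h: "n = 2 * q * h" by (auto elim: dvdE)
  then obtain h' where h': "h = Suc h'" using assms by (cases h) auto
  have "n - 1 = 2 * q * h' + (2 * q - 1)" using h h' q_ge_2 by simp
  moreover have "2 * q - 1 < 2 * q" using q_ge_2 by simp
  ultimately have "(n - 1) div (2 * q) = h'"
    by (metis div_mult_self4 div_less add_0_right mult_is_0 not_less_zero)
  moreover have "n div (2 * q) = Suc h'" using h h' q_ge_2 by simp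
  ultimately have om: "om n - om (n - 1) = int q * (int (digit_sum (Suc h')) - int (digit_sum h') - 2)"
    by (simp add: om_def algebra_simps)
  have "v2 (of_nat n) = v2 (of_nat (2 ^ Suc e)) + v2 (of_nat (Suc h'))"
    unfolding h h' of_nat_mult by (subst v2_mult) (auto simp: q_def simp del: of_nat_Suc)
  also have "v2 (of_nat (2 ^ Suc e)) = int e + 1"
    using v2_power[of 2 "Suc e"] by simp
  finally have v: "v2 (of_nat n) = int e + 1 + v2 (of_nat (Suc h'))" .
  have "int (digit_sum (Suc h')) - int (digit_sum h') - 2 = - 1 - v2 (of_nat (Suc h'))"
    using digit_sum_Suc[of h'] by linarith
  then have om': "om n - om (n - 1) = int q * (- 1 - v2 (of_nat (Suc h')))"
    using om by (simp only:)
  have "int q * v2 (of_nat n) + (om n - om (n - 1)) = int q * int e"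
    unfolding om' v by (simp add: algebra_simps)
  moreover have "min (v2 (of_nat n)) (int e) = int e"
    using v v2_of_nat_nonneg[of "Suc h'"] by simp
  ultimately show ?thesis by (simp only: add_diff_eq)
next
  case False
  have "\<not> int (Suc e) \<le> v2 (of_int (int n))"
  proof
    assume "int (Suc e) \<le> v2 (of_int (int n))"
    then have "2 ^ Suc e dvd int n"
      using power2_dvd_iff_v2[of "int n" "Suc e"] assms by simp
    then have "2 * q dvd n"
      using of_nat_dvd_iff[of "2 * q" n, where 'a = int] by (simp add: q_def)
    with False show False by simp
  qed
  then have "min (v2 (of_nat n)) (int e) = v2 (of_nat n)" by simp
  moreover have "(n - 1) div (2 * q) = n div (2 * q)"
  proof -
    have "n mod (2 * q) \<noteq> 0" using False by (simp add: dvd_eq_mod_eq_0)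
    then have "n - 1 = 2 * q * (n div (2 * q)) + (n mod (2 * q) - 1)"
      using blk_mod[of n] unfolding blk_def by linarith
    moreover have "n mod (2 * q) - 1 < 2 * q"
      using q_ge_2 by (simp add: less_imp_diff_less)
    ultimately show ?thesis
      by (metis div_mult_self4 div_less add_0_right mult_is_0 not_less_zero)
  qed
  then have "om (n - 1) = om n" by (simp add: om_def)
  ultimately show ?thesis by simp
qed

section \<open>Translation by multiples of \<open>2 * q\<close>\<close>

lemma v2_shift_min:
  assumes "n \<ge> 1" "D > 0" "int e < v2 (of_nat D)"
  shows "min (v2 (of_nat (n + D))) (int e) = min (v2 (of_nat n)) (int e)"
    and "min (v2 (of_nat n)) (int e) + 1 \<le> v2 (of_nat (2 * n + D))"
proof -
  show "min (v2 (of_nat (n + D))) (int e) = min (v2 (of_nat n)) (int e)"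
  proof (cases "v2 (of_nat n) \<le> int e")
    case True
    then have "v2 (of_nat n + of_nat D) = v2 (of_nat n)"
      using assms by (intro v2_add_eq(2)) auto
    then show ?thesis by simp
  next
    case False
    have "min (v2 (of_nat n)) (v2 (of_nat D)) \<le> v2 (of_nat n + of_nat D)"
      using assms by (intro v2_add_ge) (auto simp flip: of_nat_add)
    then show ?thesis using False assms by simp
  qed
  have "v2 (of_nat (2 * n)) = 1 + v2 (of_nat n)"
    using assms by (simp add: v2_mult)
  moreover have "min (v2 (of_nat (2 * n))) (v2 (of_nat D)) \<le> v2 (of_nat (2 * n) + of_nat D)"
    using assms by (intro v2_add_ge) (auto simp flip: of_nat_add)
  ultimately show "min (v2 (of_nat n)) (int e) + 1 \<le> v2 (of_nat (2 * n + D))"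
    using assms by (simp add: min_def split: if_splits)
qed

lemma wge_of_nat: "n > 0 \<Longrightarrow> d \<le> int q * v2 (of_nat n) \<Longrightarrow> wge q (of_nat n) d"
  using wge_of_int[of d q "int n"] by simp

text \<open>Let \<open>s = N Q_N / Q_(N-1)\<close>. Then \<open>2 z_(N-1)\<close> is
  \<open>s\<close> and \<open>2 z_N\<close> is \<open>- N^2 / s\<close>, each up to a multiple of
  \<open>1 + 2X\<close>. By \<open>om_step\<close> and \<open>v2_shift_min\<close> translation by
  \<open>D\<close> preserves the valuation of \<open>s\<close>, so the error does not grow along the
  induction.\<close>

lemma zf_translate:
  assumes "D > 0" "int e < v2 (of_nat D)"
  shows "wge q (2 * (zf (n + D) - zf n) - of_nat D) (int q * v2 (of_nat D) + 1)"
proof (induction n)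
  case 0
  let ?f = "v2 (of_nat D)"
  \<comment> \<open>Here \<open>zf 0 = 0\<close>, and \<open>Qf (D - 1) / Qf D\<close> is small
    because a block starts at \<open>D\<close>.\<close>
  have "om (D - 1) - om D = int q * (?f - int e)"
    using om_step[of D] assms by (simp add: algebra_simps min_def)
  moreover have "int q * 1 \<le> int q * (?f - int e)"
    using assms by (intro mult_left_mono) auto
  ultimately have "1 \<le> om (D - 1) - om D" using q_ge_2 by linarith
  then have "wge q (Qf (D - 1) / Qf D) 1"
    by (simp add: wge_def wval_divide wval_Qf)
  moreover have "wge q (2 * Xf) 1"
    using q_ge_2 by (simp add: wge_def wval_mult)
  ultimately have "wge q (of_nat D * (2 * Xf - Qf (D - 1) / Qf D)) (int q * ?f + 1)"
    using assms by (intro wge_mult wge_diff wge_of_nat) auto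
  moreover have "2 * zf D - of_nat D = of_nat D * (2 * Xf - Qf (D - 1) / Qf D)"
    using zf_contiguous(1)[of D] assms by (simp add: algebra_simps)
  ultimately show ?case by simp
next
  case (Suc n)
  let ?f = "v2 (of_nat D)"
  define N where "N = Suc n"
  define N' where "N' = N + D"
  define \<mu> where "\<mu> = min (v2 (of_nat N)) (int e)"
  define a where "a = (of_nat N :: rat poly fract)"
  define d where "d = (of_nat D :: rat poly fract)"
  define r where "r = Qf N / Qf (N - 1)"
  define r' where "r' = Qf N' / Qf (N' - 1)"
  have N: "N \<ge> 1" "N' \<ge> 1" by (simp_all add: N_def N'_def)
  have nz: "r \<noteq> 0" "r' \<noteq> 0" by (simp_all add: r_def r'_def)
  have a: "a \<noteq> 0" "wval q a = int q * v2 (of_nat N)"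
    using wval_of_nat[of N q] of_int_fract[of "int N"] N by (auto simp: a_def)
  have a'eq: "of_nat N' = a + d" by (simp add: N'_def a_def d_def)
  have a': "a + d \<noteq> 0" "wval q (a + d) = int q * v2 (of_nat N')"
    using wval_of_nat[of N' q] of_int_fract[of "int N'"] N unfolding a'eq[symmetric] by auto
  define s where "s = a * r"
  define s' where "s' = (a + d) * r'"
  have snz: "s \<noteq> 0" "s' \<noteq> 0" using a a' nz by (simp_all add: s_def s'_def)
  have ws': "wval q s' = int q * \<mu>"
    using om_step[OF N(2)] v2_shift_min(1)[OF N(1) assms] a' nz
    by (simp add: s'_def wval_mult r'_def wval_divide wval_Qf \<mu>_def N'_def[symmetric])
  have wr: "wval q r = int q * \<mu> - int q * v2 (of_nat N)"
    using om_step[OF N(1)] by (simp add: r_def wval_divide wval_Qf \<mu>_def)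
  have \<mu>: "int q * \<mu> \<le> int q * v2 (of_nat N)"
    by (intro mult_left_mono) (auto simp: \<mu>_def)
  have d: "wge q d (int q * ?f)"
    unfolding d_def using assms by (intro wge_of_nat) auto
  have z: "2 * zf N = a * (1 + 2 * Xf - 1 / r)" "2 * zf n = a * (r - (1 + 2 * Xf))"
    using zf_contiguous[OF N(1)] by (simp_all add: a_def r_def N_def)
  have z': "2 * zf N' = (a + d) * (1 + 2 * Xf - 1 / r')" "2 * zf (n + D) = (a + d) * (r' - (1 + 2 * Xf))"
    using zf_contiguous[OF N(2)] unfolding a'eq by (simp_all add: r'_def N'_def N_def)
  have "s' - s = (2 * (zf (n + D) - zf n) - d) + 2 * (d * (1 + Xf))"
    unfolding right_diff_distrib z z' s_def s'_def by (simp add: algebra_simps)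
  moreover have "wge q (2 * (d * (1 + Xf))) (int q * ?f + 1)"
  proof (rule wge_mult_le[OF wge_2 wge_mult[OF d]])
    show "wge q (1 + Xf) (- 1)" by (intro wge_add) (simp_all add: wge_def)
  qed (use q_ge_2 in simp)
  ultimately have ss: "wge q (s' - s) (int q * ?f + 1)"
    using Suc unfolding d_def by (metis wge_add)
  have "wge q (1 / r) 0"
    using wr \<mu> nz by (simp add: wge_def wval_divide)
  moreover have "wge q (a / s') 0"
    using a ws' \<mu> snz by (simp add: wge_def wval_divide)
  ultimately have "wge q (1 / r * (a / s') * (s' - s)) (0 + 0 + (int q * ?f + 1))"
    using ss by (intro wge_mult)
  moreover have "wge q (d * (of_nat (2 * N + D) / s')) (int q * ?f + 1)"
  proof (rule wge_mult_le[OF d])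
    have "int q * (\<mu> + 1) \<le> int q * v2 (of_nat (2 * N + D))"
      using v2_shift_min(2)[OF N(1) assms] by (intro mult_left_mono) (simp_all add: \<mu>_def)
    then have "int q \<le> int q * v2 (of_nat (2 * N + D)) - int q * \<mu>"
      by (simp add: algebra_simps)
    moreover have "wge q (of_nat (2 * N + D) / s') (int q * v2 (of_nat (2 * N + D)) - wval q s')"
      using N snz by (intro wge_divide wge_of_nat) auto
    ultimately show "wge q (of_nat (2 * N + D) / s') (int q)"
      unfolding ws' by (blast intro: wge_mono)
  qed (use q_ge_2 in simp)
  moreover have "wge q (2 * (d * Xf)) (int q * ?f + 1)"
    by (rule wge_mult_le[OF wge_2 wge_mult[OF d, of Xf "- 1"]]) (use q_ge_2 in \<open>simp_all add: wge_def\<close>)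
  ultimately have "wge q (2 * (d * Xf) - (d * (of_nat (2 * N + D) / s') - 1 / r * (a / s') * (s' - s))) (int q * ?f + 1)"
    by (intro wge_diff) simp_all
  \<comment> \<open>The difference of \<open>(a + d)^2 / s'\<close> and \<open>a^2 / s\<close> is
    split into a change of numerator and a change of denominator, matching the bounds just
    obtained.\<close>
  moreover have "2 * (d * Xf) - (d * (of_nat (2 * N + D) / s') - 1 / r * (a / s') * (s' - s)) =
      2 * (zf N' - zf N) - d"
  proof -
    have N2: "of_nat (2 * N + D) = 2 * a + d" by (simp add: a_def d_def)
    have e1: "(a + d) * (1 / r') = (a + d)\<^sup>2 / s'"
      unfolding s'_def using nz a'(1) by (simp add: power2_eq_square)
    have e2: "1 / r * (a / s') * s = a\<^sup>2 / s'"
      unfolding s_def using nz by (simp add: power2_eq_square)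
    have e3: "1 / r * (a / s') * s' = a * (1 / r)"
      using snz by simp
    have e4: "d * ((2 * a + d) / s') = (a + d)\<^sup>2 / s' - a\<^sup>2 / s'"
      using snz by (simp add: field_simps power2_eq_square)
    have "d * (of_nat (2 * N + D) / s') - 1 / r * (a / s') * (s' - s) = (a + d) * (1 / r') - a * (1 / r)"
      unfolding N2 e4 right_diff_distrib e1 e2 e3 by simp
    then show ?thesis
      unfolding right_diff_distrib z z' by (simp add: algebra_simps)
  qed
  ultimately show ?case
    by (simp add: N'_def N_def d_def)
qed

section \<open>Differences of logarithmic derivatives within one block\<close>

definition rel :: "int \<Rightarrow> int \<Rightarrow> nat \<Rightarrow> bool" where
  "rel j j' f \<longleftrightarrow> wge q (zi j' - zi j - 2 ^ f * Xf ^ (2 ^ f)) (int q * int f - 2 ^ f + 1)"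

lemma wge_power_2: "wge q (2 ^ f) (int q * int f)"
  using two_nz by (simp add: wge_def wval_power)

lemma wge_unit:
  assumes "m \<noteq> 0" "v2 (of_int m) = int f"
  shows "wge q (of_int m * Xf ^ (2 ^ f) - 2 ^ f * Xf ^ (2 ^ f)) (int q * int f - 2 ^ f + 1)"
proof -
  have "wge q (of_int (m - 2 ^ f)) (int q * (int f + 1))"
  proof (rule wge_of_int)
    show "int q * (int f + 1) \<le> int q * v2 (of_int (m - 2 ^ f)) \<or> m - 2 ^ f = 0"
    proof (cases "m = 2 ^ f")
      case False
      then have "(of_int m - 2 ^ f :: rat) \<noteq> 0"
        by (metis eq_iff_diff_eq_0 of_int_eq_iff of_int_numeral of_int_power)
      then have "int f + 1 \<le> v2 (of_int m - 2 ^ f)"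
        using assms by (intro v2_sub_ge) (auto simp: v2_power)
      then show ?thesis by (simp add: mult_left_mono)
    qed simp
  qed
  then have "wge q (of_int (m - 2 ^ f) * Xf ^ (2 ^ f)) (int q * int f - 2 ^ f + 1)"
    by (rule wge_mult_le[OF _ wge_Xf_power]) (use q_ge_2 in \<open>simp add: algebra_simps\<close>)
  then show ?thesis by (simp add: algebra_simps)
qed

lemma rel_sym:
  assumes "rel j j' f"
  shows "rel j' j f"
proof -
  have "wge q (2 * (2 ^ f * Xf ^ (2 ^ f))) (int q * int f - 2 ^ f + 1)"
    by (rule wge_mult_le[OF wge_2 wge_mult[OF wge_power_2 wge_Xf_power]]) (use q_ge_2 in simp)
  with assms have "wge q (- (zi j' - zi j - 2 ^ f * Xf ^ (2 ^ f)) - 2 * (2 ^ f * Xf ^ (2 ^ f))) (int q * int f - 2 ^ f + 1)"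
    unfolding rel_def by (intro wge_diff) (simp_all only: wge_minus)
  moreover have "- (zi j' - zi j - 2 ^ f * Xf ^ (2 ^ f)) - 2 * (2 ^ f * Xf ^ (2 ^ f)) = zi j - zi j' - 2 ^ f * Xf ^ (2 ^ f)"
    by (simp add: algebra_simps)
  ultimately show ?thesis unfolding rel_def by (simp only:)
qed

lemma two_le_power: "f \<ge> 1 \<Longrightarrow> (2 :: int) \<le> 2 ^ f"
  using power_increasing[of 1 f "2 :: int"] by simp

text \<open>In \<open>zi j' - zi j = (j' - j) X + j' sig j' - j sig j\<close> the middle summand
  dominates: the first is smaller because \<open>f \<ge> 1\<close> gives \<open>2^f > 1\<close>, the
  last by hypothesis.\<close>

lemma rel_direct:
  assumes "good j' f" "1 \<le> f" "j' \<noteq> j" "v2 (of_int (j' - j)) = int f"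
    and "wge q (of_int j * sig j) (int q * int f - 2 ^ f + 1)"
  shows "rel j j' f"
proof -
  let ?c = "int q * int f - 2 ^ f + 1"
  have f1: "wge q (of_int (j' - j) * Xf) ?c"
    using assms(2,4) two_le_power[OF assms(2)]
    by (intro wge_mult_le[OF wge_of_int[of "int q * int f"], of _ _ _ "-1"]) (auto simp: wge_def)
  have f2: "wge q (of_int j' * (sig j' - Xf ^ (2 ^ f))) ?c"
    using assms(1) good_sig[OF assms(1)]
    by (intro wge_mult_le[OF wge_of_int[of "int q * int f"]]) (auto simp: good_def)
  have f3: "wge q (of_int j' * Xf ^ (2 ^ f) - 2 ^ f * Xf ^ (2 ^ f)) ?c"
    using assms(1) by (intro wge_unit) (auto simp: good_def)
  from wge_diff[OF wge_add[OF wge_add[OF f1 f2] f3] assms(5)]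
  have "wge q (of_int (j' - j) * Xf + of_int j' * (sig j' - Xf ^ (2 ^ f))
      + (of_int j' * Xf ^ (2 ^ f) - 2 ^ f * Xf ^ (2 ^ f)) - of_int j * sig j) ?c" .
  moreover have "of_int (j' - j) * Xf + of_int j' * (sig j' - Xf ^ (2 ^ f))
      + (of_int j' * Xf ^ (2 ^ f) - 2 ^ f * Xf ^ (2 ^ f)) - of_int j * sig j =
      zi j' - zi j - 2 ^ f * Xf ^ (2 ^ f)"
    by (simp add: zi_eq_sig algebra_simps)
  ultimately show ?thesis unfolding rel_def by (simp only:)
qed

text \<open>The additional factor 2 in \<open>j\<close> is worth \<open>q\<close>, while
  \<open>sig j\<close> costs at most \<open>2^t \<le> q / 2\<close>.\<close>

lemma good_index_sig:
  assumes "good j t" "f < t"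
  shows "wge q (of_int j * sig j) (int q * int f - 2 ^ f + 1)"
proof -
  have t: "t < e" "v2 (of_int j) = int t" using assms(1) by (auto simp: good_def)
  have "wge q (sig j) (- (2 ^ t))"
    using good_rho[OF good_minus[OF assms(1)]] by (simp add: rho_minus)
  moreover have "wge q (of_int j) (int q * int t)"
    using t by (intro wge_of_int) simp
  moreover have "int q * int f - 2 ^ f + 1 \<le> int q * int t + - (2 ^ t)"
  proof -
    have "int q * (int f + 1) \<le> int q * int t"
      using assms(2) by (intro mult_left_mono) auto
    then have "int q * int f + int q \<le> int q * int t" by (simp add: algebra_simps)
    moreover have "(0 :: int) < 2 ^ f" "(0 :: int) < 2 ^ t" by simp_all
    ultimately show ?thesis using two_power_le[OF t(1)] by linarith
  qed
  ultimately show ?thesis using wge_mult_le by blast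
qed

text \<open>With equal valuations below \<open>f\<close> the leading terms of the \<open>sig\<close>
  cancel, so no direct estimate is available. But
  \<open>zi j - zi (j - 1) = 2 j (X - \<tau>)\<close> with
  \<open>\<tau> = rho^2 / (1 + 2 rho)\<close>: a simultaneous step changes the difference only by
  terms carrying a factor 2.\<close>

lemma rel_shift:
  assumes "good j t" "good j' t" "t < f" "j' \<noteq> j" "v2 (of_int (j' - j)) = int f"
    and "f \<le> e" and "rel (j - 1) (j' - 1) f"
  shows "rel j j' f"
proof -
  let ?c = "int q * int f - 2 ^ f + 1"
  define \<tau> where "\<tau> = (rho j)\<^sup>2 / (1 + 2 * rho j)"
  define \<tau>' where "\<tau>' = (rho j')\<^sup>2 / (1 + 2 * rho j')"
  define a a' d :: "rat poly fract" where "a = of_int j" and "a' = of_int j'" and "d = of_int (j' - j)"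
  have d_eq: "a' = a + d" by (simp add: a_def a'_def d_def)
  have te: "t < e" using assms(1) by (simp add: good_def)
  have tq: "2 * 2 ^ t \<le> int q" by (rule two_power_le[OF te])
  have tf: "2 * 2 ^ t \<le> (2 :: int) ^ f"
    using assms(3) power_increasing[of "Suc t" f "2 :: int"] by simp
  have pos: "(1 :: int) \<le> 2 ^ t" by simp
  have q2: "2 \<le> int q" using q_ge_2 by simp
  have wd: "wge q d (int q * int f)"
    unfolding d_def using assms by (intro wge_of_int) auto
  have wX: "wge q Xf (- 1)" by (simp add: wge_def)
  note r = good_rho[OF assms(1)] and r' = good_rho[OF assms(2)]
  define u where "u = zi (j - 1)"
  define u' where "u' = zi (j' - 1)"
  have u: "u = a * (rho j - Xf)" "u' = a' * (rho j' - Xf)"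
    by (simp_all add: u_def u'_def a_def a'_def zi_pred_eq_rho)
  have main: "wge q (u' - u - 2 ^ f * Xf ^ (2 ^ f)) ?c"
    using assms(7) by (simp add: rel_def u_def u'_def)
  have wu: "wge q (u' - u) (int q * int f - 2 ^ f)"
  proof -
    have "wge q (u' - u - 2 ^ f * Xf ^ (2 ^ f)) (int q * int f - 2 ^ f)"
      using main by (rule wge_mono) simp
    moreover have "wge q (2 ^ f * Xf ^ (2 ^ f)) (int q * int f - 2 ^ f)"
      using wge_mult[OF wge_power_2 wge_Xf_power] by (rule wge_mono) simp
    ultimately have "wge q ((u' - u - 2 ^ f * Xf ^ (2 ^ f)) + 2 ^ f * Xf ^ (2 ^ f)) (int q * int f - 2 ^ f)"
      by (rule wge_add)
    then show ?thesis by simp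
  qed
  have dX: "wge q (d * Xf) (int q * int f - 2 ^ f)"
    by (rule wge_mult_le[OF wd wX]) (use tf pos in linarith)
  have dr: "wge q (d * rho j') (int q * int f - 2 ^ f)"
    by (rule wge_mult_le[OF wd r']) (use tf pos in linarith)
  \<comment> \<open>The values at \<open>j - 1\<close> and \<open>j' - 1\<close> are linear in
    \<open>rho\<close>, so the preceding relation bounds \<open>j (rho j' - rho j)\<close>, and
    through it the difference of the \<open>\<tau>\<close>.\<close>
  have "wge q ((u' - u) + d * Xf - d * rho j') (int q * int f - 2 ^ f)"
    by (rule wge_diff[OF wge_add[OF wu dX] dr])
  moreover have "(u' - u) + d * Xf - d * rho j' = a * (rho j' - rho j)"
    by (simp add: u d_eq algebra_simps)
  ultimately have ar: "wge q (a * (rho j' - rho j)) (int q * int f - 2 ^ f)"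
    by (simp only:)
  have "wge q (2 * (rho j * rho j')) (- (2 ^ t))"
    by (rule wge_mult_le[OF wge_2 wge_mult[OF r r']]) (use tq in linarith)
  with r r' have sum: "wge q (rho j + rho j' + 2 * (rho j * rho j')) (- (2 ^ t))"
    by (intro wge_add)
  have "wge q (a * (rho j' - rho j) * (rho j + rho j' + 2 * (rho j * rho j'))) (int q * int f - 2 ^ f - 2 ^ t)"
    using wge_mult[OF ar sum] by simp
  from wge_divide[OF this ratio_nz[of j]]
  have "wge q (a * (rho j' - rho j) * (rho j + rho j' + 2 * (rho j * rho j')) / (1 + 2 * rho j)) (int q * int f - 2 ^ f - 2 ^ t)"
    by (simp add: good_ratio[OF assms(1)])
  from wge_divide[OF this ratio_nz[of j']]
  have at: "wge q (a * (rho j' - rho j) * (rho j + rho j' + 2 * (rho j * rho j')) / (1 + 2 * rho j) / (1 + 2 * rho j')) (int q * int f - 2 ^ f - 2 ^ t)"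
    by (simp add: good_ratio[OF assms(2)])
  have "\<tau>' - \<tau> = (rho j' - rho j) * (rho j + rho j' + 2 * (rho j * rho j')) / (1 + 2 * rho j) / (1 + 2 * rho j')"
    using ratio_nz[of j] ratio_nz[of j'] by (simp add: \<tau>_def \<tau>'_def field_simps power2_eq_square)
  then have "a * (\<tau>' - \<tau>) = a * (rho j' - rho j) * (rho j + rho j' + 2 * (rho j * rho j')) / (1 + 2 * rho j) / (1 + 2 * rho j')"
    by (simp add: mult.assoc)
  with at have "wge q (a * (\<tau>' - \<tau>)) (int q * int f - 2 ^ f - 2 ^ t)"
    by (simp only:)
  then have t1: "wge q (2 * (a * (\<tau>' - \<tau>))) ?c"
    by (rule wge_mult_le[OF wge_2]) (use tq pos in linarith)
  have t2: "wge q (2 * (d * \<tau>')) ?c"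
    unfolding \<tau>'_def by (rule wge_mult_le[OF wge_2 wge_mult[OF wd good_tau[OF assms(2)]]])
      (use tf q2 in linarith)
  have t3: "wge q (2 * (d * Xf)) ?c"
    by (rule wge_mult_le[OF wge_2 wge_mult[OF wd wX]]) (use tf pos q2 in linarith)
  have "zi j' - zi j - 2 ^ f * Xf ^ (2 ^ f) =
      (u' - u - 2 ^ f * Xf ^ (2 ^ f)) + 2 * (d * Xf) - 2 * (d * \<tau>') - 2 * (a * (\<tau>' - \<tau>))"
  proof -
    have st: "sig j = rho j - 2 * \<tau>" "sig j' = rho j' - 2 * \<tau>'"
      by (simp_all add: sig_rho \<tau>_def \<tau>'_def)
    show ?thesis
      unfolding zi_eq_sig u a_def[symmetric] a'_def[symmetric] d_eq st
      by (simp add: algebra_simps)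
  qed
  moreover have "wge q ((u' - u - 2 ^ f * Xf ^ (2 ^ f)) + 2 * (d * Xf) - 2 * (d * \<tau>') - 2 * (a * (\<tau>' - \<tau>))) ?c"
    by (rule wge_diff[OF wge_diff[OF wge_add[OF main t3] t2] t1])
  ultimately show ?thesis unfolding rel_def by (simp only:)
qed

text \<open>As \<open>2^f\<close> exactly divides \<open>j' - j\<close>, either both valuations
  agree and lie below \<open>f\<close>, or one equals \<open>f\<close> and the other is larger. The
  former case continues the preceding relation; in the latter a single index dominates and the
  relation starts afresh.\<close>

lemma rel_step:
  assumes "good j t" "good j' t'" "j' \<noteq> j" "v2 (of_int (j' - j)) = int f"
    and "1 \<le> f" "f \<le> e" and "rel (j - 1) (j' - 1) f"
  shows "rel j j' f"
proof -
  have nz: "j \<noteq> 0" "j' \<noteq> 0" and v: "v2 (of_int j) = int t" "v2 (of_int j') = int t'"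
    using assms(1,2) by (auto simp: good_def)
  consider "t < f" | "f < t" | "t = f" by linarith
  then show ?thesis
  proof cases
    case 1
    have "v2 (of_int (j + (j' - j))) = v2 (of_int j)"
      using 1 nz v assms(4) by (intro v2_of_int_add_eq) auto
    then have "t' = t" using v by simp
    then show ?thesis using rel_shift[of j t j' f] assms 1 by simp
  next
    case 2
    have "v2 (of_int ((j' - j) + j)) = v2 (of_int (j' - j))"
      using 2 v assms(3,4) by (intro v2_of_int_add_eq) auto
    then have "t' = f" using v assms(4) by simp
    then show ?thesis
      using rel_direct[of j' f j] good_index_sig[OF assms(1) 2] assms by simp
  next
    case 3
    have "v2 (of_int j) < v2 (of_int (j + (j' - j)))"
      using 3 nz v assms(3,4) by (intro v2_of_int_add_gt) auto
    then have "f < t'" using v 3 by simp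
    moreover have "v2 (of_int (j - j')) = int f"
      using assms(4) v2_minus[of "of_int (j' - j)"] by simp
    ultimately have "rel j' j f"
      using rel_direct[of j f j'] good_index_sig[OF assms(2)] assms 3 by simp
    then show ?thesis by (rule rel_sym)
  qed
qed

lemma mod_block: "i < q \<Longrightarrow> (2 * q * h + q + i) mod (2 * q) = q + i"
  by (simp add: add.assoc)

lemma good_block:
  assumes "0 < i" "i < q"
  shows "\<exists>t. good (int (2 * q * h + q + i)) t"
proof -
  obtain t where "v2 (of_nat (2 * q * h + q + i)) = int t"
    using v2_exists assms by (metis add_gr_0)
  then have "good (int (2 * q * h + q + i)) t"
    using assms mod_block[of i h] by (intro good_interior) simp_all
  then show ?thesis by blast
qed

text \<open>Both indices move right at fixed distance \<open>D\<close>, starting with the left one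
  at the beginning of the upper half-block.\<close>

lemma rel_block_even:
  assumes "0 < D" "even D" "v2 (of_nat D) = int f" "k + D < q"
  shows "rel (int (2 * q * h + q + k)) (int (2 * q * h + q + k + D)) f"
  using assms(4)
proof (induction k)
  have D: "D < q" using assms(4) by simp
  have fe: "f < e" using v2_less_e[OF assms(1) D assms(3)] .
  have f1: "1 \<le> f"
    using power2_dvd_iff_v2[of "int D" 1] assms(1-3) by simp
  {
    case 0
    have "2 * q * h + q + D = q * (2 * h + 1) + D" by (simp add: algebra_simps)
    then have "v2 (of_nat (2 * q * h + q + D)) = int f"
      using v2_add_q[OF assms(1) D, of "2 * h + 1"] assms(3) by (simp only:)
    then have "good (int (2 * q * h + q + D)) f"
      using mod_block[OF D, of h] assms(1) by (intro good_interior) simp_all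
    \<comment> \<open>No leading term of \<open>sig\<close> is known at this index, but the index is
      divisible by \<open>q\<close>, and \<open>f < e\<close> lets the crude bound suffice.\<close>
    moreover have "wge q (of_int (int (2 * q * h + q)) * sig (int (2 * q * h + q))) (int q * int f - 2 ^ f + 1)"
    proof (rule wge_mult_le)
      have "2 ^ e dvd int (2 * q * h + q)" by (simp add: q_def)
      moreover have "int (2 * q * h + q) \<noteq> 0" using q_ge_2 by (metis of_nat_eq_0_iff add_is_0 not_numeral_le_zero)
      ultimately have "int e \<le> v2 (of_int (int (2 * q * h + q)))"
        using power2_dvd_iff_v2 by blast
      then show "wge q (of_int (int (2 * q * h + q))) (int q * int e)"
        by (intro wge_of_int disjI1 mult_left_mono) auto
      show "wge q (sig (int (2 * q * h + q))) (- int q)"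
        using q_ge_2 by (intro sig_ge) simp
      have "int q * (int f + 1) \<le> int q * int e"
        using fe by (intro mult_left_mono) auto
      then show "int q * int f - 2 ^ f + 1 \<le> int q * int e + - int q"
        using two_le_power[OF f1] by (simp add: algebra_simps)
    qed
    ultimately show ?case
      using f1 assms(1,3) by (intro rel_direct) simp_all
  next
    case (Suc k)
    have IH: "rel (int (2 * q * h + q + k)) (int (2 * q * h + q + k + D)) f"
      using Suc by simp
    obtain t where "good (int (2 * q * h + q + Suc k)) t"
      using good_block[OF zero_less_Suc, of k h] Suc.prems by auto
    moreover obtain t' where "good (int (2 * q * h + q + (Suc k + D))) t'"
      using good_block[of "Suc k + D" h] Suc.prems by blast
    ultimately show ?case
      using rel_step[of "int (2 * q * h + q + Suc k)" t "int (2 * q * h + q + Suc k + D)" t' f]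
        IH f1 fe assms(1,3) by (simp add: add.assoc)
  }
qed

lemma good_tau_lead:
  assumes "good j t"
  shows "wge q ((rho j)\<^sup>2 / (1 + 2 * rho j) - Xf ^ (2 ^ Suc t)) (1 - 2 ^ Suc t)"
proof -
  define \<tau> where "\<tau> = (rho j)\<^sup>2 / (1 + 2 * rho j)"
  have te: "t < e" using assms by (simp add: good_def)
  have pw: "(2 :: int) ^ Suc t = 2 * 2 ^ t" "(1 :: int) \<le> 2 ^ t" by simp_all
  have "wge q (rho j + Xf ^ (2 ^ t)) (- (2 ^ t))"
    using wge_add[OF good_rho[OF assms], of "Xf ^ (2 ^ t)"] wge_Xf_power[of q "2 ^ t"] by simp
  then have "wge q ((rho j - Xf ^ (2 ^ t)) * (rho j + Xf ^ (2 ^ t))) (1 - 2 ^ Suc t)"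
    using assms by (intro wge_mult_le[of q _ "1 - 2 ^ t"]) (auto simp: good_def)
  moreover have "wge q (2 * (rho j * \<tau>)) (1 - 2 ^ Suc t)"
    unfolding \<tau>_def
    by (rule wge_mult_le[OF wge_2 wge_mult[OF good_rho[OF assms] good_tau[OF assms]]])
      (use two_power_le[OF te] pw in linarith)
  ultimately have "wge q ((rho j - Xf ^ (2 ^ t)) * (rho j + Xf ^ (2 ^ t)) - 2 * (rho j * \<tau>)) (1 - 2 ^ Suc t)"
    by (rule wge_diff)
  moreover have "(rho j - Xf ^ (2 ^ t)) * (rho j + Xf ^ (2 ^ t)) - 2 * (rho j * \<tau>) = \<tau> - Xf ^ (2 ^ Suc t)"
  proof -
    have "Xf ^ (2 ^ Suc t) = (Xf ^ (2 ^ t))\<^sup>2"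
      by (simp add: power_mult[symmetric] mult.commute)
    moreover have "\<tau> * (1 + 2 * rho j) = (rho j)\<^sup>2"
      using ratio_nz[of j] by (simp add: \<tau>_def)
    then have "(rho j)\<^sup>2 = \<tau> + 2 * (rho j * \<tau>)"
      by (simp add: algebra_simps)
    ultimately show ?thesis by (simp add: algebra_simps power2_eq_square)
  qed
  ultimately show ?thesis by (simp add: \<tau>_def)
qed

text \<open>By reflection \<open>zi (- c) = zi (c - 1)\<close>, so this is one contiguous step,
  equal to \<open>2 c (\<tau> - X)\<close>. Squaring \<open>rho c\<close> doubles the exponent
  \<open>2^t\<close> just as \<open>2 c\<close> raises the valuation \<open>t\<close> by
  one.\<close>

lemma rel_centre:
  assumes "good c t"
  shows "rel c (- c) (Suc t)"
proof -
  define \<tau> where "\<tau> = (rho c)\<^sup>2 / (1 + 2 * rho c)"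
  let ?f = "Suc t"
  let ?c = "int q * int ?f - 2 ^ ?f + 1"
  have c: "c \<noteq> 0" "v2 (of_int c) = int t" using assms by (auto simp: good_def)
  then have v: "v2 (of_int (2 * c)) = int ?f" by (simp add: v2_mult)
  have w2c: "wge q (of_int (2 * c)) (int q * int ?f)"
    using v by (intro wge_of_int) (simp del: of_int_mult)
  have f1: "wge q (of_int (2 * c) * (\<tau> - Xf ^ (2 ^ ?f))) ?c"
    unfolding \<tau>_def by (rule wge_mult_le[OF w2c good_tau_lead[OF assms]]) simp
  have f2: "wge q (of_int (2 * c) * Xf ^ (2 ^ ?f) - 2 ^ ?f * Xf ^ (2 ^ ?f)) ?c"
    using c v by (intro wge_unit) simp_all
  have f3: "wge q (of_int (2 * c) * Xf) ?c"
  proof (rule wge_mult_le[OF w2c])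
    show "wge q Xf (- 1)" by (simp add: wge_def)
    have "(2 :: int) \<le> 2 ^ ?f" by (rule two_le_power) simp
    then show "?c \<le> int q * int ?f + - 1" by linarith
  qed
  have "zi (- c) - zi c - 2 ^ ?f * Xf ^ (2 ^ ?f) = of_int (2 * c) * (\<tau> - Xf ^ (2 ^ ?f))
      + (of_int (2 * c) * Xf ^ (2 ^ ?f) - 2 ^ ?f * Xf ^ (2 ^ ?f)) - of_int (2 * c) * Xf"
  proof -
    have "zi (- c) = of_int c * (rho c - Xf)"
      using zi_reflect[of "c - 1"] zi_pred_eq_rho[of c] by simp
    moreover have s: "sig c = rho c - 2 * \<tau>"
      by (simp add: sig_rho \<tau>_def)
    ultimately show ?thesis unfolding zi_eq_sig[of c] s by (simp add: algebra_simps)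
  qed
  then show ?thesis
    unfolding rel_def by (simp only: wge_diff[OF wge_add[OF f1 f2] f3])
qed

text \<open>For odd \<open>n - m\<close> the indices \<open>n\<close> and \<open>- 1 - m\<close>
  differ by \<open>n + m + 1 = 2 C\<close>; they are reached from the pair \<open>C\<close>,
  \<open>- C\<close> by \<open>k\<close> simultaneous steps.\<close>

lemma rel_block_odd:
  assumes "k < c" "c + k < q" "0 < c" "v2 (of_nat (2 * (2 * q * h + q + c))) = int f"
  shows "rel (int (2 * q * h + q + c) + int k) (- int (2 * q * h + q + c) + int k) f"
  using assms(1,2)
proof (induction k)
  obtain t where t: "good (int (2 * q * h + q + c)) t"
    using good_block[of c h] assms by fastforce
  then have te: "t < e" and vt: "v2 (of_nat (2 * q * h + q + c)) = int t"
    by (auto simp: good_def)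
  have "v2 (of_nat (2 * (2 * q * h + q + c))) = 1 + v2 (of_nat (2 * q * h + q + c))"
    unfolding of_nat_mult[of 2] using assms(3) by (subst v2_mult) (auto simp flip: of_nat_add of_nat_mult)
  then have f: "f = Suc t" using assms(4) vt by simp
  {
    case 0
    show ?case using rel_centre[OF t] f by simp
  next
    case (Suc k)
    have IH: "rel (int (2 * q * h + q + c) + int k) (- int (2 * q * h + q + c) + int k) f"
      using Suc by simp
    obtain t1 where t1: "good (int (2 * q * h + q + (c + Suc k))) t1"
      using good_block[of "c + Suc k" h] Suc.prems by blast
    obtain t2 where t2: "good (int (2 * q * h + q + (c - Suc k))) t2"
      using good_block[of "c - Suc k" h] Suc.prems by fastforce
    have j': "- int (2 * q * h + q + (c - Suc k)) = - int (2 * q * h + q + c) + int (Suc k)"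
      using Suc.prems by (simp add: of_nat_diff)
    have j: "int (2 * q * h + q + (c + Suc k)) = int (2 * q * h + q + c) + int (Suc k)"
      by simp
    let ?j = "int (2 * q * h + q + c) + int (Suc k)" and ?j' = "- int (2 * q * h + q + c) + int (Suc k)"
    have diff: "?j' - ?j = - int (2 * (2 * q * h + q + c))" by simp
    have vD: "v2 (of_int (?j' - ?j)) = int f"
      unfolding diff using assms(4) by (simp only: of_int_minus v2_minus of_int_of_nat_eq)
    have "?j' - ?j \<noteq> 0"
      unfolding diff using assms(3) by (simp only: neg_equal_0_iff_equal of_nat_eq_0_iff) simp
    then have ne: "?j' \<noteq> ?j" by (simp only: right_minus_eq not_False_eq_True)
    have "?j - 1 = int (2 * q * h + q + c) + int k" "?j' - 1 = - int (2 * q * h + q + c) + int k"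
      by simp_all
    then have prev: "rel (?j - 1) (?j' - 1) f" using IH by (simp only:)
    have g1: "good ?j t1" using t1 by (simp only: j)
    have g2: "good ?j' t2" using good_minus[OF t2] by (simp only: j')
    have f1: "1 \<le> f" "f \<le> e" using te f by auto
    show ?case by (rule rel_step[OF g1 g2 ne vD f1 prev])
  }
qed

lemma v2_of_nat_odd: "odd n \<Longrightarrow> v2 (of_nat n) = 0"
  using v2_odd[of "int n"] by simp

text \<open>One of \<open>n - m\<close> and \<open>n + m + 1\<close> is odd; the even one carries
  the whole valuation \<open>f\<close> and selects the recursion.\<close>

lemma block_difference:
  assumes "m < n" "n div (2 * q) = m div (2 * q)" "q \<le> m mod (2 * q)"
    and "v2 (of_nat ((n - m) * (n + m + 1))) = int f"
  shows "1 \<le> f" "f \<le> e"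
    "wge q (zf n - zf m - 2 ^ f * Xf ^ (2 ^ f)) (int q * int f - 2 ^ f + 1)"
proof -
  obtain h where h: "m div (2 * q) = h" by blast
  define i where "i = m mod (2 * q) - q"
  define i' where "i' = n mod (2 * q) - q"
  have lt: "n mod (2 * q) < 2 * q" "m mod (2 * q) < 2 * q" using q_ge_2 by simp_all
  have m: "m = 2 * q * h + q + i"
    using blk_mod[of m] assms(3) unfolding i_def blk_def h by linarith
  have bn: "n = 2 * q * h + n mod (2 * q)"
    using blk_mod[of n] assms(2) by (simp add: blk_def h)
  then have n: "n = 2 * q * h + q + i'"
    using m assms(1) unfolding i'_def by linarith
  have i: "i < i'" "i' < q" using m n assms(1) lt bn by linarith+
  have vsplit: "v2 (of_nat ((n - m) * (n + m + 1))) = v2 (of_nat (n - m)) + v2 (of_nat (n + m + 1))"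
    unfolding of_nat_mult using assms(1) by (subst v2_mult) (auto simp del: of_nat_add of_nat_diff)
  have "1 \<le> f \<and> f \<le> e \<and> wge q (zf n - zf m - 2 ^ f * Xf ^ (2 ^ f)) (int q * int f - 2 ^ f + 1)"
  proof (cases "even (n - m)")
    case True
    let ?D = "i' - i"
    have D: "n - m = ?D" "0 < ?D" "?D < q" using m n i by linarith+
    have "odd (n + m + 1)" using True assms(1) by simp
    then have vf: "v2 (of_nat ?D) = int f"
      using assms(4) vsplit v2_of_nat_odd[of "n + m + 1"] D by simp
    have eD: "even ?D" using True D by simp
    have "rel (int (2 * q * h + q + i)) (int (2 * q * h + q + i + ?D)) f"
      using rel_block_even[OF D(2) eD vf, of i h] i by simp
    moreover have "2 * q * h + q + i + ?D = n" using n i by linarith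
    ultimately have "rel (int m) (int n) f" using m by (metis (full_types))
    then have "wge q (zf n - zf m - 2 ^ f * Xf ^ (2 ^ f)) (int q * int f - 2 ^ f + 1)"
      by (simp add: rel_def zi_def)
    moreover have "f < e" using v2_less_e[OF D(2,3) vf] .
    moreover have "1 \<le> f"
      using power2_dvd_iff_v2[of "int ?D" 1] vf eD D by simp
    ultimately show ?thesis by simp
  next
    case False
    then have "odd (i' - i)" using m n i by (metis add_diff_cancel_left)
    then obtain k where k: "i' - i = 2 * k + 1" using oddE by blast
    \<comment> \<open>Half of \<open>i + i' + 1\<close>, the offset of the centre of
      symmetry.\<close>
    define c where "c = i + k + 1"
    have ck: "i' = c + k" "i + 1 = c - k" "k < c" "0 < c" "c + k < q"
      using k i unfolding c_def by linarith+
    have nm: "n + m + 1 = 2 * (2 * q * h + q + c)"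
      using m n ck by (simp add: c_def)
    have vf: "v2 (of_nat (2 * (2 * q * h + q + c))) = int f"
      using assms(4) vsplit v2_of_nat_odd[OF False] unfolding nm by linarith
    have "rel (int (2 * q * h + q + c) + int k) (- int (2 * q * h + q + c) + int k) f"
      using rel_block_odd[OF ck(3,5,4) vf] .
    moreover have "int (2 * q * h + q + c) + int k = int n"
      using n ck(1) by simp
    moreover have "- int (2 * q * h + q + c) + int k = - 1 - int m"
    proof -
      have "2 * q * h + q + c = m + 1 + k" using m ck(2,3) by linarith
      then show ?thesis by simp
    qed
    ultimately have "rel (int n) (- 1 - int m) f" by (simp only:)
    then have "rel (- 1 - int m) (int n) f" by (rule rel_sym)
    then have "wge q (zf n - zf m - 2 ^ f * Xf ^ (2 ^ f)) (int q * int f - 2 ^ f + 1)"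
      by (simp add: rel_def zi_reflect) (simp add: zi_def)
    moreover obtain t where t: "good (int (2 * q * h + q + c)) t"
      using good_block[of c h] ck by fastforce
    then have te: "t < e" and vt: "v2 (of_nat (2 * q * h + q + c)) = int t"
      by (auto simp: good_def)
    have "v2 (of_nat (2 * (2 * q * h + q + c))) = 1 + v2 (of_nat (2 * q * h + q + c))"
      unfolding of_nat_mult[of 2] using ck(4) by (subst v2_mult) (auto simp flip: of_nat_add of_nat_mult)
    then have "f = Suc t" using vf vt by simp
    ultimately show ?thesis using te by simp
  qed
  then show "1 \<le> f" "f \<le> e"
    "wge q (zf n - zf m - 2 ^ f * Xf ^ (2 ^ f)) (int q * int f - 2 ^ f + 1)" by auto
qed

end

section \<open>The leading term of the integral\<close>

lemma poly_ge_mono: "poly_ge q P c \<Longrightarrow> d \<le> c \<Longrightarrow> poly_ge q P d"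
  unfolding poly_ge_def by (meson add_right_mono kge_mono)

lemma poly_ge_minus [simp]: "poly_ge q (- P) c \<longleftrightarrow> poly_ge q P c"
  by (simp add: poly_ge_def)

lemma poly_ge_diff: "poly_ge q P c \<Longrightarrow> poly_ge q R c \<Longrightarrow> poly_ge q (P - R) c"
  using poly_ge_add[of q P c "- R"] by simp

lemma to_fract_smult_of_int: "to_fract (smult (of_int c) P) = of_int c * to_fract (P :: rat poly)"
proof -
  have "smult (of_int c) P = monom (of_int c) 0 * P" by (simp add: monom_0)
  then show ?thesis by (simp only: to_fract_mult of_int_fract)
qed

context dyadic_radius
begin

definition lead2 :: "nat \<Rightarrow> nat \<Rightarrow> rat poly" where
  "lead2 g a = monom (2 ^ g) a + monom (2 ^ (g + 2)) (a + 2 * q)"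

text \<open>Squaring \<open>1 + 2 X\<^sup>q\<close> leaves \<open>1 + 4 X\<^bsup>2q\<^esup>\<close> up to smaller terms.\<close>

lemma Qpoly_mult_lead2:
  assumes "q \<le> m mod (2 * q)" "q \<le> n mod (2 * q)"
  defines "g \<equiv> digit_sum (m div (2 * q)) + digit_sum (n div (2 * q))"
  shows "poly_ge q (Qpoly m * Qpoly n - lead2 g (blk m + blk n)) (om m + om n + 1)"
    and "om m + om n = int q * int g - int (blk m + blk n)"
proof -
  show om: "om m + om n = int q * int g - int (blk m + blk n)"
    using int_blk[of m] int_blk[of n] by (simp add: g_def algebra_simps)
  have em: "poly_ge q (Qpoly m - lead m) (om m + 1)" and en: "poly_ge q (Qpoly n - lead n) (om n + 1)"
    using Qpoly_lead assms by blast+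
  have lm: "poly_ge q (lead m) (om m)"
    using poly_ge_diff[OF poly_ge_Qpoly[of m] poly_ge_mono[OF em, of "om m"]] by simp
  have "poly_ge q ((Qpoly m - lead m) * Qpoly n) (om m + om n + 1)"
    using poly_ge_mult[OF em poly_ge_Qpoly[of n]] by (rule poly_ge_mono) simp
  moreover have "poly_ge q (lead m * (Qpoly n - lead n)) (om m + om n + 1)"
    using poly_ge_mult[OF lm en] by (rule poly_ge_mono) simp
  moreover have "poly_ge q (monom (2 ^ (g + 2)) (blk m + blk n + q)) (om m + om n + 1)"
    using om q_ge_2 v2_power[of 2 "g + 2"]
    by (auto simp: poly_ge_def kge_def algebra_simps)
  ultimately have "poly_ge q ((Qpoly m - lead m) * Qpoly n + lead m * (Qpoly n - lead n)
      + monom (2 ^ (g + 2)) (blk m + blk n + q)) (om m + om n + 1)"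
    by (intro poly_ge_add)
  moreover have "lead m * lead n = lead2 g (blk m + blk n) + monom (2 ^ (g + 2)) (blk m + blk n + q)"
  proof -
    let ?x = "2 ^ digit_sum (m div (2 * q)) :: rat" and ?y = "2 ^ digit_sum (n div (2 * q)) :: rat"
    have pw: "2 ^ g = ?x * ?y" "2 ^ (g + 2) = 4 * (?x * ?y)"
      by (simp_all add: g_def power_add)
    have "lead m * lead n = monom (?x * ?y) (blk m + blk n)
        + (monom (2 * (?x * ?y)) (blk m + blk n + q) + monom (2 * (?x * ?y)) (blk m + blk n + q))
        + monom (4 * (?x * ?y)) ((blk m + q) + (blk n + q))"
      by (simp add: lead_def distrib_left distrib_right mult_monom ac_simps)
    also have "(blk m + q) + (blk n + q) = blk m + blk n + 2 * q" by simp
    also have "monom (2 * (?x * ?y)) (blk m + blk n + q) + monom (2 * (?x * ?y)) (blk m + blk n + q) =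
        monom (4 * (?x * ?y)) (blk m + blk n + q)"
      by (simp add: add_monom)
    finally show ?thesis
      unfolding lead2_def pw by (simp only: ac_simps)
  qed
  ultimately show "poly_ge q (Qpoly m * Qpoly n - lead2 g (blk m + blk n)) (om m + om n + 1)"
    by (simp add: algebra_simps)
qed

lemma monom_mult_lead2: "monom 1 k * lead2 g a = lead2 g (a + k)"
  by (simp add: lead2_def mult_monom algebra_simps)

text \<open>By \<open>zf_translate\<close>, \<open>zf n - zf m\<close> is \<open>(n - m) / 2\<close>
  to leading order, and \<open>n - m\<close> cancels in \<open>Fpoly_eq_zf\<close>. The constant
  left on \<open>Fpoly\<close> is harmless: it only shifts the Newton polygon vertically.\<close>

lemma Fpoly_congruent:
  assumes "m < n" "m mod (2 * q) = n mod (2 * q)"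
  shows "poly_ge q (smult (of_int (2 * (int n + int m + 1))) (Fpoly m n) - Qpoly m * Qpoly n) (om m + om n + 1)"
proof -
  let ?o = "int n + int m + 1"
  let ?f = "v2 (of_nat (n - m))"
  have D: "0 < n - m" using assms by simp
  have "2 * q dvd n - m" using assms mod_eq_dvd_iff_nat by (metis less_imp_le)
  then have "2 ^ Suc e dvd int (n - m)"
    using of_nat_dvd_iff[of "2 * q" "n - m", where 'a = int] by (simp add: q_def)
  then have De: "int e < ?f"
    using power2_dvd_iff_v2[of "int (n - m)" "Suc e"] D by (simp del: of_nat_diff)
  let ?d = "of_nat (n - m) :: rat poly fract"
  have dnz: "?d \<noteq> 0" and wd: "wval q ?d = int q * ?f"
    using D wval_of_nat[OF D, of q] of_int_fract[of "int (n - m)"] by (auto simp del: of_nat_diff)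
  let ?G = "Qf m * Qf n"
  have "wge q (2 * (zf n - zf m) - ?d) (int q * ?f + 1)"
    using zf_translate[OF D De, of m] assms by simp
  moreover have "wge q ?G (om m + om n)"
    by (simp add: wge_def wval_mult wval_Qf)
  ultimately have "wge q ((2 * (zf n - zf m) - ?d) * ?G) (int q * ?f + 1 + (om m + om n))"
    by (rule wge_mult)
  moreover have "(2 * (zf n - zf m) - ?d) * ?G = ?d * (of_int (2 * ?o) * to_fract (Fpoly m n) - ?G)"
  proof -
    have "int n * (int n + 1) - int m * (int m + 1) = int (n - m) * ?o"
      using assms by (simp add: of_nat_diff algebra_simps)
    then have "of_int (int (n - m) * ?o) * to_fract (Fpoly m n) = (zf n - zf m) * ?G"
      using Fpoly_eq_zf[of n m] by simp
    then have "2 * ((zf n - zf m) * ?G) = ?d * (of_int (2 * ?o) * to_fract (Fpoly m n))"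
      by (simp add: algebra_simps)
    then show ?thesis by (simp add: algebra_simps)
  qed
  ultimately have "wge q (?d * (of_int (2 * ?o) * to_fract (Fpoly m n) - ?G) / ?d) (int q * ?f + 1 + (om m + om n) - wval q ?d)"
    using wge_divide[OF _ dnz] by metis
  then have "wge q (of_int (2 * ?o) * to_fract (Fpoly m n) - ?G) (om m + om n + 1)"
    using dnz by (simp add: wd ac_simps)
  then have "wge q (to_fract (smult (of_int (2 * ?o)) (Fpoly m n) - Qpoly m * Qpoly n)) (om m + om n + 1)"
    by (simp only: to_fract_diff to_fract_mult to_fract_smult_of_int Qf_def)
  then show ?thesis by (simp only: wge_to_fract)
qed

text \<open>The index \<open>m\<close> is moved to \<open>m'\<close> in the block of
  \<open>n\<close> by a multiple \<open>D\<close> of \<open>2 q\<close>. This changes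
  \<open>zf\<close> only by valuation at least \<open>q e\<close>, and since
  \<open>f \<le> e < v2 D\<close> it does not affect the valuation of
  \<open>(n - m) (n + m + 1)\<close>.\<close>

lemma zf_difference:
  assumes "m < n" "q \<le> m mod (2 * q)" "q \<le> n mod (2 * q)" "m mod (2 * q) \<noteq> n mod (2 * q)"
  obtains f where "v2 (of_nat ((n - m) * (n + m + 1))) = int f"
    "wge q (zf n - zf m - 2 ^ f * Xf ^ (2 ^ f)) (int q * int f - 2 ^ f + 1)"
proof -
  define m' where "m' = blk n + m mod (2 * q)"
  have lt: "m mod (2 * q) < 2 * q" using q_ge_2 by simp
  have m'd: "m' div (2 * q) = n div (2 * q)" "m' mod (2 * q) = m mod (2 * q)"
    using lt by (simp_all add: m'_def blk_def)
  have "m' \<noteq> n" using m'd assms(4) by metis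
  define D where "D = 2 * q * (n div (2 * q) - m div (2 * q))"
  have "m div (2 * q) \<le> n div (2 * q)" using assms(1) by (simp add: div_le_mono)
  then have "blk m + D = blk n" by (simp add: blk_def D_def flip: distrib_left)
  then have m': "m' = m + D" using blk_mod[of m] by (simp add: m'_def)
  define V where "V = (\<lambda>k. of_int (int n * (int n + 1) - int k * (int k + 1)) :: rat)"
  have V_eq: "V k = of_int ((int n - int k) * (int n + int k + 1))" for k
    unfolding V_def by (rule arg_cong[of _ _ of_int]) (simp add: algebra_simps)
  have V_nz: "V k \<noteq> 0" if "k \<noteq> n" for k
    using that unfolding V_eq of_int_eq_0_iff by auto
  have V_abs: "v2 (V k) = v2 (of_nat ((n - k) * (n + k + 1)))" if "k \<le> n" for k
    unfolding V_eq using le_Suc_ex[OF that] by (auto simp: algebra_simps)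
  obtain f where f: "v2 (V m') = int f" "1 \<le> f" "f \<le> e"
    and main: "wge q (zf n - zf m' - 2 ^ f * Xf ^ (2 ^ f)) (int q * int f - 2 ^ f + 1)"
  proof (cases "m' < n")
    case True
    obtain f where f: "v2 (of_nat ((n - m') * (n + m' + 1))) = int f"
      using v2_exists[of "(n - m') * (n + m' + 1)"] True by auto
    moreover have "q \<le> m' mod (2 * q)" using m'd assms by simp
    ultimately show ?thesis
      using block_difference[OF True m'd(1)[symmetric], of f] V_abs[of m'] True that[of f] by simp
  next
    \<comment> \<open>Although \<open>m < n\<close>, the moved index may exceed \<open>n\<close>;
      then the symmetric relation is used.\<close>
    case False
    then have lt: "n < m'" using \<open>m' \<noteq> n\<close> by simp
    obtain f where f: "v2 (of_nat ((m' - n) * (m' + n + 1))) = int f"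
      using v2_exists[of "(m' - n) * (m' + n + 1)"] lt by auto
    have b: "1 \<le> f" "f \<le> e" "wge q (zf m' - zf n - 2 ^ f * Xf ^ (2 ^ f)) (int q * int f - 2 ^ f + 1)"
      using block_difference[OF lt m'd(1) assms(3) f] by auto
    have "rel (int n) (int m') f" using b(3) by (simp add: rel_def zi_def)
    from rel_sym[OF this] have "wge q (zf n - zf m' - 2 ^ f * Xf ^ (2 ^ f)) (int q * int f - 2 ^ f + 1)"
      by (simp add: rel_def zi_def)
    moreover have "V m' = - of_nat ((m' - n) * (m' + n + 1))"
      unfolding V_eq using less_imp_add_positive[OF lt] by (auto simp: algebra_simps)
    then have "v2 (V m') = int f" using f by (simp only: v2_minus)
    ultimately show ?thesis using b that[of f] by simp
  qed
  have near: "wge q (zf m' - zf m) (int q * int f - 2 ^ f + 1) \<and> v2 (V m) = int f"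
  proof (cases "D = 0")
    case True
    then show ?thesis using m' f by simp
  next
    case False
    then have Dpos: "D > 0" by simp
    have "2 ^ Suc e dvd int D" by (simp add: D_def q_def)
    then have De: "int e < v2 (of_nat D)"
      using power2_dvd_iff_v2[of "int D" "Suc e"] Dpos by simp
    have "int q * (int e + 1) \<le> int q * v2 (of_nat D)"
      using De by (intro mult_left_mono) auto
    then have qe: "int q * int e + int q \<le> int q * v2 (of_nat D)" by (simp add: algebra_simps)
    have "wge q (2 * (zf m' - zf m) - of_nat D) (int q * int e + int q)"
      using zf_translate[OF Dpos De, of m] qe unfolding m' by (elim wge_mono) simp
    moreover have "wge q (of_nat D) (int q * int e + int q)"
      using Dpos qe by (intro wge_of_nat) auto
    ultimately have "wge q (2 * (zf m' - zf m) - of_nat D + of_nat D) (int q * int e + int q)"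
      by (rule wge_add)
    then have "wge q (2 * (zf m' - zf m)) (int q * int e + int q)" by simp
    from wge_divide[OF this two_nz] have "wge q (zf m' - zf m) (int q * int e)"
      by (simp only: nonzero_mult_div_cancel_left[OF two_nz] wval_2 add_diff_cancel_right')
    moreover have "int q * int f - 2 ^ f + 1 \<le> int q * int e"
      using mult_left_mono[of "int f" "int e" "int q"] f(3) two_le_power[OF f(2)] by simp
    ultimately have 1: "wge q (zf m' - zf m) (int q * int f - 2 ^ f + 1)" by (rule wge_mono)
    have diff: "V m = V m' + of_nat (D * (m' + m + 1))"
      unfolding V_def m' by (simp add: algebra_simps)
    have "v2 (of_nat (D * (m' + m + 1))) = v2 (of_nat D) + v2 (of_nat (m' + m + 1))"
      unfolding of_nat_mult using Dpos by (subst v2_mult) (auto simp del: of_nat_add)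
    then have "v2 (V m') < v2 (of_nat (D * (m' + m + 1)))"
      using De f v2_of_nat_nonneg[of "m' + m + 1"] by simp
    then have "v2 (V m) = int f"
      unfolding diff using v2_add_eq(2)[of "V m'" "of_nat (D * (m' + m + 1))"] V_nz[OF \<open>m' \<noteq> n\<close>] f by simp
    with 1 show ?thesis by blast
  qed
  have "wge q ((zf n - zf m' - 2 ^ f * Xf ^ (2 ^ f)) + (zf m' - zf m)) (int q * int f - 2 ^ f + 1)"
    using main near by (intro wge_add) auto
  moreover have "(zf n - zf m' - 2 ^ f * Xf ^ (2 ^ f)) + (zf m' - zf m) = zf n - zf m - 2 ^ f * Xf ^ (2 ^ f)"
    by simp
  ultimately show ?thesis
    using that[of f] near V_abs[of m] assms(1) by simp
qed

lemma Fpoly_incongruent: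
  assumes "m < n" "q \<le> m mod (2 * q)" "q \<le> n mod (2 * q)" "m mod (2 * q) \<noteq> n mod (2 * q)"
  obtains f c where "odd c"
    "poly_ge q (smult (of_int c) (Fpoly m n) - monom 1 (2 ^ f) * (Qpoly m * Qpoly n)) (om m + om n - 2 ^ f + 1)"
proof -
  obtain f where f: "v2 (of_nat ((n - m) * (n + m + 1))) = int f"
    and main: "wge q (zf n - zf m - 2 ^ f * Xf ^ (2 ^ f)) (int q * int f - 2 ^ f + 1)"
    using zf_difference[OF assms] .
  obtain d where d: "(n - m) * (n + m + 1) = 2 ^ f * (2 * d + 1)"
    using f v2_of_nat_eq_iff[of "(n - m) * (n + m + 1)" f] assms(1) by auto
  let ?c = "2 * int d + 1"
  let ?G = "Qf m * Qf n"
  let ?p = "2 ^ f :: rat poly fract"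
  have pnz: "?p \<noteq> 0" and wp: "wval q ?p = int q * int f"
    using two_nz by (simp_all add: wval_power)
  have "int n * (int n + 1) - int m * (int m + 1) = int ((n - m) * (n + m + 1))"
    using less_imp_add_positive[OF assms(1)] by (auto simp: algebra_simps)
  also have "\<dots> = 2 ^ f * ?c" unfolding d by (simp add: algebra_simps)
  finally have F: "of_int (2 ^ f * ?c) * to_fract (Fpoly m n) = (zf n - zf m) * ?G"
    using Fpoly_eq_zf[of n m] by simp
  have "wge q ?G (om m + om n)"
    by (simp add: wge_def wval_mult wval_Qf)
  with main have "wge q ((zf n - zf m - ?p * Xf ^ (2 ^ f)) * ?G) (int q * int f - 2 ^ f + 1 + (om m + om n))"
    by (rule wge_mult)
  moreover have "(zf n - zf m - ?p * Xf ^ (2 ^ f)) * ?G = ?p * (of_int ?c * to_fract (Fpoly m n) - Xf ^ (2 ^ f) * ?G)"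
    using F by (simp add: algebra_simps)
  ultimately have "wge q (?p * (of_int ?c * to_fract (Fpoly m n) - Xf ^ (2 ^ f) * ?G) / ?p)
      (int q * int f - 2 ^ f + 1 + (om m + om n) - wval q ?p)"
    using wge_divide[OF _ pnz] by metis
  then have "wge q (of_int ?c * to_fract (Fpoly m n) - Xf ^ (2 ^ f) * ?G) (om m + om n - 2 ^ f + 1)"
    unfolding wp nonzero_mult_div_cancel_left[OF pnz] by (rule wge_mono) simp
  then have "wge q (to_fract (smult (of_int ?c) (Fpoly m n) - monom 1 (2 ^ f) * (Qpoly m * Qpoly n))) (om m + om n - 2 ^ f + 1)"
    by (simp only: to_fract_diff to_fract_mult to_fract_smult_of_int to_fract_monom_1 Qf_def)
  then have "poly_ge q (smult (of_int ?c) (Fpoly m n) - monom 1 (2 ^ f) * (Qpoly m * Qpoly n)) (om m + om n - 2 ^ f + 1)"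
    by (simp only: wge_to_fract)
  then show ?thesis by (rule that[rotated]) simp
qed

lemma Fpoly_lead2:
  assumes "m < n" "q \<le> m mod (2 * q)" "q \<le> n mod (2 * q)"
  obtains c g b where "c \<noteq> 0" "poly_ge q (smult c (Fpoly m n) - lead2 g b) (int q * int g - int b + 1)"
proof -
  define g where "g = digit_sum (m div (2 * q)) + digit_sum (n div (2 * q))"
  let ?a = "blk m + blk n" and ?G = "Qpoly m * Qpoly n"
  have G: "poly_ge q (?G - lead2 g ?a) (om m + om n + 1)"
    and om: "om m + om n = int q * int g - int ?a"
    using Qpoly_mult_lead2[OF assms(2,3)] by (simp_all add: g_def)
  show ?thesis
  proof (cases "m mod (2 * q) = n mod (2 * q)")
    case True
    let ?c = "of_int (2 * (int n + int m + 1)) :: rat"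
    have "poly_ge q ((smult ?c (Fpoly m n) - ?G) + (?G - lead2 g ?a)) (om m + om n + 1)"
      by (rule poly_ge_add[OF Fpoly_congruent[OF assms(1) True] G])
    then have "poly_ge q (smult ?c (Fpoly m n) - lead2 g ?a) (int q * int g - int ?a + 1)"
      by (simp only: om) simp
    moreover have "?c \<noteq> 0" by (simp only: of_int_eq_0_iff) presburger
    ultimately show ?thesis using that by blast
  next
    case False
    obtain f c where c: "odd c"
      and F: "poly_ge q (smult (of_int c) (Fpoly m n) - monom 1 (2 ^ f) * ?G) (om m + om n - 2 ^ f + 1)"
      using Fpoly_incongruent[OF assms False] .
    have "poly_ge q (monom 1 (2 ^ f)) (- (2 ^ f))"
      by (simp add: poly_ge_def kge_def)
    from poly_ge_mult[OF this G]
    have "poly_ge q (monom 1 (2 ^ f) * (?G - lead2 g ?a)) (om m + om n - 2 ^ f + 1)"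
      by (rule poly_ge_mono) simp
    from poly_ge_add[OF F this]
    have "poly_ge q (smult (of_int c) (Fpoly m n) - lead2 g (?a + 2 ^ f)) (om m + om n - 2 ^ f + 1)"
      by (simp add: right_diff_distrib monom_mult_lead2)
    moreover have "om m + om n - 2 ^ f + 1 = int q * int g - int (?a + 2 ^ f) + 1"
      using om by simp
    moreover have "(of_int c :: rat) \<noteq> 0" using c by auto
    ultimately show ?thesis using that by metis
  qed
qed

end

section \<open>Edges of Newton polygons\<close>

lemma nu2_eq: "x \<noteq> 0 \<Longrightarrow> nu2 x = ereal (real_of_int (v2 x))"
  by (simp add: nu2_def v2_def)

lemma newton_points_altdef:
  "newton_points F = {(real k, real_of_int (v2 (coeff F k))) | k. coeff F k \<noteq> 0}"
  unfolding newton_points_def by (auto simp: nu2_eq)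

text \<open>An open half-plane together with a segment of its boundary line. Once it contains all
  Newton points it contains their hull, which then meets the line only above
  \<open>[a, b]\<close>.\<close>

lemma convex_above_segment:
  fixes s c a b :: real
  shows "convex {(x, y). c < y - s * x \<or> (y - s * x = c \<and> a \<le> x \<and> x \<le> b)}" (is "convex ?C")
proof (rule convexI)
  fix p r :: "real \<times> real" and t t' :: real
  assume p: "p \<in> ?C" and r: "r \<in> ?C" and t: "0 \<le> t" "0 \<le> t'" "t + t' = 1"
  obtain x y x' y' where [simp]: "p = (x, y)" "r = (x', y')" by (cases p; cases r) auto
  let ?\<phi> = "(t * y + t' * y') - s * (t * x + t' * x')"
  have \<phi>: "?\<phi> - c = t * (y - s * x - c) + t' * (y' - s * x' - c)"
  proof -
    have t': "t' = 1 - t" using t(3) by simp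
    show ?thesis unfolding t' by (simp add: algebra_simps)
  qed
  have ge: "0 \<le> y - s * x - c" "0 \<le> y' - s * x' - c" using p r by auto
  then have terms: "0 \<le> t * (y - s * x - c)" "0 \<le> t' * (y' - s * x' - c)" using t by auto
  have "c < ?\<phi> \<or> (?\<phi> = c \<and> a \<le> t * x + t' * x' \<and> t * x + t' * x' \<le> b)"
  proof (cases "c < ?\<phi>")
    case False
    then have z: "t * (y - s * x - c) = 0" "t' * (y' - s * x' - c) = 0"
      using terms \<phi> by linarith+
    have "a \<le> t * x + t' * x' \<and> t * x + t' * x' \<le> b"
    proof (cases "t = 0 \<or> t' = 0")
      case True
      then show ?thesis using t z p r by auto
    next
      case False
      then have "x \<in> {a..b}" "x' \<in> {a..b}" using z p r by auto
      moreover have "convex {a..b}" by simp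
      ultimately have "t *\<^sub>R x + t' *\<^sub>R x' \<in> {a..b}" using t by (meson convexD)
      then show ?thesis by simp
    qed
    then show ?thesis using \<phi> z by simp
  qed simp
  then show "t *\<^sub>R p + t' *\<^sub>R r \<in> ?C" by simp
qed

text \<open>The midpoint of the segment is tested because, wherever \<open>x0\<close> lies, one end
  of the segment is strictly on the other side of it.\<close>

lemma segment_of_slope_on_line:
  fixes F :: "rat poly" and s :: real
  defines "H \<equiv> convex hull newton_points F"
  assumes seg: "segment_of_slope (newton_polygon F) s u v"
    and below: "\<And>x y. (x, y) \<in> H \<Longrightarrow> c \<le> y - s * x"
    and p: "(x0, y0) \<in> H" "y0 - s * x0 = c"
  shows "snd u - s * fst u = c" "snd v - s * fst v = c"
proof -
  obtain ux uy vx vy where [simp]: "u = (ux, uy)" "v = (vx, vy)" by (cases u; cases v) auto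
  have lt: "ux < vx" and sl: "(vy - uy) / (vx - ux) = s"
    and sub: "closed_segment u v \<subseteq> newton_polygon F"
    using seg by (auto simp: segment_of_slope_def)
  have eq: "vy - s * vx = uy - s * ux"
    using lt sl by (auto simp: field_simps)
  define wx wy where "wx = (ux + vx) / 2" and "wy = (uy + vy) / 2"
  have "(wx, wy) = midpoint u v"
    by (simp add: midpoint_def wx_def wy_def)
  then have "(wx, wy) \<in> newton_polygon F"
    using sub by (metis midpoint_in_closed_segment subsetD)
  then have wmin: "(wx, z) \<in> H \<Longrightarrow> wy \<le> z" for z
    by (auto simp: newton_polygon_def H_def)
  have uvH: "u \<in> H" "v \<in> H"
    using sub ends_in_segment[of u v] by (auto simp: newton_polygon_def H_def)
  have w\<phi>: "wy - s * wx = uy - s * ux"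
    using eq by (simp add: wx_def wy_def field_simps)
  have wx: "ux < wx" "wx < vx" using lt by (simp_all add: wx_def)
  text \<open>Otherwise joining an end of the segment to \<open>(x0, y0)\<close> passes strictly below the midpoint.\<close>
  have key: False if a: "(ax, ay) \<in> H" "ay - s * ax = uy - s * ux" "c < uy - s * ux"
    and between: "ax < wx \<and> wx \<le> x0 \<or> x0 \<le> wx \<and> wx < ax" for ax ay
  proof -
    define t where "t = (wx - ax) / (x0 - ax)"
    have t: "0 < t" "t \<le> 1"
      using between by (auto simp: t_def field_simps zero_less_divide_iff)
    have tx: "t * (x0 - ax) = wx - ax" using between by (auto simp: t_def)
    define z where "z = (1 - t) * ay + t * y0"
    have "(1 - t) *\<^sub>R (ax, ay) + t *\<^sub>R (x0, y0) \<in> H"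
      unfolding H_def using a(1) p(1) t
      by (intro convexD[OF convex_convex_hull]) (auto simp: H_def)
    moreover have "(1 - t) *\<^sub>R (ax, ay) + t *\<^sub>R (x0, y0) = (wx, z)"
      using tx by (simp add: z_def algebra_simps)
    ultimately have "wy \<le> z" using wmin by simp
    moreover have wx_eq: "wx = ax + t * (x0 - ax)" using tx by simp
    have "z - s * wx = (1 - t) * (ay - s * ax) + t * (y0 - s * x0)"
      unfolding wx_eq z_def by (simp add: algebra_simps)
    then have "z - s * wx = (uy - s * ux) - t * ((uy - s * ux) - c)"
      unfolding a(2) p(2) by (simp add: algebra_simps)
    moreover have "0 < t * ((uy - s * ux) - c)" using t a(3) by simp
    ultimately show False using w\<phi> by linarith
  qed
  have "\<not> c < uy - s * ux"
  proof
    assume gt: "c < uy - s * ux"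
    show False
    proof (cases "wx \<le> x0")
      case True
      then show False using key[of ux uy] uvH wx gt by simp
    next
      case False
      then show False using key[of vx vy] uvH wx gt eq by simp
    qed
  qed
  moreover have "c \<le> uy - s * ux" using below uvH by simp
  ultimately show "snd u - s * fst u = c" "snd v - s * fst v = c"
    using eq by simp_all
qed

lemma closed_segment_on_line:
  fixes s c a b x y :: real
  assumes "a < b" "a \<le> x" "x \<le> b" "y = c + s * x"
  shows "(x, y) \<in> closed_segment (a, c + s * a) (b, c + s * b)"
proof -
  define t where "t = (x - a) / (b - a)"
  have t: "0 \<le> t" "t \<le> 1" using assms by (auto simp: t_def field_simps)
  have tx: "t * (b - a) = x - a" using assms by (simp add: t_def)
  then have x: "x = (1 - t) * a + t * b" by (simp add: algebra_simps)
  have "y = (1 - t) * (c + s * a) + t * (c + s * b)"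
    unfolding assms(4) x by (simp add: algebra_simps)
  then have "(x, y) = (1 - t) *\<^sub>R (a, c + s * a) + t *\<^sub>R (b, c + s * b)"
    using x by simp
  then show ?thesis using t by (auto simp: closed_segment_def)
qed

text \<open>By maximality every edge of this slope coincides with the segment between the two
  contact points. The bound is an inequality so that existence of an edge need not be settled:
  without one the length is 0.\<close>

lemma edge_length_supporting_line:
  fixes F :: "rat poly" and \<mu> :: int
  assumes q: "q > 0" and ab: "a < b"
    and nz: "coeff F a \<noteq> 0" "coeff F b \<noteq> 0"
    and on: "int q * v2 (coeff F a) - int a = \<mu>" "int q * v2 (coeff F b) - int b = \<mu>"
    and off: "\<And>k. coeff F k \<noteq> 0 \<Longrightarrow> k \<noteq> a \<Longrightarrow> k \<noteq> b \<Longrightarrow> \<mu> < int q * v2 (coeff F k) - int k"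
  shows "edge_length F (1 / real q) \<le> real (b - a)"
proof -
  define s where "s = 1 / real q"
  define c where "c = real_of_int \<mu> / real q"
  define H where "H = convex hull newton_points F"
  have pt: "real_of_int (v2 (coeff F k)) - s * real k = real_of_int (int q * v2 (coeff F k) - int k) / real q" for k
    using q by (simp add: s_def field_simps)
  let ?C = "{(x, y). c < y - s * x \<or> (y - s * x = c \<and> real a \<le> x \<and> x \<le> real b)}"
  have "newton_points F \<subseteq> ?C"
  proof
    fix z assume "z \<in> newton_points F"
    then obtain k where k: "z = (real k, real_of_int (v2 (coeff F k)))" "coeff F k \<noteq> 0"
      by (auto simp: newton_points_altdef)
    consider "k = a" | "k = b" | "k \<noteq> a" "k \<noteq> b" by blast
    then show "z \<in> ?C"
    proof cases
      case 3
      then have "real_of_int \<mu> < real_of_int (int q * v2 (coeff F k) - int k)"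
        using off[OF k(2) 3] by (simp only: of_int_less_iff)
      then have "c < real_of_int (v2 (coeff F k)) - s * real k"
        unfolding pt c_def using q by (simp add: divide_strict_right_mono)
      then show ?thesis using k by simp
    qed (use k pt[of k] on ab in \<open>simp_all add: c_def\<close>)
  qed
  then have HC: "H \<subseteq> ?C"
    unfolding H_def by (rule hull_minimal) (rule convex_above_segment)
  then have below: "c \<le> y - s * x" if "(x, y) \<in> H" for x y
    using that by force
  define pa where "pa = (real a, c + s * real a)"
  define pb where "pb = (real b, c + s * real b)"
  have "real_of_int (v2 (coeff F a)) = c + s * real a" "real_of_int (v2 (coeff F b)) = c + s * real b"
    using pt[of a] pt[of b] on by (simp_all add: c_def)
  then have "pa \<in> newton_points F" "pb \<in> newton_points F"
    using nz unfolding newton_points_altdef pa_def pb_def by force+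
  then have pH: "pa \<in> H" "pb \<in> H" by (auto simp: H_def hull_inc)
  have "closed_segment pa pb \<subseteq> newton_polygon F"
  proof
    fix z assume z: "z \<in> closed_segment pa pb"
    then have zH: "z \<in> H"
      unfolding H_def using pH closed_segment_subset[OF _ _ convex_convex_hull] by (auto simp: H_def)
    obtain t where "z = (1 - t) *\<^sub>R pa + t *\<^sub>R pb" using z by (auto simp: closed_segment_def)
    then have "snd z - s * fst z = c"
      by (simp add: pa_def pb_def algebra_simps)
    then show "z \<in> newton_polygon F"
      using zH below by (force simp: newton_polygon_def H_def[symmetric])
  qed
  then have pseg: "segment_of_slope (newton_polygon F) s pa pb"
    using ab by (auto simp: segment_of_slope_def pa_def pb_def field_simps)
  have edge: "fst v - fst u = real (b - a)" if "newton_edge F s u v" for u v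
  proof -
    have seg: "segment_of_slope (newton_polygon F) s u v"
      and max: "\<And>u' v'. segment_of_slope (newton_polygon F) s u' v' \<Longrightarrow>
        closed_segment u v \<subseteq> closed_segment u' v' \<Longrightarrow> u' = u \<and> v' = v"
      using that by (auto simp: newton_edge_def)
    have "snd pa - s * fst pa = c" by (simp add: pa_def)
    then have line: "snd u - s * fst u = c" "snd v - s * fst v = c"
      using segment_of_slope_on_line[OF seg, of c "fst pa" "snd pa"] below pH(1)
      by (auto simp: H_def)
    have "u \<in> H" "v \<in> H"
      using seg ends_in_segment[of u v]
      by (auto simp: segment_of_slope_def newton_polygon_def H_def)
    then have "u \<in> ?C" "v \<in> ?C" using HC by blast+
    then have "real a \<le> fst u" "fst u \<le> real b" "real a \<le> fst v" "fst v \<le> real b"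
      using line by (auto simp: case_prod_unfold)
    then have "(fst u, snd u) \<in> closed_segment pa pb" "(fst v, snd v) \<in> closed_segment pa pb"
      unfolding pa_def pb_def using line ab by (intro closed_segment_on_line; simp)+
    then have "closed_segment u v \<subseteq> closed_segment pa pb"
      by (intro closed_segment_subset) auto
    from max[OF pseg this] show ?thesis
      using ab by (auto simp: pa_def pb_def of_nat_diff)
  qed
  show ?thesis
  proof (cases "\<exists>u v. newton_edge F s u v")
    case True
    then obtain u v where uv: "newton_edge F s u v" by blast
    have "(THE l. \<exists>u v. newton_edge F s u v \<and> l = fst v - fst u) = real (b - a)"
      by (rule the_equality) (use edge uv edge[OF uv, symmetric] in blast)+
    with True show ?thesis by (simp add: edge_length_def s_def)
  next
    case False
    then show ?thesis by (simp add: edge_length_def s_def)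
  qed
qed

context dyadic_radius
begin

text \<open>The monomials of \<open>lead2\<close> are \<open>2 q\<close> apart and differ by 2 in
  valuation, which gives the slope \<open>1 / q\<close>; all other coefficients lie strictly above
  their line.\<close>

lemma edge_length_Ipoly:
  assumes "m < n" "q \<le> m mod (2 * q)" "q \<le> n mod (2 * q)"
  shows "edge_length (Ipoly m n) (1 / real q) \<le> real (2 * q)"
proof -
  obtain c g b where c: "c \<noteq> 0"
    and P: "poly_ge q (smult c (Fpoly m n) - lead2 g b) (int q * int g - int b + 1)"
    using Fpoly_lead2[OF assms] .
  let ?F = "coeff (Fpoly m n)"
  have kge: "kge q (c * ?F k - coeff (lead2 g b) k) (int q * int g - int b + 1 + int k)" for k
    using P by (simp add: poly_ge_def)
  have lead: "coeff (lead2 g b) k = (if k = b then 2 ^ g else if k = b + 2 * q then 2 ^ (g + 2) else 0)" for k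
    using q_ge_2 by (auto simp: lead2_def)
  \<comment> \<open>A number equal to \<open>2^i\<close> up to larger valuation has valuation
    exactly \<open>i\<close>, so the two extreme points lie on the line itself.\<close>
  have exact: "?F k \<noteq> 0 \<and> int q * v2 (?F k) = int q * int i - int q * v2 c"
    if "kge q (c * ?F k - 2 ^ i) (int q * int i + 1)" for k i
  proof -
    have "c * ?F k - 2 ^ i = 0 \<or> v2 (2 ^ i) < v2 (c * ?F k - 2 ^ i)"
    proof (cases "c * ?F k - 2 ^ i = 0")
      case False
      then have "int q * int i < int q * v2 (c * ?F k - 2 ^ i)"
        using that by (simp add: kge_def)
      then have "int i < v2 (c * ?F k - 2 ^ i)"
        using q_ge_2 by (simp only: mult_less_cancel_left_pos)
      then show ?thesis using v2_power[of 2 i] by simp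
    qed simp
    then have "c * ?F k \<noteq> 0" and vi: "v2 (c * ?F k) = v2 (2 ^ i)"
      using v2_add_eq[of "2 ^ i" "c * ?F k - 2 ^ i"] by auto
    then have nz: "?F k \<noteq> 0" and "v2 (c * ?F k) = int i"
      by (auto simp: v2_power)
    then have "v2 (?F k) = int i - v2 c"
      using c v2_mult[of c "?F k"] by simp
    with nz show ?thesis by (simp add: right_diff_distrib)
  qed
  have Fb: "?F b \<noteq> 0" "int q * v2 (?F b) = int q * int g - int q * v2 c"
    using exact[of b g] kge[of b] by (auto simp: lead algebra_simps)
  have F2: "?F (b + 2 * q) \<noteq> 0" "int q * v2 (?F (b + 2 * q)) = int q * int (g + 2) - int q * v2 c"
    using exact[of "b + 2 * q" "g + 2"] kge[of "b + 2 * q"] q_ge_2 by (auto simp: lead algebra_simps)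
  \<comment> \<open>Dividing by \<open>X\<close> lowers indices by one; the vanishing constant term
    of \<open>Fpoly\<close> ensures that \<open>b\<close> is positive.\<close>
  have "?F 0 = 0" by (simp add: Fpoly_def coeff_antideriv)
  then obtain a where b: "b = Suc a" using Fb(1) by (cases b) auto
  let ?\<mu> = "int q * int g - int q * v2 c - int a"
  have "edge_length (Ipoly m n) (1 / real q) \<le> real (a + 2 * q - a)"
  proof (rule edge_length_supporting_line)
    show "coeff (Ipoly m n) a \<noteq> 0" "coeff (Ipoly m n) (a + 2 * q) \<noteq> 0"
      "int q * v2 (coeff (Ipoly m n) a) - int a = ?\<mu>"
      "int q * v2 (coeff (Ipoly m n) (a + 2 * q)) - int (a + 2 * q) = ?\<mu>"
      using Fb F2 by (simp_all add: coeff_Ipoly b algebra_simps)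
    fix k assume k: "coeff (Ipoly m n) k \<noteq> 0" "k \<noteq> a" "k \<noteq> a + 2 * q"
    then have "coeff (lead2 g b) (Suc k) = 0" "?F (Suc k) \<noteq> 0"
      unfolding lead using b by (simp_all add: coeff_Ipoly)
    then have "kge q (c * ?F (Suc k)) (int q * int g - int b + 1 + int (Suc k))" "?F (Suc k) \<noteq> 0"
      using kge[of "Suc k"] by simp_all
    then have "int q * int g - int b + 1 + int (Suc k) \<le> int q * v2 c + int q * v2 (?F (Suc k))"
      using c v2_mult[of c "?F (Suc k)"] by (simp add: kge_def algebra_simps)
    then show "?\<mu> < int q * v2 (coeff (Ipoly m n) k) - int k"
      by (simp add: coeff_Ipoly b)
  qed (use q_ge_2 in simp_all)
  then show ?thesis by simp
qed

end

lemma bit_imp_le_mod: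
  assumes "bit n e"
  shows "2 ^ e \<le> n mod (2 * 2 ^ e :: nat)"
proof -
  have "n mod (2 ^ e * 2) = 2 ^ e * (n div 2 ^ e mod 2) + n mod 2 ^ e"
    by (rule mod_mult2_eq)
  moreover have "n div 2 ^ e mod 2 = 1"
    using assms by (simp add: bit_iff_odd odd_iff_mod_2_eq_one)
  ultimately show ?thesis by (simp add: mult.commute)
qed

theorem theorem3p1:
  fixes m n e q :: nat
  assumes "m < n"
    and "q = 2 ^ e" and "q \<ge> 2"
    and "bit m e" and "bit n e"
  shows "edge_length (Ipoly m n) (1 / real q) < 3 * real q"
proof -
  have "e \<ge> 1" using assms(2,3) by (cases e) auto
  then interpret dyadic_radius e q
    by unfold_locales (use assms in simp_all)
  have "edge_length (Ipoly m n) (1 / real q) \<le> real (2 * q)"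
    using assms bit_imp_le_mod by (intro edge_length_Ipoly) simp_all
  then show ?thesis using assms(3) by simp
qed

end
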